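(* The minimal faithful permutation degrees of the exceptional Coxeter groups of type $E$ are: (1) $\mu(W(E_6))=27$; (2) $\mu(W(E_7))=30$; (3) $\mu(W(E_8))=240$.
   Context: For a finite group $G$, $\mu(G)$ denotes the minimal faithful permutation degree of $G$: the least non-negative integer $m$ such that $G$ embeds in the symmetric group $\mathrm{Sym}(m)$. $W(E_6)$, $W(E_7)$, $W(E_8)$ denote the finite irreducible Coxeter (Weyl) groups of types $E_6$, $E_7$, $E_8$. *)

theory Defs
  imports Complex_Main "HOL-Algebra.Bij" "HOL-Algebra.Sym_Groups" "HOL-Algebra.Elementary_Groups"
begin

definition min_perm_degree :: "('a, 'b) monoid_scheme \<Rightarrow> nat" where
  "min_perm_degree G = (LEAST m. \<exists>\<phi>. \<phi> \<in> mon G (sym_group m))"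

(* Dynkin diagram of type E_n (n = 6, 7, 8) on the nodes 1..n, in Bourbaki's labelling:

       1 - 3 - 4 - 5 - 6 - 7 - 8
               |
               2

   The diagrams E_6 and E_7 are the full subgraphs on 1..6 and 1..7, so a single
   Cartan matrix serves for all three. *)
definition E_adjacent :: "nat \<Rightarrow> nat \<Rightarrow> bool" where
  "E_adjacent i j \<longleftrightarrow> {i, j} \<in> {{1, 3}, {3, 4}, {2, 4}, {4, 5}, {5, 6}, {6, 7}, {7, 8}}"

definition cartan_E :: "nat \<Rightarrow> nat \<Rightarrow> real" where
  "cartan_E i j = (if i = j then 2 else if E_adjacent i j then -1 else 0)"

(* A vector v stands for the linear combination of the simple roots \<alpha>_1, ..., \<alpha>_n
   with coefficients v 1, ..., v n; all other values of v are 0. *)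
definition root_space :: "nat \<Rightarrow> (nat \<Rightarrow> real) set" where
  "root_space n = {v. \<forall>i. i \<notin> {1..n} \<longrightarrow> v i = 0}"

(* s_i(v) = v - <v, \<alpha>_i^vee> \<alpha>_i, where <\<alpha>_j, \<alpha>_i^vee> = C i j; only the i-th coefficient changes.
   The restriction to the root space is what membership in BijGroup requires. *)
definition simple_reflection ::
    "(nat \<Rightarrow> nat \<Rightarrow> real) \<Rightarrow> nat \<Rightarrow> nat \<Rightarrow> (nat \<Rightarrow> real) \<Rightarrow> (nat \<Rightarrow> real)" where
  "simple_reflection C n i = (\<lambda>v\<in>root_space n. v(i := v i - (\<Sum>j=1..n. C i j * v j)))"

definition weyl_group :: "(nat \<Rightarrow> nat \<Rightarrow> real) \<Rightarrow> nat \<Rightarrow> ((nat \<Rightarrow> real) \<Rightarrow> (nat \<Rightarrow> real)) monoid" where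
  "weyl_group C n =
     subgroup_generated (BijGroup (root_space n)) (simple_reflection C n ` {1..n})"

definition W_E :: "nat \<Rightarrow> ((nat \<Rightarrow> real) \<Rightarrow> (nat \<Rightarrow> real)) monoid" where
  "W_E n = weyl_group cartan_E n"

(* subgroup_generated silently drops generators outside the ambient group; none is dropped here. *)
lemma simple_reflection_in_BijGroup:
  assumes i: "i \<in> {1..n}" and C: "C i i = 2"
  shows "simple_reflection C n i \<in> carrier (BijGroup (root_space n))"
proof -
  let ?V = "root_space n" and ?s = "simple_reflection C n i"
  have closed: "?s v \<in> ?V" if "v \<in> ?V" for v
    using that i by (auto simp: simple_reflection_def root_space_def)
  have invol: "?s (?s v) = v" if v: "v \<in> ?V" for v
  proof -
    define c where "c = (\<Sum>j=1..n. C i j * v j)"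
    have s: "?s v = v(i := v i - c)"
      using v by (simp add: simple_reflection_def c_def)
    have "(\<Sum>j=1..n. C i j * (v(i := v i - c)) j)
        = (\<Sum>j=1..n. C i j * v j - (if j = i then C i i * c else 0))"
      by (intro sum.cong) (auto simp: algebra_simps)
    also have "\<dots> = c - 2 * c"
      using i C by (simp add: sum_subtractf c_def)
    finally have "(\<Sum>j=1..n. C i j * (v(i := v i - c)) j) = - c"
      by simp
    then have "v(i := v i - c) \<in> ?V \<Longrightarrow> ?s (v(i := v i - c)) = v"
      unfolding simple_reflection_def restrict_def by (simp only: if_True) auto
    then show ?thesis
      using closed[OF v] unfolding s by blast
  qed
  have "bij_betw ?s ?V ?V"
    by (rule bij_betw_byWitness[where f' = ?s]) (auto simp: closed invol)
  then show ?thesis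
    by (simp add: BijGroup_def Bij_def simple_reflection_def)
qed

lemma W_E_generators:
  assumes "i \<in> {1..n}"
  shows "simple_reflection cartan_E n i \<in> carrier (W_E n)"
  using assms simple_reflection_in_BijGroup[of i n cartan_E]
  by (auto simp: W_E_def weyl_group_def carrier_subgroup_generated cartan_E_def
      intro!: generate.incl)

lemma group_W_E: "group (W_E n)"
  by (simp add: W_E_def weyl_group_def group.group_subgroup_generated group_BijGroup)

end

theory Submission
  imports Defs
begin

text \<open>
The degrees are attained by natural faithful actions. \<open>W(E8)\<close> permutes its 240 roots and \<open>W(E6)\<close> the 27 weights of
its minuscule representation. \<open>W(E7)\<close> acts on the 28 pairs of opposite weights among the 56 minuscule weights with
kernel \<open>{1, -1}\<close>; as there are 63 pairs of roots, an odd number, the sign character takes the value \<open>-1\<close> at \<open>-1\<close>, and adding two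
points on which the group acts by this character gives a faithful action of degree 30
(\<open>E6_upper_bound\<close>, \<open>E7_upper_bound\<close>, \<open>E8_upper_bound\<close>).

For the lower bounds a small permutation representation is shown to be too small to tell reflections apart.
The statements are \<open>E6_action_constant\<close>, \<open>E7_action_constant\<close> and \<open>E8_action_constant\<close>: on a set of at most 26, 27
or 119 points, respectively, all reflections act in the same way. The roots of \<open>E8\<close> are modelled in nine coordinates, in which a reflection is named by a set of two or
three of the indices \<open>0, \<dots>, 8\<close>, and products of reflections are computed by combinatorics of these sets.

For \<open>E6\<close> the essential object is the abelian group of order 27 generated by the rotations of three pairwise orthogonal
subsystems of type \<open>A2\<close>. An element that permutes the three subsystems cyclically is conjugate to an element of the
abelian group. This restricts the possible point stabilisers so much that a point not fixed by the whole abelian group forces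
27 points (\<open>large_or_fixed\<close>); and where the abelian group acts trivially, all reflections agree (\<open>all_lines_agree\<close>). For \<open>E7\<close>
it remains to exclude that the exceptional action of \<open>E6\<close> on 27 points extends, by double counting of the three-cycles in the symmetric
group on seven letters and their fixed points. For \<open>E8\<close> the symmetric group on nine letters acts. By Bochert's argument every
point among fewer than 120 is fixed by a three-cycle, and counting translates shows that it is fixed by the alternating group on at
least six letters (\<open>big_block\<close>). The reflections in triples then exclude six and seven letters, and with eight letters all
reflections agree.

Faithfulness contradicts this directly for \<open>E6\<close>. In the other types \<open>-1\<close> is in the group. If fewer than 30 points carry a
faithful representation of \<open>W(E7)\<close>, then at most 27 of them are fixed by \<open>-1\<close> and the others form at most 14 pairs; if fewer than 240 points carry one of \<open>W(E8)\<close>, the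
points that are not fixed form at most 119 pairs. Adjacent reflections that agree on pairs agree on points, as their product has order three
(\<open>moved_agree\<close>). For \<open>E7\<close> they agree everywhere; for \<open>E8\<close> they agree on the points moved by \<open>-1\<close>, on which then \<open>-1\<close>, a product of eight reflections, is trivial.
In both types this contradicts faithfulness.
\<close>

section \<open>Point stabilisers in an elementary abelian group of order 27\<close>

lemma mod3_cancel: "a < 3 \<Longrightarrow> b < 3 \<Longrightarrow> (a + 2 * b) mod 3 = 0 \<Longrightarrow> a = b" for a b :: nat
  by presburger

text \<open>The abstract shape of the group used for type \<open>E6\<close>. The elements \<open>c1, c2, c3\<close> generate an
elementary abelian group of order 27, each is inverted by its own involution, and \<open>\<rho>\<close>, of order three,
permutes them cyclically. The decisive condition is \<open>g_conj\<close>: since \<open>c2\<^sup>2\<close> is the inverse of \<open>c2\<close>, it says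
that \<open>\<rho>\<close> is conjugate under \<open>g\<close> to the element \<open>c1 c2\<^sup>-\<^sup>1\<close> of the abelian group itself.\<close>

locale permuted_torus =
  fixes Y :: "'y set" and c1 c2 c3 r1 r2 r3 \<rho> g :: "'y \<Rightarrow> 'y"
  assumes finite_Y: "finite Y"
    and closed: "\<And>y. y \<in> Y \<Longrightarrow> c1 y \<in> Y" "\<And>y. y \<in> Y \<Longrightarrow> c2 y \<in> Y" "\<And>y. y \<in> Y \<Longrightarrow> c3 y \<in> Y"
      "\<And>y. y \<in> Y \<Longrightarrow> r1 y \<in> Y" "\<And>y. y \<in> Y \<Longrightarrow> r2 y \<in> Y" "\<And>y. y \<in> Y \<Longrightarrow> r3 y \<in> Y"
      "\<And>y. y \<in> Y \<Longrightarrow> \<rho> y \<in> Y"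
    and order3: "\<And>y. c1 (c1 (c1 y)) = y" "\<And>y. c2 (c2 (c2 y)) = y" "\<And>y. c3 (c3 (c3 y)) = y"
      "\<And>y. \<rho> (\<rho> (\<rho> y)) = y"
    and commute: "\<And>y. c2 (c1 y) = c1 (c2 y)" "\<And>y. c3 (c1 y) = c1 (c3 y)" "\<And>y. c3 (c2 y) = c2 (c3 y)"
    and involution: "\<And>y. r1 (r1 y) = y" "\<And>y. r2 (r2 y) = y" "\<And>y. r3 (r3 y) = y"
    and invert: "\<And>y. r1 (c1 y) = c1 (c1 (r1 y))" "\<And>y. r1 (c2 y) = c2 (r1 y)" "\<And>y. r1 (c3 y) = c3 (r1 y)"
      "\<And>y. r2 (c1 y) = c1 (r2 y)" "\<And>y. r2 (c2 y) = c2 (c2 (r2 y))" "\<And>y. r2 (c3 y) = c3 (r2 y)"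
      "\<And>y. r3 (c1 y) = c1 (r3 y)" "\<And>y. r3 (c2 y) = c2 (r3 y)" "\<And>y. r3 (c3 y) = c3 (c3 (r3 y))"
    and cycle: "\<And>y. \<rho> (c1 y) = c2 (\<rho> y)" "\<And>y. \<rho> (c2 y) = c3 (\<rho> y)" "\<And>y. \<rho> (c3 y) = c1 (\<rho> y)"
    and g_bij: "bij_betw g Y Y"
    and g_conj: "\<And>y. \<rho> (g y) = g (c1 (c2 (c2 y)))"
begin

definition X :: "nat \<Rightarrow> nat \<Rightarrow> nat \<Rightarrow> 'y \<Rightarrow> 'y" where
  "X a b c y = (c1 ^^ a) ((c2 ^^ b) ((c3 ^^ c) y))"

lemma pow_commute:
  "c2 ((c1 ^^ a) y) = (c1 ^^ a) (c2 y)" "c3 ((c1 ^^ a) y) = (c1 ^^ a) (c3 y)"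
  "c3 ((c2 ^^ a) y) = (c2 ^^ a) (c3 y)"
  "(c2 ^^ b) ((c1 ^^ a) y) = (c1 ^^ a) ((c2 ^^ b) y)"
  "(c3 ^^ b) ((c1 ^^ a) y) = (c1 ^^ a) ((c3 ^^ b) y)"
  "(c3 ^^ b) ((c2 ^^ a) y) = (c2 ^^ a) ((c3 ^^ b) y)"
proof -
  show a1: "c2 ((c1 ^^ a) y) = (c1 ^^ a) (c2 y)" for a y by (induction a) (auto simp: commute)
  show a2: "c3 ((c1 ^^ a) y) = (c1 ^^ a) (c3 y)" for a y by (induction a) (auto simp: commute)
  show a3: "c3 ((c2 ^^ a) y) = (c2 ^^ a) (c3 y)" for a y by (induction a) (auto simp: commute)
  show "(c2 ^^ b) ((c1 ^^ a) y) = (c1 ^^ a) ((c2 ^^ b) y)" by (induction b) (auto simp: a1)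
  show "(c3 ^^ b) ((c1 ^^ a) y) = (c1 ^^ a) ((c3 ^^ b) y)" by (induction b) (auto simp: a2)
  show "(c3 ^^ b) ((c2 ^^ a) y) = (c2 ^^ a) ((c3 ^^ b) y)" by (induction b) (auto simp: a3)
qed

lemma X_add: "X a b c (X a' b' c' y) = X (a + a') (b + b') (c + c') y"
  by (simp add: X_def funpow_add pow_commute)

lemma pow_mod3:
  assumes "\<And>y. f (f (f y)) = y" shows "(f ^^ (a mod 3)) y = (f ^^ a) y"
proof -
  have "(f ^^ 3) y = y" for y using assms by (simp add: numeral_3_eq_3)
  then have "((f ^^ 3) ^^ k) y = y" for k y by (induction k) auto
  then have "(f ^^ (3 * k)) y = y" for k y by (simp add: funpow_mult mult.commute)
  then have "(f ^^ (a mod 3 + 3 * (a div 3))) y = (f ^^ (a mod 3)) y"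
    by (simp only: funpow_add o_def)
  then show ?thesis by simp
qed

lemma X_mod: "X (a mod 3) (b mod 3) (c mod 3) y = X a b c y"
  by (simp add: X_def pow_mod3 order3)

lemma X_cong: "a mod 3 = a' mod 3 \<Longrightarrow> b mod 3 = b' mod 3 \<Longrightarrow> c mod 3 = c' mod 3 \<Longrightarrow> X a b c y = X a' b' c' y"
  by (metis X_mod)

lemma X_zero [simp]: "X 0 0 0 y = y" by (simp add: X_def)

lemma X_threefold [simp]: "X (3 * a) (3 * b) (3 * c) y = y"
  using X_cong[of "3 * a" 0 "3 * b" 0 "3 * c" 0] by simp

lemma X_closed: "y \<in> Y \<Longrightarrow> X a b c y \<in> Y"
proof -
  assume "y \<in> Y"
  then have 1: "(c3 ^^ c) y \<in> Y" by (induction c) (auto intro: closed)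
  then have 2: "(c2 ^^ b) ((c3 ^^ c) y) \<in> Y" by (induction b) (auto intro: closed)
  then show ?thesis unfolding X_def by (induction a) (auto intro: closed)
qed

lemma X_eq_iff: "X a b c y = X a' b' c' y \<longleftrightarrow> X (a + 2 * a') (b + 2 * b') (c + 2 * c') y = y"
proof
  assume "X a b c y = X a' b' c' y"
  then have "X (2*a') (2*b') (2*c') (X a b c y) = X (2*a') (2*b') (2*c') (X a' b' c' y)" by simp
  then have "X (2*a' + a) (2*b' + b) (2*c' + c) y = X (3*a') (3*b') (3*c') y"
    by (simp add: X_add)
  then show "X (a + 2 * a') (b + 2 * b') (c + 2 * c') y = y" by (simp add: add.commute)
next
  assume "X (a + 2 * a') (b + 2 * b') (c + 2 * c') y = y"
  then have "X a' b' c' (X (a + 2 * a') (b + 2 * b') (c + 2 * c') y) = X a' b' c' y" by simp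
  then have "X (a' + (a + 2 * a')) (b' + (b + 2 * b')) (c' + (c + 2 * c')) y = X a' b' c' y" 
    by (simp add: X_add)
  moreover have "X (a' + (a + 2 * a')) (b' + (b + 2 * b')) (c' + (c + 2 * c')) y = X a b c y"
    by (rule X_cong) presburger+
  ultimately show "X a b c y = X a' b' c' y" by simp
qed

lemma X_r: "r1 (X a b c y) = X (2 * a) b c (r1 y)" "r2 (X a b c y) = X a (2 * b) c (r2 y)"
  "r3 (X a b c y) = X a b (2 * c) (r3 y)"
proof -
  have p: "r ((f ^^ a) y) = (f ^^ a) (r y)" if "\<And>y. r (f y) = f (r y)" for r f :: "'y \<Rightarrow> 'y" and a y
    using that by (induction a) auto
  have q: "r ((f ^^ a) y) = (f ^^ (2 * a)) (r y)" if "\<And>y. r (f y) = f (f (r y))" for r f :: "'y \<Rightarrow> 'y" and a y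
    using that by (induction a) auto
  show "r1 (X a b c y) = X (2 * a) b c (r1 y)" "r2 (X a b c y) = X a (2 * b) c (r2 y)"
    "r3 (X a b c y) = X a b (2 * c) (r3 y)"
    unfolding X_def by (simp_all only: p[of r1 c2, OF invert(2)] p[of r1 c3, OF invert(3)] p[of r2 c1, OF invert(4)]
      p[of r2 c3, OF invert(6)] p[of r3 c1, OF invert(7)] p[of r3 c2, OF invert(8)]
      q[of r1 c1, OF invert(1)] q[of r2 c2, OF invert(5)] q[of r3 c3, OF invert(9)])
qed

lemma X_rho: "\<rho> (X a b c y) = X c a b (\<rho> y)"
proof -
  have p: "\<rho> ((f ^^ a) y) = (f' ^^ a) (\<rho> y)" if "\<And>y. \<rho> (f y) = f' (\<rho> y)" for f f' :: "'y \<Rightarrow> 'y" and a y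
    using that by (induction a) auto
  show ?thesis unfolding X_def
    by (simp only: p[of c1 c2, OF cycle(1)] p[of c2 c3, OF cycle(2)] p[of c3 c1, OF cycle(3)] pow_commute)
qed

lemma X_unit: "X (Suc 0) 0 0 y = c1 y" "X 0 (Suc 0) 0 y = c2 y" "X 0 0 (Suc 0) y = c3 y"
  by (simp_all add: X_def)

lemma X_step: "c1 (X a b c y) = X (1 + a) b c y" "c2 (X a b c y) = X a (1 + b) c y"
  "c3 (X a b c y) = X a b (1 + c) y"
  using X_add[of 1 0 0 a b c y] X_add[of 0 1 0 a b c y] X_add[of 0 0 1 a b c y]
  by (simp_all add: X_unit)

lemma X_plus: "X a b c y = y \<Longrightarrow> X a' b' c' y = y \<Longrightarrow> X (a + a') (b + b') (c + c') y = y"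
  by (metis X_add)

lemma X_times2: "X a b c y = y \<Longrightarrow> X (2 * a) (2 * b) (2 * c) y = y"
  using X_plus[of a b c y a b c] by (simp add: mult_2)

text \<open>The points fixed by the whole abelian group.\<close>

definition F :: "'y set" where "F = {y \<in> Y. c1 y = y \<and> c2 y = y \<and> c3 y = y}"

text \<open>The stabiliser of \<open>y\<close> in the abelian group, as a set of exponent vectors over the field with three elements.\<close>

definition K :: "'y \<Rightarrow> (nat \<times> nat \<times> nat) set" where
  "K y = {(a, b, c). a < 3 \<and> b < 3 \<and> c < 3 \<and> X a b c y = y}"

lemma K_iff: "X a b c y = y \<longleftrightarrow> (a mod 3, b mod 3, c mod 3) \<in> K y"
  by (simp add: K_def X_mod)

text \<open>The orbit of \<open>y\<close> is regular, so it has 27 points; if there are no more, it is everything.\<close>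

lemma trivial_K_card:
  assumes "y \<in> Y" and K: "K y = {(0,0,0)}"
  shows "27 \<le> card Y" and "card Y \<le> 27 \<Longrightarrow> y' \<in> Y \<Longrightarrow> \<exists>a b c. y' = X a b c y"
proof -
  let ?f = "\<lambda>(a, b, c). X a b c y" and ?I = "{..<3::nat} \<times> {..<3::nat} \<times> {..<3::nat}"
  have inj: "inj_on ?f ?I"
  proof (rule inj_onI, clarsimp)
    fix a b c a' b' c' :: nat
    assume *: "a < 3" "b < 3" "c < 3" "a' < 3" "b' < 3" "c' < 3" "X a b c y = X a' b' c' y"
    have "((a + 2 * a') mod 3, (b + 2 * b') mod 3, (c + 2 * c') mod 3) \<in> K y"
      by (rule iffD1[OF K_iff iffD1[OF X_eq_iff *(7)]])
    then have 0: "(a + 2 * a') mod 3 = 0" "(b + 2 * b') mod 3 = 0" "(c + 2 * c') mod 3 = 0" using K by simp_all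
    show "a = a' \<and> b = b' \<and> c = c'"
      by (intro conjI mod3_cancel[OF *(1,4) 0(1)] mod3_cancel[OF *(2,5) 0(2)] mod3_cancel[OF *(3,6) 0(3)])
  qed
  have card: "card (?f ` ?I) = 27" by (subst card_image[OF inj]) simp
  have sub: "?f ` ?I \<subseteq> Y" using assms(1) by (auto intro: X_closed)
  show "27 \<le> card Y" using card_mono[OF finite_Y sub] card by simp
  assume "card Y \<le> 27" "y' \<in> Y"
  then have "?f ` ?I = Y" using card_seteq[OF finite_Y sub] card by simp
  with \<open>y' \<in> Y\<close> have "y' \<in> ?f ` ?I" by simp
  then show "\<exists>a b c. y' = X a b c y" by auto
qed

text \<open>The points \<open>y\<close>, \<open>r1 y\<close>, \<open>r2 y\<close> and \<open>r3 y\<close> have the stabilisers generated by \<open>(1,1,1)\<close>, \<open>(2,1,1)\<close>, \<open>(1,2,1)\<close> and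
\<open>(1,1,2)\<close>. These differ and are constant on orbits of the abelian group, so there are four orbits of nine points.\<close>

lemma diagonal_K_card:
  assumes y: "y \<in> Y" and K: "K y = {(0,0,0), (1,1,1), (2,2,2)}"
  shows "36 \<le> card Y"
proof -
  define s where "s = (\<lambda>j::nat. if j = 0 then y else if j = 1 then r1 y else if j = 2 then r2 y else r3 y)"
  define e where "e = (\<lambda>(j::nat) (i::nat). if j = i then 2 else 1 :: nat)"
  have ex3: "(\<exists>k<3. P k) \<longleftrightarrow> P 0 \<or> P 1 \<or> P (2::nat)" for P
      by (auto simp: less_Suc_eq numeral_3_eq_3 numeral_2_eq_2)
  have Ks: "X a b c (s j) = s j \<longleftrightarrow> (\<exists>k<3. a mod 3 = (k * e j 1) mod 3 \<and> b mod 3 = (k * e j 2) mod 3 \<and> c mod 3 = (k * e j 3) mod 3)"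
    if j: "j < 4" for a b c j
  proof -
    have base: "X a b c y = y \<longleftrightarrow> a mod 3 = 0 \<and> b mod 3 = 0 \<and> c mod 3 = 0
      \<or> a mod 3 = 1 \<and> b mod 3 = 1 \<and> c mod 3 = 1 \<or> a mod 3 = 2 \<and> b mod 3 = 2 \<and> c mod 3 = 2" for a b c
      unfolding K_iff K by blast
    have r: "X a b c (r1 y) = r1 y \<longleftrightarrow> X (2*a) b c y = y" "X a b c (r2 y) = r2 y \<longleftrightarrow> X a (2*b) c y = y"
       "X a b c (r3 y) = r3 y \<longleftrightarrow> X a b (2*c) y = y" for a b c
      by (metis X_r(1) involution(1), metis X_r(2) involution(2), metis X_r(3) involution(3))
    have double: "2 * m mod 3 = 0 \<longleftrightarrow> m mod 3 = 0" "2 * m mod 3 = 1 \<longleftrightarrow> m mod 3 = 2"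
      "2 * m mod 3 = 2 \<longleftrightarrow> m mod 3 = 1" for m :: nat
      by presburger+
    have num: "0 mod 3 = (0::nat)" "1 mod 3 = (1::nat)" "2 mod 3 = (2::nat)" "4 mod 3 = (1::nat)"
       "0 * m = (0::nat)" "1 * m = m" "2 * 1 = (2::nat)" "2 * 2 = (4::nat)" for m :: nat by auto
    consider "j = 0" | "j = 1" | "j = 2" | "j = 3" using j by linarith
    then show ?thesis
    proof cases
      case 1
      then have e: "e j 1 = 1" "e j 2 = 1" "e j 3 = 1" "s j = y" by (simp_all add: e_def s_def)
      show ?thesis unfolding e base ex3 num by blast
    next
      case 2
      then have e: "e j 1 = 2" "e j 2 = 1" "e j 3 = 1" "s j = r1 y" by (simp_all add: e_def s_def)
      show ?thesis unfolding e base r ex3 num double by blast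
    next
      case 3
      then have e: "e j 1 = 1" "e j 2 = 2" "e j 3 = 1" "s j = r2 y" by (simp_all add: e_def s_def)
      show ?thesis unfolding e base r ex3 num double by blast
    next
      case 4
      then have e: "e j 1 = 1" "e j 2 = 1" "e j 3 = 2" "s j = r3 y" by (simp_all add: e_def s_def)
      show ?thesis unfolding e base r ex3 num double by blast
    qed
  qed
  have sY: "s j \<in> Y" for j using y closed by (simp add: s_def)
  let ?f = "\<lambda>(j, a, b). X a b 0 (s j)" and ?I = "{..<4::nat} \<times> {..<3::nat} \<times> {..<3::nat}"
  have inj: "inj_on ?f ?I"
  proof (rule inj_onI, clarsimp)
    fix a b a' b' j j' :: nat
    assume *: "j < 4" "a < 3" "b < 3" "j' < 4" "a' < 3" "b' < 3" and eq: "X a b 0 (s j) = X a' b' 0 (s j')"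
    \<comment> \<open>the diagonal element attached to \<open>j'\<close> fixes the whole torus orbit of \<open>s j'\<close>\<close>
    have "X (e j' 1) (e j' 2) (e j' 3) (s j') = s j'"
      using Ks[OF *(4), of "e j' 1" "e j' 2" "e j' 3"] by (auto intro!: exI[of _ 1])
    then have "X (e j' 1) (e j' 2) (e j' 3) (X a b 0 (s j)) = X a b 0 (s j)"
      unfolding eq by (metis X_add add.commute)
    then have "X a b 0 (X (e j' 1) (e j' 2) (e j' 3) (s j)) = X a b 0 (s j)"
      by (metis X_add add.commute)
    then have "X (2*a) (2*b) (2*0) (X a b 0 (X (e j' 1) (e j' 2) (e j' 3) (s j))) = X (2*a) (2*b) (2*0) (X a b 0 (s j))"
      by simp
    moreover have "X (2*a) (2*b) (2*0) (X a b 0 z) = z" for z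
      using X_cong[of "2*a+a" 0 "2*b+b" 0 "2*0+0" 0 z] by (simp add: X_add)
    ultimately have "X (e j' 1) (e j' 2) (e j' 3) (s j) = s j" by simp
    then have "\<exists>k<3. e j' 1 mod 3 = (k * e j 1) mod 3 \<and> e j' 2 mod 3 = (k * e j 2) mod 3 \<and> e j' 3 mod 3 = (k * e j 3) mod 3"
      using Ks *(1) by blast
    moreover have "j = 0 \<or> j = 1 \<or> j = 2 \<or> j = 3" "j' = 0 \<or> j' = 1 \<or> j' = 2 \<or> j' = 3" using *(1,4) by linarith+
    ultimately have j: "j = j'" unfolding ex3 e_def by (elim disjE; hypsubst; simp)
    then have "X (a + 2*a') (b + 2*b') (0 + 2*0) (s j) = s j" using eq X_eq_iff by blast
    then obtain k where k: "k < 3" "(a + 2*a') mod 3 = (k * e j 1) mod 3" "(b + 2*b') mod 3 = (k * e j 2) mod 3" "0 = (k * e j 3) mod 3"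
      using Ks *(1) by auto
    have "k = 0 \<or> k = 1 \<or> k = 2" "e j 3 = 1 \<or> e j 3 = 2" using k(1) by (auto simp: e_def)
    then have "k = 0" using k(4) by auto
    then have 0: "(a + 2*a') mod 3 = 0" "(b + 2*b') mod 3 = 0" using k(2,3) by simp_all
    show "j = j' \<and> a = a' \<and> b = b'"
      by (intro conjI j mod3_cancel[OF *(2,5) 0(1)] mod3_cancel[OF *(3,6) 0(2)])
  qed
  have "card (?f ` ?I) = 36" by (subst card_image[OF inj]) simp
  moreover have "?f ` ?I \<subseteq> Y" using sY by (auto intro: X_closed)
  ultimately show ?thesis using card_mono[OF finite_Y] by metis
qed

end

context permuted_torus begin

text \<open>A point fixed by \<open>\<rho>\<close> has a stabiliser that is invariant under the cyclic shift of coordinates. If it does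
not contain \<open>(1,2,0)\<close>, then it lies on the diagonal: for every other vector, either the vector itself or its difference
from its shift is \<open>(1,2,0)\<close> up to shift and sign. A diagonal stabiliser needs 36 points; a trivial one makes the action
regular, and then \<open>c1 c2\<^sup>-\<^sup>1\<close> has no fixed point although its conjugate \<open>\<rho>\<close> has one.\<close>

lemma cycle_fixed:
  assumes y: "y \<in> Y" and "card Y \<le> 27" and rho: "\<rho> y = y" 
    and iff: "card {y \<in> Y. \<rho> y = y} = card {y \<in> Y. c1 y = c2 y}"
  shows "c1 y = c2 y"
proof (rule ccontr)
  assume "c1 y \<noteq> c2 y"
  then have n: "X 1 2 0 y \<noteq> y" using X_eq_iff[of 1 0 0 y 0 1 0] by (simp add: X_unit numeral_2_eq_2)
  have shift: "X c a b y = y" if "X a b c y = y" for a b c using X_rho[of a b c y] rho that by simp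
  have n1: "X 0 1 2 y \<noteq> y" "X 2 0 1 y \<noteq> y" using n shift by metis+
  have "X 0 1 2 y = y" if "X 0 2 1 y = y" using X_times2[OF that] X_cong[of 0 0 4 1 2 2 y] by simp
  moreover have "X 2 0 1 y = y" if "X 1 0 2 y = y" using X_times2[OF that] X_cong[of 2 2 0 0 4 1 y] by simp
  moreover have "X 1 2 0 y = y" if "X 2 1 0 y = y" using X_times2[OF that] X_cong[of 4 1 2 2 0 0 y] by simp
  ultimately have n2: "X 0 2 1 y \<noteq> y" "X 1 0 2 y \<noteq> y" "X 2 1 0 y \<noteq> y" using n n1 by blast+
  have diff: "X (a + 2 * c) (b + 2 * a) (c + 2 * b) y = y" if "X a b c y = y" for a b c
    using X_plus[OF that X_times2[OF shift[OF that]]] .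
  have diag: "a = b \<and> b = c" if 1: "a < 3" "b < 3" "c < 3" and 2: "X a b c y = y" for a b c
  proof (rule ccontr)
    assume neq: "\<not> (a = b \<and> b = c)"
    define a' b' c' where "a' = (a + 2 * c) mod 3" and "b' = (b + 2 * a) mod 3" and "c' = (c + 2 * b) mod 3"
    have 3: "X a' b' c' y = y" using diff[OF 2] by (simp add: X_mod a'_def b'_def c'_def)
    have no: "\<not> ((a, b, c) \<in> Z \<or> (a', b', c') \<in> Z)" if "Z = {(1,2,0), (0,1,2), (2,0,1), (0,2,1), (1,0,2), (2,1,0)}" for Z
      using 2 3 n n1 n2 unfolding that by blast
    have "a \<in> {0, 1, 2}" "b \<in> {0, 1, 2}" "c \<in> {0, 1, 2}" using 1 by auto
    then show False using neq no[OF refl] unfolding a'_def b'_def c'_def by (elim insertE emptyE) simp_all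
  qed
  have K_sub: "K y \<subseteq> {(0,0,0), (1,1,1), (2,2,2)}"
  proof (rule subsetI)
    fix v assume v: "v \<in> K y"
    then obtain a where "v = (a, a, a)" "a < 3" using diag by (auto simp: K_def)
    then show "v \<in> {(0,0,0), (1,1,1), (2,2,2)}" by auto
  qed
  have zero: "(0,0,0) \<in> K y" by (simp add: K_def)
  show False
  proof (cases "(1,1,1) \<in> K y \<or> (2,2,2) \<in> K y")
    case True
    then have "(1,1,1) \<in> K y \<and> (2,2,2) \<in> K y"
      using X_times2[of 1 1 1 y] X_times2[of 2 2 2 y] X_cong[of 4 1 4 1 4 1 y] by (auto simp: K_def)
    then have "K y = {(0,0,0), (1,1,1), (2,2,2)}" using K_sub zero by blast
    then show False using diagonal_K_card[OF y] assms(2) by simp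
  next
    case False
    then have K0: "K y = {(0,0,0)}" using K_sub zero by blast
    have "c1 y' \<noteq> c2 y'" if y': "y' \<in> Y" for y'
    proof
      assume *: "c1 y' = c2 y'"
      have "\<exists>a b c. y' = X a b c y" by (rule trivial_K_card(2)[OF y K0 assms(2) y'])
      then obtain a b c where y'_eq: "y' = X a b c y" by (elim exE) 
      have "X (1 + a) b c y = X a (1 + b) c y"
        by (rule *[unfolded y'_eq X_step])
      then have "X ((1 + a) + 2 * a) (b + 2 * (1 + b)) (c + 2 * c) y = y"
        by (rule iffD1[OF X_eq_iff])
      moreover have "X ((1 + a) + 2 * a) (b + 2 * (1 + b)) (c + 2 * c) y = X 1 2 0 y"
        by (rule X_cong) presburger+
      ultimately show False using n by simp
    qed
    then have "card {y \<in> Y. \<rho> y = y} = 0" unfolding iff by (metis (mono_tags, lifting) Collect_empty_eq card.empty)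
    then show False using y rho finite_Y by auto
  qed
qed

lemma card_fix: "card {y \<in> Y. \<rho> y = y} = card {y \<in> Y. c1 y = c2 y}"
proof -
  have e: "\<rho> (g y) = g y \<longleftrightarrow> c1 y = c2 y" if "y \<in> Y" for y
  proof -
    have "c1 (c2 (c2 y)) \<in> Y" using that closed by simp
    then have "\<rho> (g y) = g y \<longleftrightarrow> c1 (c2 (c2 y)) = y"
      unfolding g_conj by (rule inj_on_eq_iff[OF bij_betw_imp_inj_on[OF g_bij] _ that])
    also have "\<dots> \<longleftrightarrow> c1 y = c2 y" by (metis commute(1) order3(2))
    finally show ?thesis .
  qed
  have "{y \<in> Y. \<rho> y = y} = g ` {y \<in> Y. c1 y = c2 y}"
  proof (intro subset_antisym subsetI)
    fix z assume z: "z \<in> {y \<in> Y. \<rho> y = y}"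
    then obtain y where "z = g y" "y \<in> Y" using g_bij unfolding bij_betw_def by blast
    then show "z \<in> g ` {y \<in> Y. c1 y = c2 y}" using z e by blast
  next
    fix z assume "z \<in> g ` {y \<in> Y. c1 y = c2 y}"
    then obtain y where "z = g y" "y \<in> Y" "c1 y = c2 y" by blast
    then show "z \<in> {y \<in> Y. \<rho> y = y}" using e g_bij unfolding bij_betw_def by blast
  qed
  moreover have "inj_on g {y \<in> Y. c1 y = c2 y}" 
    using g_bij by (auto simp: bij_betw_def intro: inj_on_subset)
  ultimately show ?thesis by (simp add: card_image)
qed

text \<open>By conjugacy the two fixed point sets have the same size, so the inclusion of the previous lemma is an
equality. On this common set \<open>\<rho>\<close> acts trivially, which turns \<open>c1 = c2\<close> into \<open>c2 = c3\<close>; as \<open>r3\<close> commutes with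
\<open>c1\<close> and \<open>c2\<close>, the set is also invariant under \<open>r3\<close>, which turns \<open>c2 = c3\<close> into \<open>c2 = c3\<^sup>-\<^sup>1\<close>. Hence all three are trivial there.\<close>

lemma F_eq:
  assumes "card Y \<le> 27"
  shows "{y \<in> Y. c1 y = c2 y} = F" and "{y \<in> Y. \<rho> y = y} = F"
proof -
  have sub: "{y \<in> Y. \<rho> y = y} \<subseteq> {y \<in> Y. c1 y = c2 y}"
    using cycle_fixed assms card_fix by blast
  then have eq: "{y \<in> Y. \<rho> y = y} = {y \<in> Y. c1 y = c2 y}"
    using card_fix finite_Y by (intro card_seteq) auto
  have "y \<in> F" if y: "y \<in> Y" "c1 y = c2 y" for y
  proof -
    have c23: "c2 z = c3 z" if "z \<in> Y" "c1 z = c2 z" for z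
    proof -
      have "\<rho> z = z" using that eq by blast
      moreover have "\<rho> (c1 z) = \<rho> (c2 z)" using that(2) by simp
      ultimately show ?thesis by (simp add: cycle)
    qed
    have "c1 (r3 y) = c2 (r3 y)" by (simp only: invert(7,8)[symmetric] y(2))
    then have "c2 (r3 y) = c3 (r3 y)" using c23 closed(6) y(1) by simp
    then have "r3 (c2 (r3 y)) = r3 (c3 (r3 y))" by simp
    then have 2: "c2 y = c3 (c3 y)" by (simp add: invert involution)
    have 3: "c2 y = c3 y" using c23 y by simp
    then have "c3 (c3 (c3 y)) = c3 (c3 y)" using 2 by simp
    then have "c3 y = y" using 2 3 by (simp add: order3)
    then show ?thesis using y 3 unfolding F_def by auto
  qed
  then show "{y \<in> Y. c1 y = c2 y} = F" by (auto simp: F_def)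
  then show "{y \<in> Y. \<rho> y = y} = F" using eq by simp
qed

lemma F_r: "y \<in> F \<Longrightarrow> r1 y \<in> F" "y \<in> F \<Longrightarrow> r2 y \<in> F" "y \<in> F \<Longrightarrow> r3 y \<in> F"
  unfolding F_def using closed by simp_all (metis invert order3)+

lemma rho_F: "\<rho> z \<in> F \<longleftrightarrow> z \<in> F" if "z \<in> Y"
proof -
  have *: "\<rho> z \<in> F" if "z \<in> F" for z
    using that closed(7)[of z] cycle[of z] by (simp add: F_def)
  show ?thesis using *[of z] *[of "\<rho> z"] *[of "\<rho> (\<rho> z)"] by (auto simp: order3)
qed

text \<open>The involutions change the signs of single exponents and \<open>\<rho>\<close> shifts them, so an element with exactly
two nonzero exponents is conjugate to \<open>c1 c2\<^sup>-\<^sup>1\<close>, which fixes only the points of \<open>F\<close>.\<close>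

lemma no_weight_two:
  assumes "card Y \<le> 27" "y \<in> Y" "y \<notin> F" "a mod 3 \<noteq> 0" "b mod 3 \<noteq> 0"
  shows "X a b 0 y \<noteq> y" "X 0 a b y \<noteq> y" "X b 0 a y \<noteq> y"
proof -
  note rF = rho_F
  have 1: "X a b 0 y \<noteq> y" if "y \<in> Y" "y \<notin> F" "a mod 3 \<noteq> 0" "b mod 3 \<noteq> 0" for a b y
  proof
    assume *: "X a b 0 y = y"
    have F': "z \<in> F" if "z \<in> Y" "X 1 2 0 z = z" for z
      using that X_eq_iff[of 1 0 0 z 0 1 0] F_eq(1)[OF assms(1)] by (auto simp: X_unit numeral_2_eq_2)
    have "a mod 3 = 1 \<or> a mod 3 = 2" "b mod 3 = 1 \<or> b mod 3 = 2" using that(3,4) by linarith+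
    moreover have "X (a mod 3) (b mod 3) 0 y = y" using * X_mod[of a b 0 y] by simp
    moreover have "X 1 2 0 y = y" if "X 2 1 0 y = y" using X_times2[OF that] X_cong[of 4 1 2 2 0 0 y] by simp
    moreover have False if "X 1 1 0 y = y"
    proof -
      have "X 1 2 0 (r2 y) = r2 y" using X_r(2)[of 1 1 0 y] that by simp
      then have "r2 y \<in> F" by (rule F'[OF closed(5)[OF \<open>y \<in> Y\<close>]])
      then show False using F_r(2)[of "r2 y"] \<open>y \<notin> F\<close> by (simp add: involution)
    qed
    moreover have "X 1 1 0 y = y" if "X 2 2 0 y = y" using X_times2[OF that] X_cong[of 4 1 4 1 0 0 y] by simp
    ultimately show False using F' \<open>y \<in> Y\<close> \<open>y \<notin> F\<close> by (elim disjE) auto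
  qed
  show "X a b 0 y \<noteq> y" by (rule 1) (use assms in auto)
  have s: "X a b c (\<rho> z) = \<rho> z \<longleftrightarrow> X b c a z = z" for a b c z
    by (metis X_rho order3(4))
  show "X b 0 a y \<noteq> y"
    using 1[of "\<rho> y" a b] assms rF closed(7) by (simp add: s)
  show "X 0 a b y \<noteq> y"
    using 1[of "\<rho> (\<rho> y)" a b] assms rF closed(7) by (simp add: s)
qed

text \<open>Without elements of weight two the stabiliser of \<open>y\<close> is generated by \<open>c1\<close>. Its orbit has nine points, and
the images under \<open>\<rho>\<close> and \<open>\<rho>\<^sup>2\<close> have the stabilisers generated by \<open>c2\<close> and \<open>c3\<close>: together 27 points outside \<open>F\<close>.\<close>

lemma fixed_by_one:
  assumes "card Y \<le> 27" and y: "y \<in> Y" "y \<notin> F" and c: "c1 y = y"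
  shows "card Y = 27 \<and> F = {} \<and> 9 \<le> card {y \<in> Y. c1 y = y}"
proof -
  note nw = no_weight_two[OF assms(1) y]
  have c1: "X k 0 0 y = y" for k
  proof (induction k)
    case (Suc k)
    then show ?case using X_plus[of k 0 0 y 1 0 0] c by (simp add: X_unit)
  qed simp
  have K: "b mod 3 = 0 \<and> c mod 3 = 0" if *: "X 0 b c y = y" for b c
  proof -
    have 1: "X 1 b c y = y" using X_plus[OF * c1[of 1]] by simp
    have "\<not> (b mod 3 \<noteq> 0 \<and> c mod 3 \<noteq> 0)" using nw(2)[of b c] * by blast
    moreover have "\<not> (b mod 3 \<noteq> 0 \<and> c mod 3 = 0)"
      using nw(1)[of 1 b] 1 X_cong[of 1 1 b b 0 c y] by (cases "b mod 3 = 0") auto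
    moreover have "\<not> (b mod 3 = 0 \<and> c mod 3 \<noteq> 0)"
      using nw(3)[of c 1] 1 X_cong[of 1 1 0 b c c y] by (cases "c mod 3 = 0") auto
    ultimately show ?thesis by metis
  qed
  define P where "P = (\<lambda>(a, b). X 0 a b y) ` ({..<3} \<times> {..<3})"
  have "inj_on (\<lambda>(a, b). X 0 a b y) ({..<3} \<times> {..<3})"
  proof (rule inj_onI, clarsimp)
    fix a b a' b' :: nat
    assume *: "a < 3" "b < 3" "a' < 3" "b' < 3" "X 0 a b y = X 0 a' b' y"
    then have 0: "(a + 2 * a') mod 3 = 0" "(b + 2 * b') mod 3 = 0"
      using K[of "a + 2 * a'" "b + 2 * b'"] X_eq_iff[of 0 a b y 0 a' b'] by simp_all
    show "a = a' \<and> b = b'" by (intro conjI mod3_cancel[OF *(1,3) 0(1)] mod3_cancel[OF *(2,4) 0(2)])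
  qed
  then have P9: "card P = 9" unfolding P_def by (subst card_image) auto
  have PY: "P \<subseteq> Y" unfolding P_def using y by (auto intro: X_closed)
  have P1: "c1 z = z" if zP: "z \<in> P" for z
  proof -
    obtain a b where z: "z = X 0 a b y" using zP unfolding P_def by auto
    have "X (1 + 0) (0 + a) (0 + b) y = X (0 + 0) (a + 0) (b + 0) y"
      using arg_cong[OF c1[of 1], of "X 0 a b"] by (simp add: X_add)
    then show ?thesis unfolding z X_step by simp
  qed
  have P23: "c2 z \<noteq> z \<and> c3 z \<noteq> z" if zP: "z \<in> P" for z
  proof -
    obtain a b where z: "z = X 0 a b y" using zP unfolding P_def by auto
    have 0: "((1 + a) + 2 * a) mod 3 \<noteq> 0" "((1 + b) + 2 * b) mod 3 \<noteq> 0" by presburger+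
    have "X 0 ((1 + a) + 2 * a) (b + 2 * b) y \<noteq> y" by (rule notI) (use K 0(1) in metis)
    moreover have "X 0 (a + 2 * a) ((1 + b) + 2 * b) y \<noteq> y" by (rule notI) (use K 0(2) in metis)
    ultimately show ?thesis unfolding z X_step
      using X_eq_iff[of 0 "1 + a" b y 0 a b] X_eq_iff[of 0 a "1 + b" y 0 a b] by simp
  qed
  have inj: "inj \<rho>" by (rule inj_on_inverseI[of _ "\<lambda>z. \<rho> (\<rho> z)"]) (simp add: order3)
  have cards: "card (\<rho> ` P) = 9" "card (\<rho> ` \<rho> ` P) = 9"
    using P9 inj by (auto simp: card_image inj_on_def)
  have sub: "P \<union> \<rho> ` P \<union> \<rho> ` \<rho> ` P \<subseteq> Y" using PY closed by auto
  have "finite P" using PY finite_Y by (rule finite_subset)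
  then have fin: "finite P" "finite (\<rho> ` P)" "finite (\<rho> ` \<rho> ` P)" by simp_all
  have move: "c2 (\<rho> w) = \<rho> w \<longleftrightarrow> c1 w = w" "c3 (\<rho> w) = \<rho> w \<longleftrightarrow> c2 w = w"
    "c1 (\<rho> w) = \<rho> w \<longleftrightarrow> c3 w = w" for w
    using cycle[of w, symmetric] inj by (simp_all add: inj_eq)
  have R1: "c2 z = z \<and> c1 z \<noteq> z \<and> c3 z \<noteq> z" if zP: "z \<in> \<rho> ` P" for z
  proof -
    obtain w where "z = \<rho> w" "w \<in> P" using zP by (rule imageE)
    then show ?thesis using P1[of w] P23[of w] by (simp add: move)
  qed
  have R2: "c3 z = z \<and> c1 z \<noteq> z \<and> c2 z \<noteq> z" if zP: "z \<in> \<rho> ` \<rho> ` P" for z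
  proof -
    obtain w where "z = \<rho> w" "w \<in> \<rho> ` P" using zP by (rule imageE)
    then show ?thesis using R1[of w] by (simp add: move)
  qed
  have "P \<inter> \<rho> ` P = {}" "(P \<union> \<rho> ` P) \<inter> \<rho> ` \<rho> ` P = {}" using R1 R2 P1 P23 by blast+
  then have card: "card (P \<union> \<rho> ` P \<union> \<rho> ` \<rho> ` P) = 27"
    using cards P9 fin by (simp add: card_Un_disjoint)
  have "F \<inter> (P \<union> \<rho> ` P \<union> \<rho> ` \<rho> ` P) = {}" using R1 R2 P1 P23 unfolding F_def by blast
  moreover have "P \<union> \<rho> ` P \<union> \<rho> ` \<rho> ` P = Y" using card_seteq[OF finite_Y sub] card assms(1) by simp
  ultimately have "F = {}" unfolding F_def by blast
  moreover have "card Y = 27" using card_mono[OF finite_Y sub] card assms(1) by simp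
  moreover have "card P \<le> card {y \<in> Y. c1 y = y}" using PY P1 finite_Y by (intro card_mono) auto
  ultimately show ?thesis using P9 by simp
qed

text \<open>Outside \<open>F\<close> the stabiliser is generated by one of the \<open>ci\<close>, or it is trivial, or it is spanned by a vector
without zero entries. The last kind becomes diagonal after applying involutions and needs 36 points. If
it is trivial, \<open>Y\<close> is a regular orbit and \<open>\<rho> y\<close> is the translate of \<open>y\<close> by some vector; this vector has sum zero as
\<open>\<rho>\<close> has order three, so it is a coboundary and a translate of \<open>y\<close> is fixed by \<open>\<rho>\<close>.\<close>

lemma large_or_fixed:
  assumes Y: "card Y \<le> 27" and "F \<noteq> Y"
  shows "card Y = 27 \<and> F = {} \<and> 9 \<le> card {y \<in> Y. c1 y = y}"
proof -
  obtain y where y: "y \<in> Y" "y \<notin> F" using assms(2) by (auto simp: F_def)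
  note rF = rho_F closed(7)
  show ?thesis
  proof (cases "c1 y = y \<or> c2 y = y \<or> c3 y = y")
    case True
    then show ?thesis
    proof (elim disjE)
      assume "c1 y = y" then show ?thesis using fixed_by_one[OF Y y] by blast
    next
      assume "c2 y = y"
      then have "c1 (\<rho> (\<rho> y)) = \<rho> (\<rho> y)" using cycle by metis
      then show ?thesis using fixed_by_one[OF Y, of "\<rho> (\<rho> y)"] y rF by blast
    next
      assume "c3 y = y"
      then have "c1 (\<rho> y) = \<rho> y" using cycle by metis
      then show ?thesis using fixed_by_one[OF Y, of "\<rho> y"] y rF by blast
    qed
  next
    case False
    have w1: "a mod 3 = 0" if "X a 0 0 y = y \<or> X 0 a 0 y = y \<or> X 0 0 a y = y" for a
    proof (rule ccontr)
      assume "a mod 3 \<noteq> 0"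
      then have "a mod 3 = 1 \<or> 2 * a mod 3 = 1" by presburger
      then have "X 1 0 0 y = y \<or> X 0 1 0 y = y \<or> X 0 0 1 y = y"
        using that X_times2[of a 0 0 y] X_times2[of 0 a 0 y] X_times2[of 0 0 a y]
          X_mod[of a 0 0 y] X_mod[of 0 a 0 y] X_mod[of 0 0 a y]
          X_mod[of "2*a" 0 0 y] X_mod[of 0 "2*a" 0 y] X_mod[of 0 0 "2*a" y] by auto
      then show False using False by (simp add: X_unit)
    qed
    note nw = no_weight_two[OF Y y]
    have small: "a mod 3 = 0 \<and> b mod 3 = 0" if "X 0 a b y = y" for a b
    proof -
      have "\<not> (a mod 3 \<noteq> 0 \<and> b mod 3 \<noteq> 0)" using nw(2)[of a b] that by blast
      moreover have "\<not> (a mod 3 \<noteq> 0 \<and> b mod 3 = 0)" using w1[of a] that X_cong[of 0 0 a a 0 b y] by (cases "a mod 3 = 0") auto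
      moreover have "\<not> (a mod 3 = 0 \<and> b mod 3 \<noteq> 0)" using w1[of b] that X_cong[of 0 0 0 a b b y] by (cases "b mod 3 = 0") auto
      ultimately show ?thesis by metis
    qed
    have False
    proof (cases "K y = {(0,0,0)}")
      case True
      have card27: "card Y = 27" using trivial_K_card(1)[OF y(1) True] Y by simp
      have "\<exists>a b c. \<rho> y = X a b c y"
        by (rule trivial_K_card(2)[OF y(1) True Y closed(7)[OF y(1)]])
      then obtain a b c where r: "\<rho> y = X a b c y" by (elim exE)
      have "\<rho> (\<rho> (\<rho> y)) = X (a + b + c) (a + b + c) (a + b + c) y"
        by (simp add: r X_rho X_add ac_simps)
      then have "X (a + b + c) (a + b + c) (a + b + c) y = y" by (simp add: order3)
      then have s: "(a + b + c) mod 3 = 0" using True K_iff[of "a+b+c" "a+b+c" "a+b+c" y] by simp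
      \<comment> \<open>the exponents \<open>(0, b, 2a)\<close> solve the equation saying that the translate is fixed by \<open>\<rho>\<close>\<close>
      have "\<rho> (X 0 b (2 * a) y) = X (3 * a) b (b + c) y" by (simp add: r X_rho X_add)
      also have "\<dots> = X 0 b (2 * a) y" using s by (intro X_cong; presburger)
      finally have "X 0 b (2 * a) y \<in> F" using F_eq(2)[OF Y] X_closed[OF y(1)] by blast
      then have "X 1 b (2 * a) y = X 0 b (2 * a) y" by (simp add: F_def X_step)
      then have "X (1 + 2 * 0) (b + 2 * b) (2 * a + 2 * (2 * a)) y = y" using X_eq_iff by blast
      then show False using True K_iff[of 1 "b + 2*b" "2*a + 2*(2*a)" y] by simp
    next
      case False
      moreover have "(0,0,0) \<in> K y" by (simp add: K_def)
      ultimately obtain v where "v \<in> K y" "v \<noteq> (0,0,0)" by auto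
      then obtain a b c where abc: "X a b c y = y" "a < 3" "b < 3" "c < 3" "\<not> (a = 0 \<and> b = 0 \<and> c = 0)"
        by (cases v) (auto simp: K_def)
      have "a \<noteq> 0" using small[of b c] abc by (cases "a = 0") auto
      moreover have "b \<noteq> 0"
        using nw(3)[of c a] w1[of a] abc \<open>a \<noteq> 0\<close> by (cases "b = 0"; cases "c = 0") auto
      moreover have "c \<noteq> 0"
        using nw(1)[of a b] abc \<open>a \<noteq> 0\<close> \<open>b \<noteq> 0\<close> by (cases "c = 0") auto
      ultimately have cases: "a = 1 \<or> a = 2" "b = 1 \<or> b = 2" "c = 1 \<or> c = 2" using abc by linarith+
      \<comment> \<open>the involutions change the signs, so a stabiliser element of full weight may be taken diagonal\<close>
      define z1 where "z1 = (if a = 1 then y else r1 y)"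
      define z2 where "z2 = (if b = 1 then z1 else r2 z1)"
      define z where "z = (if c = 1 then z2 else r3 z2)"
      have inj: "r1 u = r1 v \<longleftrightarrow> u = v" "r2 u = r2 v \<longleftrightarrow> u = v" "r3 u = r3 v \<longleftrightarrow> u = v" for u v
        by (metis involution(1), metis involution(2), metis involution(3))
      have flip: "X i j k (r1 w) = r1 w \<longleftrightarrow> X (2 * i) j k w = w"
        "X i j k (r2 w) = r2 w \<longleftrightarrow> X i (2 * j) k w = w" "X i j k (r3 w) = r3 w \<longleftrightarrow> X i j (2 * k) w = w" for i j k w
        using X_r(1)[of i j k "r1 w"] X_r(2)[of i j k "r2 w"] X_r(3)[of i j k "r3 w"]
          inj(1)[of "X i j k (r1 w)" "r1 w"] inj(2)[of "X i j k (r2 w)" "r2 w"] inj(3)[of "X i j k (r3 w)" "r3 w"]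
        by (simp_all add: involution)
      have sgn: "X i j k z = z \<longleftrightarrow> X (a * i) (b * j) (c * k) y = y" for i j k
        using cases by (auto simp: z_def z2_def z1_def flip)
      have zY: "z \<in> Y" using y closed by (simp add: z_def z2_def z1_def)
      have diag: "X 1 1 1 z = z" "X 2 2 2 z = z" 
        using X_times2[OF abc(1)] by (simp_all add: sgn abc(1) mult.commute[of _ 2])
      have "K z = {(0,0,0), (1,1,1), (2,2,2)}"
      proof (intro subset_antisym subsetI)
        fix v assume "v \<in> K z"
        then obtain i j k where v: "v = (i, j, k)" "i < 3" "j < 3" "k < 3" "X i j k z = z" by (auto simp: K_def)
        have "X (2 * i) (2 * i) (2 * i) z = z"
        proof -
          have "i = 0 \<or> i = 1 \<or> i = 2" using v(2) by linarith
          then show ?thesis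
            using diag X_cong[of 4 1 4 1 4 1 z] by (elim disjE; hypsubst; simp)
        qed
        then have "X (i + 2 * i) (j + 2 * i) (k + 2 * i) z = z" using X_plus v(5) by blast
        then have "X (a * (i + 2 * i)) (b * (j + 2 * i)) (c * (k + 2 * i)) y = y" by (simp only: sgn)
        moreover have "X (a * (i + 2 * i)) (b * (j + 2 * i)) (c * (k + 2 * i)) y = X 0 (b * (j + 2 * i)) (c * (k + 2 * i)) y"
          by (rule X_cong) (auto simp: algebra_simps)
        ultimately have "b * (j + 2 * i) mod 3 = 0 \<and> c * (k + 2 * i) mod 3 = 0" by (intro small) simp
        then have 0: "(j + 2 * i) mod 3 = 0" "(k + 2 * i) mod 3 = 0" using cases by (elim disjE; simp; presburger)+
        have "j = i" by (rule mod3_cancel[OF v(3,2) 0(1)])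
        moreover have "k = i" by (rule mod3_cancel[OF v(4,2) 0(2)])
        ultimately show "v \<in> {(0,0,0), (1,1,1), (2,2,2)}" using v by auto
      next
        fix v assume "v \<in> {(0::nat,0::nat,0::nat), (1,1,1), (2,2,2)}"
        then show "v \<in> K z" using diag by (auto simp: K_def)
      qed
      then show False using diagonal_K_card[OF zY] Y by simp
    qed
    then show ?thesis ..
  qed
qed

end

section \<open>The lines spanned by roots\<close>

text \<open>In the space of vectors in \<open>\<real>\<^sup>9\<close> with coordinate sum zero, the roots of \<open>E8\<close> are up to sign the vectors \<open>e\<^sub>i - e\<^sub>j\<close> and
\<open>e\<^sub>i + e\<^sub>j + e\<^sub>k - (e\<^sub>0 + \<dots> + e\<^sub>8)/3\<close>. The line spanned by such a root is written as the set \<open>{i, j}\<close> or \<open>{i, j, k}\<close>.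
Two different lines are adjacent when they are not orthogonal; the inner product of two triples is
the size of their intersection minus one.\<close>

definition adjacent :: "nat set \<Rightarrow> nat set \<Rightarrow> bool" where
  "adjacent R Q \<longleftrightarrow> (if card R = 3 \<and> card Q = 3 then card (R \<inter> Q) \<in> {0, 2} else card (R \<inter> Q) = 1)"

text \<open>Two adjacent lines span a plane containing exactly one more line of roots.\<close>

definition third :: "nat set \<Rightarrow> nat set \<Rightarrow> nat set" where
  "third R Q = (if R \<inter> Q = {} then {..<9} - (R \<union> Q) else (R - Q) \<union> (Q - R))"

text \<open>The image of the line \<open>Q\<close> under the reflection that negates the line \<open>R\<close>.\<close>

definition star :: "nat set \<Rightarrow> nat set \<Rightarrow> nat set" where
  "star R Q = (if adjacent R Q then third R Q else Q)"

text \<open>The systems \<open>E6\<close> and \<open>E7\<close> consist of the roots of \<open>E8\<close> that are constant on the coordinates from \<open>n\<close> on.\<close>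

definition root_lines :: "nat \<Rightarrow> nat set set" where
  "root_lines n = {R. R \<subseteq> {..<9} \<and> card R \<in> {2, 3} \<and>
     (R \<inter> {n..<9} = {} \<or> {n..<9} \<subseteq> R \<and> (card R = 3 \<or> n = 8))}"

lemma nine: "{..<9::nat} = {0,1,2,3,4,5,6,7,8}" by auto

lemma upto9: "{6..<9::nat} = {6,7,8}" "{7..<9::nat} = {7,8}" "{8..<9::nat} = {8}" by auto

lemma adjacent_commute: "adjacent R Q = adjacent Q R"
  by (auto simp: adjacent_def Int_commute)

lemma third_commute: "third R Q = third Q R"
  by (auto simp: third_def)

lemmas star_eval = star_def adjacent_def third_def nine insert_Diff_if
lemmas lines_eval = root_lines_def upto9

lemma root_lines_6_7: "root_lines 6 \<subseteq> root_lines 7"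
proof
  fix R assume "R \<in> root_lines 6"
  moreover have "{6..<9::nat} = insert 6 {7..<9}" by auto
  ultimately show "R \<in> root_lines 7" by (auto simp: root_lines_def)
qed

declare One_nat_def [simp del]

text \<open>An action of a symmetric group given through its transpositions. Here and in the actions below,
equations hold on the whole type and only closure refers to \<open>Y\<close>; so they
pass to invariant subsets and to images of sets of points without further conditions.\<close>

locale transposition_action =
  fixes N :: nat and Y :: "'y set" and t :: "nat set \<Rightarrow> 'y \<Rightarrow> 'y"
  assumes finite_Y: "finite Y"
    and t_closed: "\<And>i j y. \<lbrakk>i < N; j < N; i \<noteq> j; y \<in> Y\<rbrakk> \<Longrightarrow> t {i, j} y \<in> Y"
    and t_invol: "\<And>i j y. \<lbrakk>i < N; j < N; i \<noteq> j\<rbrakk> \<Longrightarrow> t {i, j} (t {i, j} y) = y"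
    and t_transpose: "\<And>a b i j y. \<lbrakk>a < N; b < N; i < N; j < N; a \<noteq> b; i \<noteq> j\<rbrakk>
                   \<Longrightarrow> t {a, b} (t {i, j} y) = t {transpose a b i, transpose a b j} (t {a, b} y)"
begin

lemma t_conj: "\<lbrakk>i < N; j < N; k < N; i \<noteq> j; i \<noteq> k; j \<noteq> k\<rbrakk> \<Longrightarrow> t {i, j} (t {j, k} y) = t {i, k} (t {i, j} y)"
  using t_transpose[of i j j k y] by simp

lemma t_comm: "\<lbrakk>i < N; j < N; k < N; l < N; i \<noteq> j; k \<noteq> l; {i, j} \<inter> {k, l} = {}\<rbrakk>
                   \<Longrightarrow> t {i, j} (t {k, l} y) = t {k, l} (t {i, j} y)"
  using t_transpose[of i j k l y] by (simp add: transpose_def)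

text \<open>Equivalently, the alternating group on \<open>B\<close> fixes \<open>y\<close>: the transpositions in \<open>B\<close> all have the same effect on \<open>y\<close> exactly
when the products of two of them fix \<open>y\<close>.\<close>

definition alt :: "'y \<Rightarrow> nat set \<Rightarrow> bool" where
  "alt y B \<longleftrightarrow> B \<subseteq> {..<N} \<and> (\<exists>v. \<forall>i\<in>B. \<forall>j\<in>B. i \<noteq> j \<longrightarrow> t {i, j} y = v)"

lemma altD: "alt y B \<Longrightarrow> i \<in> B \<Longrightarrow> j \<in> B \<Longrightarrow> k \<in> B \<Longrightarrow> l \<in> B \<Longrightarrow> i \<noteq> j \<Longrightarrow> k \<noteq> l \<Longrightarrow> t {i, j} y = t {k, l} y"
  unfolding alt_def by metis

lemma alt_subset: "alt y B \<Longrightarrow> C \<subseteq> B \<Longrightarrow> alt y C"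
  unfolding alt_def by (meson subset_iff)

lemma clique:
  assumes "i < N" "j < N" "k < N" "i \<noteq> j" "i \<noteq> k" "j \<noteq> k" "t {i, j} y = v" "t {j, k} y = v"
  shows "t {i, k} y = v"
proof -
  have "t {i, j} v = y" "t {j, k} v = y"
    using t_invol[OF assms(1,2,4), of y] t_invol[OF assms(2,3,6), of y] assms(7,8) by simp_all
  then show ?thesis using t_conj[OF assms(1-6), of v] assms(7) by simp
qed

lemma alt_triple:
  assumes "i < N" "j < N" "k < N" "i \<noteq> j" "i \<noteq> k" "j \<noteq> k" "t {i, j} y = t {j, k} y"
  shows "alt y {i, j, k}"
proof -
  have "t {i, k} y = t {j, k} y" by (rule clique[OF assms(1-6) assms(7) refl])
  then have "\<forall>a\<in>{i, j, k}. \<forall>b\<in>{i, j, k}. a \<noteq> b \<longrightarrow> t {a, b} y = t {j, k} y"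
    using assms(7) by (simp add: insert_commute)
  then show ?thesis using assms(1-3) unfolding alt_def by auto
qed

lemma alt_shift:
  assumes alt: "alt y {x, u, w}" and dist: "distinct [x, u, w, a]" and a: "a < N"
  shows "t {x, u} (t {u, w} (t {x, a} y)) = t {u, a} y"
proof -
  have N: "x < N" "u < N" "w < N" using alt by (auto simp: alt_def)
  have y: "t {x, u} (t {u, w} y) = y"
    using altD[OF alt, of x u u w] t_invol[of x u y] N dist by auto
  have "t {x, u} (t {u, w} (t {x, a} y)) = t {x, u} (t {x, a} (t {u, w} y))"
    using t_comm[of u w x a y] N a dist by auto
  also have "\<dots> = t {u, a} (t {x, u} (t {u, w} y))"
    using t_conj[of u x a "t {u, w} y"] N a dist by (auto simp: insert_commute)
  finally show ?thesis using y by simp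
qed

lemma alt_fix:
  assumes alt: "alt y {x, u, w}" and dist: "distinct [x, u, w, a, b]" and a: "a < N" "b < N"
  shows "t {x, u} (t {u, w} (t {a, b} y)) = t {a, b} y"
proof -
  have N: "x < N" "u < N" "w < N" using alt by (auto simp: alt_def)
  have y: "t {x, u} (t {u, w} y) = y"
    using altD[OF alt, of x u u w] t_invol[of x u y] N dist by auto
  have "t {x, u} (t {u, w} (t {a, b} y)) = t {a, b} (t {x, u} (t {u, w} y))"
    using t_comm[of u w a b y] t_comm[of x u a b "t {u, w} y"] N a dist by auto
  then show ?thesis using y by simp
qed

text \<open>Alternating groups on two overlapping sets generate the one on the union. If the sets share only \<open>x\<close>,
a three-cycle of \<open>B\<close> fixes the image of \<open>y\<close> under the transpositions inside \<open>B'\<close> and moves the transposition \<open>{x, a}\<close>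
to \<open>{u, a}\<close>; this links elements of different sets.\<close>

lemma alt_Un:
  assumes B: "alt y B" "3 \<le> card B" and B': "alt y B'" "3 \<le> card B'" and "B \<inter> B' \<noteq> {}"
  shows "alt y (B \<union> B')"
proof -
  have fin: "finite B" "finite B'" using B(2) B'(2) card.infinite by fastforce+
  have BN: "B \<subseteq> {..<N}" "B' \<subseteq> {..<N}" using B B' by (auto simp: alt_def)
  obtain v where "\<forall>i\<in>B. \<forall>j\<in>B. i \<noteq> j \<longrightarrow> t {i, j} y = v" using B(1) unfolding alt_def by (elim conjE exE)
  then have v: "t {i, j} y = v" if "i \<in> B" "j \<in> B" "i \<noteq> j" for i j using that by simp
  obtain v' where "\<forall>i\<in>B'. \<forall>j\<in>B'. i \<noteq> j \<longrightarrow> t {i, j} y = v'" using B'(1) unfolding alt_def by (elim conjE exE)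
  then have v': "t {i, j} y = v'" if "i \<in> B'" "j \<in> B'" "i \<noteq> j" for i j using that by simp
  obtain x where x: "x \<in> B" "x \<in> B'" using assms(5) by blast
  have two: "\<exists>u w. u \<in> C \<and> w \<in> C \<and> u \<noteq> w \<and> u \<noteq> x \<and> w \<noteq> x" if "3 \<le> card C" for C :: "nat set"
  proof -
    have "finite C" using that card.infinite by fastforce
    then have "2 \<le> card (C - {x})" using that by (auto simp: card_Diff_singleton_if)
    then obtain S where "S \<subseteq> C - {x}" "card S = 2" by (meson obtain_subset_with_card_n)
    then show ?thesis unfolding card_2_iff by blast
  qed
  have eq: "v = v'"
  proof (cases "\<exists>u. u \<in> B \<and> u \<in> B' \<and> u \<noteq> x")
    case True
    then obtain u where "u \<in> B" "u \<in> B'" "u \<noteq> x" by blast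
    then show ?thesis using v[of u x] v'[of u x] x by simp
  next
    case False
    obtain u w where uw: "u \<in> B" "w \<in> B" "u \<noteq> w" "u \<noteq> x" "w \<noteq> x" using two[OF B(2)] by blast
    obtain a b where ab: "a \<in> B'" "b \<in> B'" "a \<noteq> b" "a \<noteq> x" "b \<noteq> x" using two[OF B'(2)] by blast
    have d: "u \<noteq> a" "u \<noteq> b" "w \<noteq> a" "w \<noteq> b" using False uw ab by blast+
    have lt: "a < N" "b < N" "u < N" "x < N" using ab uw x BN by auto
    have alt3: "alt y {x, u, w}" using alt_subset[OF B(1)] uw x by simp
    have "t {x, u} (t {u, w} v') = v'"
      using alt_fix[OF alt3, of a b] v'[OF ab(1-3)] uw ab d lt by simp
    moreover have "t {x, u} (t {u, w} v') = t {u, a} y"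
      using alt_shift[OF alt3, of a] v'[of x a] uw ab d lt x by simp
    ultimately have "t {u, a} y = v'" by simp
    then have "t {u, x} y = v'" using clique[of u a x] v'[of a x] ab x d uw lt by simp
    then show ?thesis using v[of u x] uw x by simp
  qed
  have cross: "t {i, j} y = v" if "i \<in> B" "j \<in> B'" "i \<noteq> j" for i j
  proof (cases "i = x \<or> j = x")
    case True then show ?thesis using v v' eq that x by blast
  next
    case False
    then show ?thesis using clique[of i x j y v] v[of i x] v'[of x j] eq that x BN by auto
  qed
  have "t {i, j} y = v" if "i \<in> B \<union> B'" "j \<in> B \<union> B'" "i \<noteq> j" for i j
    using that v v' cross[of i j] cross[of j i] eq by (auto simp: insert_commute)
  then show ?thesis using BN unfolding alt_def by blast
qed

end

section \<open>Small actions of the reflections of types E6 and E7\<close>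

text \<open>What remains of a permutation representation of a Weyl group of type \<open>E\<close>: the images of the reflections,
subject to the relation that conjugation moves reflections as it moves lines.\<close>

locale reflection_action =
  fixes n :: nat and Y :: "'y set" and t :: "nat set \<Rightarrow> 'y \<Rightarrow> 'y"
  assumes finite_Y: "finite Y"
    and closed: "\<And>R y. R \<in> root_lines n \<Longrightarrow> y \<in> Y \<Longrightarrow> t R y \<in> Y"
    and invol: "\<And>R y. R \<in> root_lines n \<Longrightarrow> t R (t R y) = y"
    and conj: "\<And>R Q y. R \<in> root_lines n \<Longrightarrow> Q \<in> root_lines n \<Longrightarrow> t R (t Q y) = t (star R Q) (t R y)"
begin

lemma third_line:
  assumes "R \<in> root_lines n" "Q \<in> root_lines n" "adjacent R Q"
  shows "t R (t Q y) = t (third R Q) (t R y)" "t R (t Q y) = t Q (t (third R Q) y)"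
proof -
  show 1: "t R (t Q y) = t (third R Q) (t R y)" for y using conj[of R Q y] assms by (simp add: star_def)
  have "t Q (t R (t Q y)) = t (third R Q) (t Q (t Q y))"
    using conj[of Q R "t Q y"] assms by (simp add: star_def adjacent_commute third_commute)
  then have "t Q (t Q (t R (t Q y))) = t Q (t (third R Q) y)" using invol[OF assms(2)] by simp
  then show "t R (t Q y) = t Q (t (third R Q) y)" using invol[OF assms(2)] by simp
qed

lemma braid:
  assumes "R \<in> root_lines n" "Q \<in> root_lines n" "adjacent R Q"
  shows "t R (t Q (t R y)) = t Q (t R (t Q y))"
  using third_line(1)[OF assms, of "t R y"] third_line(1)[OF assms(2,1), of "t Q y"] assms
  by (simp add: invol adjacent_commute third_commute)

lemma rotation_cubed:
  assumes "R \<in> root_lines n" "Q \<in> root_lines n" "adjacent R Q"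
  shows "t R (t Q (t R (t Q (t R (t Q y))))) = y"
  using braid[OF assms, of "t Q (t R (t Q y))"] assms by (simp add: invol)

lemma rotation_inverse:
  assumes "R \<in> root_lines n" "Q \<in> root_lines n" "adjacent R Q"
  shows "t R (t Q (t R (t Q y))) = t Q (t R y)"
  using braid[OF assms, of "t Q y"] assms by (simp add: invol)

lemma commuting: 
  assumes "R \<in> root_lines n" "Q \<in> root_lines n" "\<not> adjacent R Q"
  shows "t R (t Q y) = t Q (t R y)"
  using conj[OF assms(1,2)] assms(3) by (simp add: star_def)

end

locale e6_action = reflection_action +
  assumes E6: "root_lines 6 \<subseteq> root_lines n"
begin

lemma line_6: "R \<in> root_lines 6 \<Longrightarrow> R \<in> root_lines n"
  using E6 by blast

lemma conj4:
  assumes "{A, B, C, D, R, star D R, star C (star D R), star B (star C (star D R))} \<subseteq> root_lines 6"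
    and "star A (star B (star C (star D R))) = R'"
  shows "t A (t B (t C (t D (t R y)))) = t R' (t A (t B (t C (t D y))))"
  using assms conj[of D R y] conj[of C "star D R" "t D y"] conj[of B "star C (star D R)" "t C (t D y)"]
    conj[of A "star B (star C (star D R))" "t B (t C (t D y))"] E6
  by (simp add: subset_iff)

text \<open>The rotations \<open>c1, c2, c3\<close> are the Coxeter elements of three pairwise orthogonal subsystems of type \<open>A2\<close>, with lines
\<open>01, 12, 02\<close>, then \<open>34, 45, 35\<close>, then \<open>012, 345, 678\<close>. Conjugating \<open>c1 c2\<^sup>-\<^sup>1\<close>, which is a product of four
reflections, by \<open>turn\<close> gives \<open>cyc\<close>, and \<open>cyc\<close> permutes the three subsystems.\<close>

definition "c1 y = t {0, 1} (t {1, 2} y)"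
definition "c2 y = t {3, 4} (t {4, 5} y)"
definition "c3 y = t {0, 1, 2} (t {3, 4, 5} y)"
definition "turn y = t {0, 4} (t {0, 1, 3} y)"
definition "cyc y = t {1, 4} (t {2, 3, 4} (t {0, 5} (t {0, 1, 4} y)))"

lemma adj_A2: "adjacent {0,1} {1,2}" "adjacent {3,4} {4,5}" "adjacent {0,1,2} {3,4,5}"
   "adjacent {1,4} {2,3,4}" "adjacent {0,5} {0,1,4}"
  by (simp_all add: adjacent_def)

lemma lines: 
  "{0,1} \<in> root_lines n" "{1,2} \<in> root_lines n" "{0,2} \<in> root_lines n" "{3,4} \<in> root_lines n" 
  "{4,5} \<in> root_lines n" "{3,5} \<in> root_lines n" "{0,1,2} \<in> root_lines n" "{3,4,5} \<in> root_lines n" 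
  "{1,4} \<in> root_lines n" "{2,3,4} \<in> root_lines n" "{0,5} \<in> root_lines n" "{0,1,4} \<in> root_lines n"
  "{0,4} \<in> root_lines n" "{0,1,3} \<in> root_lines n" "{6,7,8} \<in> root_lines n" "{2,3} \<in> root_lines n"
  by (rule line_6, simp add: lines_eval)+

lemma torus_commute: "c2 (c1 y) = c1 (c2 y)" "c3 (c1 y) = c1 (c3 y)" "c3 (c2 y) = c2 (c3 y)"
proof -
  have comm: "t {3,4} (t {0,1} y) = t {0,1} (t {3,4} y)" "t {4,5} (t {0,1} y) = t {0,1} (t {4,5} y)"
    "t {3,4} (t {1,2} y) = t {1,2} (t {3,4} y)" "t {4,5} (t {1,2} y) = t {1,2} (t {4,5} y)"
    "t {0,1,2} (t {0,1} y) = t {0,1} (t {0,1,2} y)" "t {3,4,5} (t {0,1} y) = t {0,1} (t {3,4,5} y)"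
    "t {0,1,2} (t {1,2} y) = t {1,2} (t {0,1,2} y)" "t {3,4,5} (t {1,2} y) = t {1,2} (t {3,4,5} y)"
    "t {0,1,2} (t {3,4} y) = t {3,4} (t {0,1,2} y)" "t {3,4,5} (t {3,4} y) = t {3,4} (t {3,4,5} y)"
    "t {0,1,2} (t {4,5} y) = t {4,5} (t {0,1,2} y)" "t {3,4,5} (t {4,5} y) = t {4,5} (t {3,4,5} y)" for y
    by (rule commuting, (rule lines)+, simp add: adjacent_def)+
  show "c2 (c1 y) = c1 (c2 y)" "c3 (c1 y) = c1 (c3 y)" "c3 (c2 y) = c2 (c3 y)"
    unfolding c1_def c2_def c3_def by (simp_all only: comm)
qed

lemma torus_cycle: "cyc (c1 y) = c2 (cyc y)" "cyc (c2 y) = c3 (cyc y)" "cyc (c3 y) = c1 (cyc y)"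
proof -
  have c: "cyc (t {0,1} y) = t {4,5} (cyc y)" "cyc (t {1,2} y) = t {3,5} (cyc y)"
    "cyc (t {3,4} y) = t {3,4,5} (cyc y)" "cyc (t {4,5} y) = t {6,7,8} (cyc y)"
    "cyc (t {0,1,2} y) = t {1,2} (cyc y)" "cyc (t {3,4,5} y) = t {0,2} (cyc y)" for y
    unfolding cyc_def
    by ((rule conj4; simp add: star_eval lines_eval insert_commute)+)
  have r: "t {4,5} (t {3,5} z) = t {3,4} (t {4,5} z)" "t {3,4,5} (t {6,7,8} z) = t {0,1,2} (t {3,4,5} z)"
    "t {1,2} (t {0,2} z) = t {0,1} (t {1,2} z)" for z
    by ((subst conj; (rule lines)?), simp add: star_eval)+
  show "cyc (c1 y) = c2 (cyc y)" "cyc (c2 y) = c3 (cyc y)" "cyc (c3 y) = c1 (cyc y)"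
    unfolding c1_def c2_def c3_def c r by (rule refl)+
qed

lemma torus_invert:
  "t {0,1} (c1 y) = c1 (c1 (t {0,1} y))" "t {3,4} (c2 y) = c2 (c2 (t {3,4} y))"
  "t {0,1,2} (c3 y) = c3 (c3 (t {0,1,2} y))"
  unfolding c1_def c2_def c3_def
  by (simp_all add: rotation_inverse adj_A2 lines invol)

lemma torus_fix:
  "t {0,1} (c2 y) = c2 (t {0,1} y)" "t {0,1} (c3 y) = c3 (t {0,1} y)"
  "t {3,4} (c1 y) = c1 (t {3,4} y)" "t {3,4} (c3 y) = c3 (t {3,4} y)"
  "t {0,1,2} (c1 y) = c1 (t {0,1,2} y)" "t {0,1,2} (c2 y) = c2 (t {0,1,2} y)"
proof -
  have *: "t {0,1} (t {3,4} y) = t {3,4} (t {0,1} y)" "t {0,1} (t {4,5} y) = t {4,5} (t {0,1} y)"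
    "t {0,1} (t {0,1,2} y) = t {0,1,2} (t {0,1} y)" "t {0,1} (t {3,4,5} y) = t {3,4,5} (t {0,1} y)"
    "t {3,4} (t {1,2} y) = t {1,2} (t {3,4} y)" "t {3,4} (t {0,1} y) = t {0,1} (t {3,4} y)"
    "t {3,4} (t {0,1,2} y) = t {0,1,2} (t {3,4} y)" "t {3,4} (t {3,4,5} y) = t {3,4,5} (t {3,4} y)"
    "t {0,1,2} (t {0,1} y) = t {0,1} (t {0,1,2} y)" "t {0,1,2} (t {1,2} y) = t {1,2} (t {0,1,2} y)"
    "t {0,1,2} (t {3,4} y) = t {3,4} (t {0,1,2} y)" "t {0,1,2} (t {4,5} y) = t {4,5} (t {0,1,2} y)" for y
    by (rule commuting, (rule lines)+, simp add: adjacent_def)+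
  show "t {0,1} (c2 y) = c2 (t {0,1} y)" "t {0,1} (c3 y) = c3 (t {0,1} y)"
    "t {3,4} (c1 y) = c1 (t {3,4} y)" "t {3,4} (c3 y) = c3 (t {3,4} y)"
    "t {0,1,2} (c1 y) = c1 (t {0,1,2} y)" "t {0,1,2} (c2 y) = c2 (t {0,1,2} y)"
    unfolding c1_def c2_def c3_def by (simp_all only: *(1) *(2) *(3) *(4) *(5) *(7) *(8) *(9) *(10) *(11) *(12) *(6))
qed

lemma cyc_cubed: "cyc (cyc (cyc y)) = y"
proof -
  define p where "p = (\<lambda>y. t {1, 4} (t {2, 3, 4} y))"
  define q where "q = (\<lambda>y. t {0, 5} (t {0, 1, 4} y))"
  have *: "t {0, 5} (t {1,4} y) = t {1,4} (t {0,5} y)" "t {0, 5} (t {2,3,4} y) = t {2,3,4} (t {0,5} y)"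
    "t {0,1,4} (t {1,4} y) = t {1,4} (t {0,1,4} y)" "t {0,1,4} (t {2,3,4} y) = t {2,3,4} (t {0,1,4} y)" for y
    by (rule commuting, (rule lines)+, simp add: adjacent_def)+
  have qp: "q (p y) = p (q y)" for y unfolding p_def q_def by (simp only: *)
  have "p (p (p y)) = y" "q (q (q y)) = y" for y
    unfolding p_def q_def using rotation_cubed lines adj_A2 by blast+
  moreover have "cyc y = p (q y)" for y by (simp add: cyc_def p_def q_def)
  ultimately show ?thesis by (simp add: qp)
qed

lemma turn_conj: 
  "turn (t {0,1} y) = t {1,4} (turn y)" "turn (t {1,2} y) = t {2,3,4} (turn y)"
  "turn (t {4,5} y) = t {0,5} (turn y)" "turn (t {3,4} y) = t {0,1,4} (turn y)"
proof -
  have *: "turn (t R y) = t R' (turn y)"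
    if "{R, star {0,1,3} R} \<subseteq> root_lines 6" "star {0,4} (star {0,1,3} R) = R'" for R R'
    using conj[of "{0,1,3}" R y] conj[of "{0,4}" "star {0,1,3} R" "t {0,1,3} y"] lines that E6
    by (simp add: turn_def subset_iff)
  show "turn (t {0,1} y) = t {1,4} (turn y)" "turn (t {1,2} y) = t {2,3,4} (turn y)"
    "turn (t {4,5} y) = t {0,5} (turn y)" "turn (t {3,4} y) = t {0,1,4} (turn y)"
    by ((rule *; simp add: star_eval lines_eval insert_commute)+)
qed

sublocale torus: permuted_torus Y c1 c2 c3 "t {0,1}" "t {3,4}" "t {0,1,2}" cyc turn
proof
  show "bij_betw turn Y Y"
    by (rule bij_betw_byWitness[where f' = "\<lambda>y. t {0,1,3} (t {0,4} y)"])
      (auto simp: turn_def invol closed lines)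
  show "cyc (turn y) = turn (c1 (c2 (c2 y)))" for y
    unfolding c2_def rotation_inverse[OF lines(4,5) adj_A2(2)] c1_def
    by (simp add: turn_conj cyc_def)
  show "c1 (c1 (c1 y)) = y" "c2 (c2 (c2 y)) = y" "c3 (c3 (c3 y)) = y" for y
    unfolding c1_def c2_def c3_def by (simp_all only: rotation_cubed lines adj_A2)
qed (simp_all add: finite_Y closed invol lines torus_commute torus_invert torus_fix torus_cycle cyc_cubed,
  simp_all add: c1_def c2_def c3_def cyc_def closed lines)

end

text \<open>The reflections in the lines \<open>{a, b}\<close> permute the nine coordinates.\<close>

lemma star_pair:
  assumes "a \<noteq> b" shows "star {a, b} Q = transpose a b ` Q"
proof -
  have c: "card {a, b} = 2" using assms by simp
  consider "a \<in> Q" "b \<in> Q" | "a \<in> Q" "b \<notin> Q" | "a \<notin> Q" "b \<in> Q" | "a \<notin> Q" "b \<notin> Q" by blast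
  then show ?thesis
  proof cases
    case 1
    then have "{a, b} \<inter> Q = {a, b}" by blast
    then have "star {a, b} Q = Q" using c by (simp add: star_def adjacent_def)
    then show ?thesis using 1 by (auto simp: transpose_def image_iff)
  next
    case 2
    then have i: "{a, b} \<inter> Q = {a}" by blast
    then have "star {a, b} Q = insert b (Q - {a})" using c 2 by (auto simp: star_def adjacent_def third_def)
    then show ?thesis using 2 by (auto simp: transpose_def image_iff)
  next
    case 3
    then have i: "{a, b} \<inter> Q = {b}" by blast
    then have "star {a, b} Q = insert a (Q - {b})" using c 3 by (auto simp: star_def adjacent_def third_def)
    then show ?thesis using 3 by (auto simp: transpose_def image_iff)
  next
    case 4
    then have "{a, b} \<inter> Q = {}" by blast
    then have "star {a, b} Q = Q" using c by (simp add: star_def adjacent_def)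
    then show ?thesis using 4 by (auto simp: transpose_def image_iff)
  qed
qed

lemma star_self [simp]: "R \<in> root_lines n \<Longrightarrow> star R R = R"
  by (auto simp: star_def adjacent_def root_lines_def)

lemma low_line: "R \<subseteq> {..<n} \<Longrightarrow> n \<le> 9 \<Longrightarrow> card R = 2 \<or> card R = 3 \<Longrightarrow> R \<in> root_lines n"
  by (auto simp: root_lines_def)

lemma pair_line: "i < n \<Longrightarrow> j < n \<Longrightarrow> i \<noteq> j \<Longrightarrow> n \<le> 9 \<Longrightarrow> {i, j} \<in> root_lines n"
  by (rule low_line) auto

lemma triple_line: "distinct [i, j, k] \<Longrightarrow> i < n \<Longrightarrow> j < n \<Longrightarrow> k < n \<Longrightarrow> n \<le> 9 \<Longrightarrow> {i, j, k} \<in> root_lines n"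
  by (rule low_line) auto

lemma root_lines_8: "root_lines 8 = {R. R \<subseteq> {..<9} \<and> (card R = 2 \<or> card R = 3)}"
  by (auto simp: root_lines_def upto9)

text \<open>Three disjoint triples lie in one plane. This is how triples involving the last coordinates
are reached from those below.\<close>

lemma complement_of_two_triples:
  assumes S: "S \<subseteq> {..<9}" "card S = 3"
  obtains A B where "A \<union> B = {..<9} - S" "card A = 3" "card B = 3" "star A B = S"
proof -
  have fS: "finite S" using S(1) finite_subset by blast
  have c6: "card ({..<9} - S) = 6" using S fS by (subst card_Diff_subset) auto
  then have "3 \<le> card ({..<9} - S)" by simp
  then obtain A where A: "A \<subseteq> {..<9} - S" "card A = 3" by (rule obtain_subset_with_card_n)
  define B where "B = {..<9} - S - A"
  have fA: "finite A" using A finite_subset by blast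
  have cB: "card B = 3" unfolding B_def using A fA c6 by (subst card_Diff_subset) auto
  have disj: "A \<inter> B = {}" by (auto simp: B_def)
  have "star A B = S" using disj A cB S(1) by (auto simp: star_def adjacent_def third_def B_def)
  moreover have "A \<union> B = {..<9} - S" using A(1) by (auto simp: B_def)
  ultimately show thesis using A(2) cB that by blast
qed

text \<open>The pairs of neighbours generate the symmetric group on \<open>{..<n}\<close>, which carries \<open>{0, 1, 2}\<close> to all triples
below \<open>n\<close>. A triple containing the last coordinates comes from two triples partitioning its
complement, and a pair \<open>{i, 8}\<close> is the third line of two triples sharing two elements.\<close>

theorem root_lines_generated:
  assumes n: "n \<in> {6, 7, 8}"
    and pairs: "\<And>i. i + 1 < n \<Longrightarrow> {i, i + 1} \<in> Z"
    and triple: "{0, 1, 2} \<in> Z"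
    and star: "\<And>R S. \<lbrakk>R \<in> Z; S \<in> Z; R \<in> root_lines n; S \<in> root_lines n; star R S \<in> root_lines n\<rbrakk> \<Longrightarrow> star R S \<in> Z"
  shows "root_lines n \<subseteq> Z"
proof
  have n9: "n \<le> 9" "5 < n" using n by auto
  have pair: "{i, j} \<in> Z" if "i < j" "j < n" for i j
    using that
  proof (induction j)
    case (Suc j)
    show ?case
    proof (cases "i = j")
      case True then show ?thesis using pairs[of i] Suc.prems by (simp add: One_nat_def)
    next
      case False
      then have IH: "{i, j} \<in> Z" using Suc by simp
      have "star {j, j + 1} {i, j} = {i, Suc j}" using False Suc.prems by (subst star_pair) (auto simp: transpose_def)
      then show ?thesis using star[of "{j, j + 1}" "{i, j}"] IH pairs[of j] Suc.prems False n9 by (simp add: pair_line)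
    qed
  qed simp
  then have pair: "{i, j} \<in> Z" if "i \<noteq> j" "i < n" "j < n" for i j
    using that by (metis insert_commute linorder_neqE_nat)
  have swap: "star {a, b} S \<in> Z" if "a \<noteq> b" "a < n" "b < n" "S \<in> Z" "S \<in> root_lines n" "star {a, b} S \<in> root_lines n" for a b S
    using that pair n9 by (intro star pair_line) auto
  have tri: "{i, j, k} \<in> Z" if "i < j" "j < k" "k < n" for i j k
  proof -
    have "{0, 1, k} \<in> Z"
    proof (cases "k = 2")
      case False
      have "star {2, k} {0, 1, 2} = {0, 1, k}" using False that by (subst star_pair) (auto simp: transpose_def)
      then show ?thesis using swap[of 2 k "{0, 1, 2}"] triple False that n9 by (simp add: triple_line)
    qed (use triple in simp)
    then have "{0, j, k} \<in> Z"
    proof (cases "j = 1")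
      case False
      have "star {1, j} {0, 1, k} = {0, j, k}" using False that by (subst star_pair) (auto simp: transpose_def)
      then show ?thesis using swap[of 1 j "{0, 1, k}"] \<open>{0, 1, k} \<in> Z\<close> False that n9 by (simp add: triple_line)
    qed simp
    then show "{i, j, k} \<in> Z"
    proof (cases "i = 0")
      case False
      have "star {0, i} {0, j, k} = {i, j, k}" using False that by (subst star_pair) (auto simp: transpose_def)
      then show ?thesis using swap[of 0 i "{0, j, k}"] \<open>{0, j, k} \<in> Z\<close> False that n9 by (simp add: triple_line)
    qed simp
  qed
  have low3: "S \<in> Z" if S: "S \<subseteq> {..<n}" "card S = 3" for S
  proof -
    obtain xs where xs: "sorted_wrt (<) xs" "set xs = S" "length xs = card S"
      using finite_set_strict_sorted[of S] S(1) finite_subset by blast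
    then obtain i j k where "xs = [i, j, k]" using S(2) by (auto simp: length_Suc_conv numeral_3_eq_3)
    then show ?thesis using tri[of i j k] xs S(1) by auto
  qed
  have low2: "S \<in> Z" if S: "S \<subseteq> {..<n}" "card S = 2" for S
    using that pair unfolding card_2_iff by auto
  have high3: "S \<in> Z" if S: "S \<subseteq> {..<9}" "{n..<9} \<subseteq> S" "card S = 3" "S \<in> root_lines n" for S
  proof -
    obtain A B where AB: "A \<union> B = {..<9} - S" "card A = 3" "card B = 3" "star A B = S"
      using complement_of_two_triples[OF S(1,3)] by blast
    have "{..<9} - S \<subseteq> {..<n}"
    proof
      fix x assume x: "x \<in> {..<9} - S"
      then have "x \<notin> {n..<9}" using S(2) by blast
      then show "x \<in> {..<n}" using x by simp
    qed
    then have "A \<subseteq> {..<n}" "B \<subseteq> {..<n}" using AB(1) by auto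
    then show ?thesis using star[of A B] low3 AB(2-4) S(4) low_line n9(1) by simp
  qed
  fix R assume R: "R \<in> root_lines n"
  then have R9: "R \<subseteq> {..<9}" and cR: "card R = 2 \<or> card R = 3"
    and or: "R \<inter> {n..<9} = {} \<or> {n..<9} \<subseteq> R \<and> (card R = 3 \<or> n = 8)"
    by (auto simp: root_lines_def)
  show "R \<in> Z"
  proof (cases "R \<inter> {n..<9} = {}")
    case True
    then have "R \<subseteq> {..<n}" using R9 by force
    then show ?thesis using low2 low3 cR by blast
  next
    case False
    show ?thesis
    proof (cases "card R = 3")
      case True then show ?thesis using high3 R9 R or False by blast
    next
      case F: False
      then have n8: "n = 8" and "card R = 2" using or False cR by auto
      then have "8 \<in> R" using or False by (auto simp: upto9)
      obtain a b where "R = {a, b}" "a \<noteq> b" using \<open>card R = 2\<close> by (auto simp: card_2_iff)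
      then obtain i where i: "R = {i, 8}" "i \<noteq> 8" using \<open>8 \<in> R\<close> by (cases "a = 8") auto
      then have "i < 8" using R9 by auto
      have "card ({..<8} - {i}) = 7" using \<open>i < 8\<close> by simp
      then have "2 \<le> card ({..<8} - {i})" by simp
      then obtain P where P: "P \<subseteq> {..<8} - {i}" "card P = 2" by (rule obtain_subset_with_card_n)
      then obtain a b where ab: "P = {a, b}" "a \<noteq> b" by (auto simp: card_2_iff)
      have l: "a < 8" "b < 8" "a \<noteq> i" "b \<noteq> i" using P ab by auto
      have r: "{8, a, b} \<in> root_lines n" "{i, a, b} \<in> root_lines n"
        using n8 l ab \<open>i < 8\<close> by (auto simp: root_lines_8 card_insert_if)
      have "{8, a, b} \<in> Z" using high3[of "{8, a, b}"] r n8 l ab by (auto simp: upto9 card_insert_if)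
      moreover have "{i, a, b} \<in> Z" using low3[of "{i, a, b}"] n8 l ab \<open>i < 8\<close> by (auto simp: card_insert_if)
      moreover have "star {i, a, b} {8, a, b} = R"
      proof -
        have "{i, a, b} \<inter> {8, a, b} = {a, b}" using l i by auto
        then show ?thesis using l ab i by (auto simp: star_def adjacent_def third_def card_insert_if)
      qed
      ultimately show ?thesis using star[of "{i, a, b}" "{8, a, b}"] r R by simp
    qed
  qed
qed

context reflection_action
begin

text \<open>Equality of two reflections on \<open>F\<close>. It is transported by every reflection that preserves \<open>F\<close>.\<close>

definition same :: "'y set \<Rightarrow> nat set \<Rightarrow> nat set \<Rightarrow> bool" where
  "same F R Q \<longleftrightarrow> (\<forall>y\<in>F. t R y = t Q y)"

lemma conj_star: "R \<in> root_lines n \<Longrightarrow> S \<in> root_lines n \<Longrightarrow> t (star S R) y = t S (t R (t S y))"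
  using conj[of S R "t S y"] by (simp add: invol)

lemma same_star:
  assumes F: "\<And>R y. R \<in> root_lines n \<Longrightarrow> y \<in> F \<Longrightarrow> t R y \<in> F"
    and "same F R Q" "R \<in> root_lines n" "Q \<in> root_lines n" "S \<in> root_lines n"
  shows "same F (star S R) (star S Q)"
  using assms by (simp add: same_def conj_star)

text \<open>Agreement on an invariant set is preserved by conjugation. So the agreement of \<open>{0, 1}\<close> and \<open>{1, 2}\<close> spreads to
all neighbouring pairs and to one triple, and the lines agreeing with \<open>{0, 1}\<close> are closed under \<open>star\<close>.\<close>

theorem all_lines_agree:
  assumes n: "n \<in> {6, 7, 8}"
    and F: "\<And>R y. R \<in> root_lines n \<Longrightarrow> y \<in> F \<Longrightarrow> t R y \<in> F"
    and base: "\<And>y. y \<in> F \<Longrightarrow> t {0, 1} y = t {1, 2} y"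
    and y: "y \<in> F" and R: "R \<in> root_lines n" and Q: "Q \<in> root_lines n"
  shows "t R y = t Q y"
proof -
  have n9: "n \<le> 9" "5 < n" using n by auto
  have tr: "same F A B \<Longrightarrow> same F B C \<Longrightarrow> same F A C" and sy: "same F A B \<Longrightarrow> same F B A" for A B C
    by (auto simp: same_def)
  have swap: "same F (transpose a b ` A) (transpose a b ` B)"
    if "same F A B" "A \<in> root_lines n" "B \<in> root_lines n" "a \<noteq> b" "a < n" "b < n" for A B a b
    using same_star[OF F that(1-3) pair_line[OF that(5,6,4) n9(1)]] that(4) by (simp add: star_pair)
  have b01: "same F {0, 1} {1, 2}" using base by (simp add: same_def)
  have step: "same F {i, i + 1} {i + 1, i + 2}" if "i + 2 < n" for i
    using that
  proof (induction i)
    case 0 then show ?case using b01 by (simp add: numeral_2_eq_2 One_nat_def)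
  next
    case (Suc i)
    then have 1: "same F {i, i + 1} {i + 1, i + 2}" by simp
    have "same F {i + 3, i + 1} {i + 1, i + 2}"
      using swap[OF 1, of i "i + 3"] Suc.prems n9 by (simp add: pair_line transpose_def insert_commute)
    from swap[OF this, of "i + 1" "i + 2"] have "same F {i + 3, i + 2} {i + 2, i + 1}"
      using Suc.prems n9 by (simp add: pair_line transpose_def insert_commute)
    then have 2: "same F {i + 2, i + 1} {i + 3, i + 2}" by (rule sy)
    have e: "{Suc i, Suc i + 1} = {i + 2, i + 1}" "{Suc i + 1, Suc i + 2} = {i + 3, i + 2}" by auto
    show ?case unfolding e by (rule 2)
  qed
  define Z where "Z = {R. same F {0, 1} R}"
  have "root_lines n \<subseteq> Z"
  proof (rule root_lines_generated[OF n])
    fix i assume "i + 1 < n"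
    then show "{i, i + 1} \<in> Z"
    proof (induction i)
      case (Suc i)
      have "{Suc i, Suc i + 1} = {i + 1, i + 2}" by auto
      moreover have "same F {0, 1} {i, i + 1}" using Suc by (simp add: Z_def)
      then have "same F {0, 1} {i + 1, i + 2}" by (rule tr) (use Suc.prems step[of i] in simp)
      ultimately show ?case by (simp add: Z_def)
    qed (simp add: Z_def same_def)
  next
    \<comment> \<open>conjugation by the triple \<open>{0, 3, 4}\<close> moves \<open>{0, 1}\<close> to a triple and fixes \<open>{1, 2}\<close>, so it links the pairs with the triples\<close>
    have "same F (star {0, 3, 4} {0, 1}) (star {0, 3, 4} {1, 2})"
      using n9 by (intro same_star F b01) (auto intro: pair_line triple_line)
    then have "same F {1, 3, 4} {1, 2}" by (simp add: star_eval)
    from swap[OF this, of 0 3] have "same F {1, 0, 4} {1, 2}"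
      using n9 by (simp add: pair_line triple_line transpose_def insert_commute)
    from swap[OF this, of 2 4] have 1: "same F {0, 1, 2} {1, 4}"
      using n9 by (simp add: pair_line triple_line transpose_def insert_commute)
    have "same F {1, 4} {1, 2}"
      using swap[OF b01, of 0 4] n9 by (simp add: pair_line triple_line transpose_def insert_commute)
    then have "same F {0, 1} {1, 4}" using tr[OF b01 sy] by simp
    then show "{0, 1, 2} \<in> Z" unfolding Z_def using tr[OF _ sy[OF 1]] by simp
  next
    fix R S assume *: "R \<in> Z" "S \<in> Z" "R \<in> root_lines n" "S \<in> root_lines n"
    then have 1: "same F {0, 1} R" "same F {0, 1} S" by (simp_all add: Z_def)
    have "same F (star R R) (star R S)" by (rule same_star[OF F tr[OF sy[OF 1(1)] 1(2)] *(3,4,3)])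
    then have "same F R (star R S)" using *(3) by simp
    then show "star R S \<in> Z" unfolding Z_def using tr[OF 1(1)] by simp
  qed
  then have "same F {0, 1} R" "same F {0, 1} Q" using R Q by (auto simp: Z_def)
  then show ?thesis using y by (auto simp: same_def)
qed

lemma transposition_action:
  assumes "N = (if n = 8 then 9 else n)" "n \<le> 8"
  shows "transposition_action N Y t"
proof
  have pl: "{i, j} \<in> root_lines n" if "i < N" "j < N" "i \<noteq> j" for i j
    using that assms by (auto simp: root_lines_8 pair_line split: if_splits)
  show "t {a, b} (t {i, j} y) = t {transpose a b i, transpose a b j} (t {a, b} y)"
    if "a < N" "b < N" "i < N" "j < N" "a \<noteq> b" "i \<noteq> j" for a b i j y
    using conj[OF pl[OF that(1,2,5)] pl[OF that(3,4,6)], of y] by (simp add: star_pair that)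
  show "finite Y" by (rule finite_Y)
  show "t {i, j} y \<in> Y" if "i < N" "j < N" "i \<noteq> j" "y \<in> Y" for i j y using closed[OF pl] that by blast
  show "t {i, j} (t {i, j} y) = y" if "i < N" "j < N" "i \<noteq> j" for i j y using invol[OF pl] that by blast
qed

end

lemma exists_permutation:
  assumes fin: "finite U" and sub: "A \<subseteq> U" "A' \<subseteq> U" "B \<subseteq> U" "B' \<subseteq> U" and disj: "A \<inter> A' = {}" "B \<inter> B' = {}"
    and card: "card A = card B" "card A' = card B'"
  shows "\<exists>p. p permutes U \<and> p ` A = B \<and> p ` A' = B'"
proof -
  have f: "finite A" "finite A'" "finite B" "finite B'" using sub by (auto intro: finite_subset[OF _ fin])
  obtain f where f1: "bij_betw f A B" using f card finite_same_card_bij by blast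
  obtain g where g1: "bij_betw g A' B'" using f card finite_same_card_bij by blast
  have "card (U - (A \<union> A')) = card (U - (B \<union> B'))"
    using f card disj sub fin by (simp add: card_Diff_subset card_Un_disjoint)
  then obtain h where h1: "bij_betw h (U - (A \<union> A')) (U - (B \<union> B'))"
    using fin finite_same_card_bij by (meson finite_Diff)
  define p where "p = (\<lambda>x. if x \<in> A then f x else if x \<in> A' then g x else if x \<in> U then h x else x)"
  have pA: "p ` A = B" using f1 by (auto simp: p_def bij_betw_def)
  have pA': "p ` A' = B'" using g1 disj by (force simp: p_def bij_betw_def image_iff)
  have 1: "bij_betw p A B" using f1 by (rule bij_betw_cong[THEN iffD1, rotated]) (simp add: p_def)
  have 2: "bij_betw p A' B'" using g1 disj by (intro bij_betw_cong[THEN iffD1, OF _ g1]) (auto simp: p_def)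
  have 3: "bij_betw p (U - (A \<union> A')) (U - (B \<union> B'))" by (rule bij_betw_cong[THEN iffD1, OF _ h1]) (auto simp: p_def)
  have "bij_betw p (A \<union> A') (B \<union> B')" using 1 2 disj by (intro bij_betw_combine)
  then have "bij_betw p ((A \<union> A') \<union> (U - (A \<union> A'))) ((B \<union> B') \<union> (U - (B \<union> B')))"
    using 3 by (rule bij_betw_combine) auto
  moreover have "(A \<union> A') \<union> (U - (A \<union> A')) = U" "(B \<union> B') \<union> (U - (B \<union> B')) = U" using sub by auto
  ultimately have "bij_betw p U U" by simp
  moreover have "p x = x" if "x \<notin> U" for x using that sub by (auto simp: p_def)
  ultimately have "p permutes U" by (rule bij_imp_permutes) 
  then show ?thesis using pA pA' by blast
qed

context transposition_action
begin

text \<open>By \<open>alt_Un\<close> the maximal sets of size at least three whose alternating group fixes \<open>y\<close> are pairwise disjoint.\<close>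

definition block :: "'y \<Rightarrow> nat set \<Rightarrow> bool" where
  "block y B \<longleftrightarrow> alt y B \<and> 3 \<le> card B \<and> (\<forall>C. alt y C \<longrightarrow> 3 \<le> card C \<longrightarrow> C \<inter> B \<noteq> {} \<longrightarrow> C \<subseteq> B)"

lemma block_absorbs: "block y B \<Longrightarrow> alt y C \<Longrightarrow> 3 \<le> card C \<Longrightarrow> C \<inter> B \<noteq> {} \<Longrightarrow> C \<subseteq> B"
  by (simp add: block_def)

lemma block_eq: "block y B \<Longrightarrow> block y B' \<Longrightarrow> B \<inter> B' \<noteq> {} \<Longrightarrow> B = B'"
  using block_absorbs[of y B B'] block_absorbs[of y B' B] by (auto simp: block_def)

lemma exists_block:
  assumes S: "alt y S" "3 \<le> card S"
  obtains B where "block y B" "S \<subseteq> B"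
proof -
  have f: "finite {B. S \<subseteq> B \<and> alt y B}" by (rule finite_subset[of _ "Pow {..<N}"]) (auto simp: alt_def)
  have "S \<in> {B. S \<subseteq> B \<and> alt y B}" using S by simp
  from finite_has_maximal2[OF f this] obtain B where B': "B \<in> {B. S \<subseteq> B \<and> alt y B}"
    and max': "\<forall>C\<in>{B. S \<subseteq> B \<and> alt y B}. B \<subseteq> C \<longrightarrow> B = C"
    by (elim bexE conjE)
  have B: "S \<subseteq> B" "alt y B" using B' by simp_all
  have max: "B = C" if "S \<subseteq> C" "alt y C" "B \<subseteq> C" for C using max' that by simp
  have "finite B" using B(2) finite_subset by (auto simp: alt_def)
  then have c: "3 \<le> card B" using S(2) card_mono[OF _ B(1)] by simp
  have "C \<subseteq> B" if "alt y C" "3 \<le> card C" "C \<inter> B \<noteq> {}" for C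
  proof -
    have "alt y (B \<union> C)" using alt_Un[OF B(2) c that(1,2)] that(3) by (simp add: Int_commute)
    then have "B = B \<union> C" using B(1) by (intro max) auto
    then show ?thesis by blast
  qed
  then have "block y B" using B(2) c by (simp add: block_def)
  then show thesis using B(1) by (rule that)
qed

lemma alt_transpose:
  assumes "a < N" "b < N" "a \<noteq> b"
  shows "alt (t {a, b} y) (transpose a b ` S) \<longleftrightarrow> alt y S"
proof -
  have 1: "alt (t {a, b} y) (transpose a b ` S)" if S: "alt y S" for y S
  proof -
    obtain v where v: "\<forall>i\<in>S. \<forall>j\<in>S. i \<noteq> j \<longrightarrow> t {i, j} y = v" using S unfolding alt_def by (elim conjE exE)
    have SN: "S \<subseteq> {..<N}" using S by (simp add: alt_def)
    have "t {transpose a b i, transpose a b j} (t {a, b} y) = t {a, b} v" if "i \<in> S" "j \<in> S" "i \<noteq> j" for i j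
    proof -
      have "i < N" "j < N" using SN that by auto
      then show ?thesis using t_transpose[of a b i j y] assms that v by simp
    qed
    moreover have "transpose a b ` S \<subseteq> {..<N}" using SN assms by (auto simp: transpose_def)
    ultimately show ?thesis unfolding alt_def by (intro conjI exI[of _ "t {a, b} v"]) auto
  qed
  show ?thesis
    using 1[of y S] 1[of "t {a, b} y" "transpose a b ` S"] assms by (auto simp: t_invol image_comp)
qed

text \<open>Conjugation by transpositions permutes the points, so the counts depend only on how \<open>S\<close> and \<open>S'\<close> intersect.\<close>

lemma card_alt_permute:
  assumes "p permutes {..<N}"
  shows "card {y \<in> Y. alt y (p ` S) \<and> alt y (p ` S')} = card {y \<in> Y. alt y S \<and> alt y S'}"
  using assms finite_lessThan
proof (induction rule: permutes_induct)
  case (swap a b p)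
  then have ab: "a < N" "b < N" "a \<noteq> b" by auto
  have im: "(transpose a b \<circ> p) ` T = transpose a b ` (p ` T)" for T by (simp add: image_comp)
  have inv: "t {a, b} (t {a, b} y) = y" for y by (rule t_invol[OF ab])
  have alt': "alt y (transpose a b ` T) \<longleftrightarrow> alt (t {a, b} y) T" for y T
    using alt_transpose[OF ab, of "t {a, b} y" T] inv by simp
  have "bij_betw (t {a, b}) {y \<in> Y. alt y A \<and> alt y B}
     {y \<in> Y. alt y (transpose a b ` A) \<and> alt y (transpose a b ` B)}" for A B
    by (intro bij_betw_byWitness[where f' = "t {a, b}"]) (auto simp: alt' inv t_closed[OF ab])
  from this[of "p ` S" "p ` S'"]
  have "bij_betw (t {a, b}) {y \<in> Y. alt y (p ` S) \<and> alt y (p ` S')}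
     {y \<in> Y. alt y ((transpose a b \<circ> p) ` S) \<and> alt y ((transpose a b \<circ> p) ` S')}"
    unfolding im .
  then show ?case using swap.IH by (simp add: bij_betw_same_card)
qed simp

end

text \<open>On the points fixed by the group of order 27 adjacent reflections agree, so if all points are of
this kind all reflections agree. Otherwise \<open>large_or_fixed\<close> applies. The second case does occur: the 27
weights of the minuscule representation, equivalently the 27 lines on a cubic surface.\<close>

theorem E6_action_dichotomy:
  assumes "e6_action n Y t" and Y: "card Y \<le> 27"
  shows "(\<forall>y\<in>Y. \<forall>R\<in>root_lines 6. \<forall>Q\<in>root_lines 6. t R y = t Q y) \<or>
    card Y = 27 \<and> 9 \<le> card {y \<in> Y. t {0,1} y = t {1,2} y} \<and>
      {y \<in> Y. t {0,1} y = t {1,2} y \<and> t {3,4} y = t {4,5} y} = {}"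
proof -
  interpret e6_action n Y t by fact
  interpret six: reflection_action 6 Y t
  proof
    show "finite Y" by (rule finite_Y)
  qed (use closed[OF line_6] invol[OF line_6] conj[OF line_6 line_6] in blast)+
  let ?F = torus.F
  have move: "t R a = b \<longleftrightarrow> a = t R b" if "R \<in> root_lines n" for R a b
    using invol[OF that, of a] invol[OF that, of b] by auto
  have c_iff: "c1 y = y \<longleftrightarrow> t {0,1} y = t {1,2} y" "c2 y = y \<longleftrightarrow> t {3,4} y = t {4,5} y" for y
    unfolding c1_def c2_def move[OF lines(1), of "t {1,2} y"] move[OF lines(4), of "t {4,5} y"] by (rule eq_commute)+
  show ?thesis
  proof (cases "?F = Y")
    case False
    then have "card Y = 27" "?F = {}" "9 \<le> card {y \<in> Y. c1 y = y}"
      using torus.large_or_fixed[OF Y] by auto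
    moreover have "{y \<in> Y. c1 y = y \<and> c2 y = y} \<subseteq> {y \<in> Y. c1 y = c2 y}" by auto
    ultimately show ?thesis unfolding torus.F_eq(1)[OF Y] by (simp add: c_iff)
  next
    case True
    have "t R y = t Q y" if "y \<in> Y" "R \<in> root_lines 6" "Q \<in> root_lines 6" for y R Q
    proof (rule six.all_lines_agree[of Y])
      show "t {0, 1} y = t {1, 2} y" if "y \<in> Y" for y
      proof -
        have "y \<in> torus.F" using that True by simp
        then show ?thesis by (simp add: torus.F_def c_iff)
      qed
    qed (use that six.closed in auto)
    then show ?thesis by blast
  qed
qed

theorem E6_action_constant:
  assumes "reflection_action 6 Y t" and "card Y \<le> 26" "y \<in> Y" "R \<in> root_lines 6" "Q \<in> root_lines 6"
  shows "t R y = t Q y"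
proof -
  have "e6_action 6 Y t" using assms(1) by (simp add: e6_action_def e6_action_axioms_def)
  moreover have "card Y \<le> 27" "card Y \<noteq> 27" using assms(2) by simp_all
  ultimately have "\<forall>y\<in>Y. \<forall>R\<in>root_lines 6. \<forall>Q\<in>root_lines 6. t R y = t Q y"
    using E6_action_dichotomy[of 6 Y t] by argo
  then show ?thesis using assms(3-5) by blast
qed

text \<open>If the restriction to \<open>E6\<close> is the exceptional action on 27 points, then each of the 35 three-cycles of the symmetric
group on seven letters fixes at least nine points, and two disjoint three-cycles fix no point in common.
The triples belonging to one point therefore lie in a single block of at most five letters, so there are at most
ten of them. Double counting gives \<open>35 \<cdot> 9 \<le> 27 \<cdot> 10\<close>, which is false.\<close>

theorem E7_action_constant:
  assumes action: "reflection_action 7 Y t" and card: "card Y \<le> 27"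
    and y: "y \<in> Y" and R: "R \<in> root_lines 7" and Q: "Q \<in> root_lines 7"
  shows "t R y = t Q y"
proof -
  interpret reflection_action 7 Y t by fact
  interpret transposition_action 7 Y t by (rule transposition_action) auto
  have "e6_action 7 Y t" using action root_lines_6_7 by (simp add: e6_action_def e6_action_axioms_def)
  from E6_action_dichotomy[OF this card] show ?thesis
  proof (elim disjE conjE)
    assume *: "\<forall>y\<in>Y. \<forall>R\<in>root_lines 6. \<forall>Q\<in>root_lines 6. t R y = t Q y"
    have "{0,1} \<in> root_lines 6" "{1,2} \<in> root_lines 6" by (auto simp: lines_eval)
    then have "t {0,1} y = t {1,2} y" if "y \<in> Y" for y using * that by blast
    then show ?thesis using all_lines_agree[of Y y R Q] closed y R Q by simp
  next
    assume Y27: "card Y = 27" and nine: "9 \<le> card {y \<in> Y. t {0,1} y = t {1,2} y}"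
      and none: "{y \<in> Y. t {0,1} y = t {1,2} y \<and> t {3,4} y = t {4,5} y} = {}"
    have alt3: "alt y {0,1,2} \<longleftrightarrow> t {0,1} y = t {1,2} y" "alt y {3,4,5} \<longleftrightarrow> t {3,4} y = t {4,5} y" for y
    proof -
      show "alt y {0,1,2} \<longleftrightarrow> t {0,1} y = t {1,2} y"
        by (rule iffI, erule altD, simp_all, rule alt_triple, simp_all)
      show "alt y {3,4,5} \<longleftrightarrow> t {3,4} y = t {4,5} y"
        by (rule iffI, erule altD, simp_all, rule alt_triple, simp_all)
    qed
    define T where "T = {S. S \<subseteq> {..<7::nat} \<and> card S = 3}"
    have finT: "finite T" unfolding T_def by (rule finite_subset[of _ "Pow {..<7}"]) auto
    have each: "9 \<le> card {y \<in> Y. alt y S}" if "S \<in> T" for S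
    proof -
      have "\<exists>p. p permutes {..<7} \<and> p ` {0,1,2} = S \<and> p ` {} = {}"
        using that by (intro exists_permutation) (auto simp: T_def)
      then obtain p where p: "p permutes {..<7}" "p ` {0,1,2} = S" by blast
      show ?thesis using card_alt_permute[OF p(1), of "{0,1,2}" "{0,1,2}"] nine p(2) by (simp add: alt3)
    qed
    have disjoint: "S \<inter> S' \<noteq> {}" if S: "S \<in> T" "S' \<in> T" and z: "z \<in> Y" "alt z S" "alt z S'" for S S' z
    proof
      assume "S \<inter> S' = {}"
      then have "\<exists>p. p permutes {..<7} \<and> p ` {0,1,2} = S \<and> p ` {3,4,5} = S'"
        using S by (intro exists_permutation) (auto simp: T_def)
      then obtain p where p: "p permutes {..<7}" "p ` {0,1,2} = S" "p ` {3,4,5} = S'" by blast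
      have "card {y \<in> Y. alt y S \<and> alt y S'} = 0"
        using card_alt_permute[OF p(1), of "{0,1,2}" "{3,4,5}"] none p(2,3) by (simp add: alt3)
      then show False using z finite_Y by auto
    qed
    have few: "card {S \<in> T. alt z S} \<le> 10" if z: "z \<in> Y" for z
    proof (cases "{S \<in> T. alt z S} = {}")
      case False
      then obtain S0 where S0: "S0 \<in> T" "alt z S0" by blast
      have "3 \<le> card S0" using S0(1) by (simp add: T_def)
      then obtain B where block: "block z B" and S0B: "S0 \<subseteq> B" using exists_block[OF S0(2)] by blast
      then have B: "S0 \<subseteq> B" "alt z B" by (simp_all add: block_def)
      have BN: "B \<subseteq> {..<7}" using B by (simp add: alt_def)
      then have fB: "finite B" using finite_subset by blast
      have c3: "3 \<le> card B" using S0 card_mono[OF fB B(1)] by (simp add: T_def)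
      have sub: "{S \<in> T. alt z S} \<subseteq> {S. S \<subseteq> B \<and> card S = 3}"
      proof clarify
        fix S assume S: "S \<in> T" "alt z S"
        have "S \<inter> B \<noteq> {}" using disjoint[OF S(1) S0(1) z S(2) S0(2)] B(1) by blast
        then have "S \<subseteq> B" using block_absorbs[OF block S(2)] S(1) by (simp add: T_def)
        then show "S \<subseteq> B \<and> card S = 3" using S(1) by (auto simp: T_def)
      qed
      have "card B \<le> 5"
      proof (rule ccontr)
        assume "\<not> card B \<le> 5"
        then have "card (B - S0) \<ge> 3" using S0(1) B(1) fB finite_subset[OF B(1) fB] by (simp add: card_Diff_subset T_def)
        then obtain S' where S': "S' \<subseteq> B - S0" "card S' = 3" by (rule obtain_subset_with_card_n)
        then have "S' \<in> T" "alt z S'" using BN alt_subset[OF B(2)] by (auto simp: T_def)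
        then show False using disjoint[OF S0(1) _ z S0(2)] S'(1) by blast
      qed
      then have "card B choose 3 \<le> 5 choose 3" by (rule binomial_right_mono)
      also have "(5::nat) choose 3 = 10" by (simp add: numeral_eq_Suc)
      finally have "card {S. S \<subseteq> B \<and> card S = 3} \<le> 10" by (simp add: n_subsets fB)
      moreover have "finite {S. S \<subseteq> B \<and> card S = 3}" using fB by simp
      ultimately show ?thesis using card_mono[OF _ sub] by fastforce
    next
      case True
      show ?thesis unfolding True by simp
    qed
    have "card T = 35"  unfolding T_def using n_subsets[of "{..<7::nat}" 3] by (simp add: numeral_eq_Suc)
    then have "35 * 9 \<le> (\<Sum>S\<in>T. card {y \<in> Y. alt y S})"
      using sum_mono[of T "\<lambda>_. 9" "\<lambda>S. card {y \<in> Y. alt y S}"] each by simp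
    also have "\<dots> = (\<Sum>y\<in>Y. card {S \<in> T. alt y S})"
      by (rule sum_multicount_gen[OF finT finite_Y]) simp
    also have "\<dots> \<le> (\<Sum>y\<in>Y. 10)" by (rule sum_mono) (rule few)
    also have "\<dots> = 270" using Y27 by simp
    finally show ?thesis by simp
  qed
qed

section \<open>Small actions of the reflections of type E8\<close>

lemma three_cycle_apply:
  assumes "distinct [i, j, k]"
  shows "(transpose i j \<circ> transpose j k) x = (if x = i then j else if x = j then k else if x = k then i else x)"
  using assms by (auto simp: transpose_def)

text \<open>Bochert's argument. Let \<open>\<Gamma>\<close> be a largest subset on which the group \<open>J\<close> acts with trivial intersection \<open>J \<inter> Sym \<Gamma>\<close>, and
suppose that \<open>\<Gamma>\<close> is smaller than its complement. Then some \<open>x \<noteq> id\<close> in \<open>J\<close> is supported outside \<open>\<Gamma>\<close>; for a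
point \<open>d\<close> moved by \<open>x\<close>, some \<open>z \<noteq> id\<close> in \<open>J\<close> is supported on \<open>\<Gamma> \<union> {d}\<close> and moves \<open>d\<close>. The supports of \<open>x\<close> and \<open>z\<close>
meet only in \<open>d\<close>, so the commutator of \<open>x\<close> and \<open>z\<close> is a three-cycle.\<close>

theorem large_trivial_subset:
  assumes fin: "finite \<Omega>" and J: "\<And>p. p \<in> J \<Longrightarrow> p permutes \<Omega>"
    and comp: "\<And>p q. p \<in> J \<Longrightarrow> q \<in> J \<Longrightarrow> p \<circ> q \<in> J" and inv: "\<And>p. p \<in> J \<Longrightarrow> inv' p \<in> J"
    and no3: "\<And>i j k. \<lbrakk>i \<in> \<Omega>; j \<in> \<Omega>; k \<in> \<Omega>; distinct [i, j, k]\<rbrakk> \<Longrightarrow> transpose i j \<circ> transpose j k \<notin> J"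
  shows "\<exists>\<Gamma>\<subseteq>\<Omega>. card \<Omega> \<le> 2 * card \<Gamma> \<and> (\<forall>p\<in>J. p permutes \<Gamma> \<longrightarrow> p = id)"
proof -
  define good where "good = {\<Gamma>. \<Gamma> \<subseteq> \<Omega> \<and> (\<forall>p\<in>J. p permutes \<Gamma> \<longrightarrow> p = id)}"
  have fg: "finite (card ` good)" unfolding good_def using fin by simp
  have "{} \<in> good" by (auto simp: good_def)
  then have "Max (card ` good) \<in> card ` good" using fg by (intro Max_in) auto
  then obtain \<Gamma> where \<Gamma>: "\<Gamma> \<in> good" "card \<Gamma> = Max (card ` good)" by auto
  have max: "card \<Gamma>' \<le> card \<Gamma>" if "\<Gamma>' \<in> good" for \<Gamma>' using that fg \<Gamma>(2) by simp
  have \<Gamma>\<Omega>: "\<Gamma> \<subseteq> \<Omega>" and triv: "\<And>p. p \<in> J \<Longrightarrow> p permutes \<Gamma> \<Longrightarrow> p = id" using \<Gamma>(1) by (auto simp: good_def)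
  have f\<Gamma>: "finite \<Gamma>" using \<Gamma>\<Omega> fin finite_subset by blast
  have "card \<Omega> \<le> 2 * card \<Gamma>"
  proof (rule ccontr)
    assume "\<not> card \<Omega> \<le> 2 * card \<Gamma>"
    then have "card \<Gamma> < card (\<Omega> - \<Gamma>)" using \<Gamma>\<Omega> fin f\<Gamma> by (simp add: card_Diff_subset)
    then have "\<Omega> - \<Gamma> \<notin> good" using max by fastforce
    then obtain x where x: "x \<in> J" "x permutes \<Omega> - \<Gamma>" "x \<noteq> id" by (auto simp: good_def)
    then obtain d where d: "x d \<noteq> d" by (auto simp: fun_eq_iff)
    have d\<Delta>: "d \<in> \<Omega>" "d \<notin> \<Gamma>" using d x(2) by (auto simp: permutes_def)
    have "card \<Gamma> < card (insert d \<Gamma>)" using d\<Delta> f\<Gamma> by simp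
    then have "insert d \<Gamma> \<notin> good" using max by fastforce
    then obtain z where z: "z \<in> J" "z permutes insert d \<Gamma>" "z \<noteq> id" using d\<Delta> \<Gamma>\<Omega> by (auto simp: good_def)
    have zd: "z d \<noteq> d"
    proof
      assume "z d = d"
      then have "z permutes \<Gamma>" using z(2) by (intro permutes_superset[OF z(2)]) auto
      then show False using triv z by blast
    qed
    define \<beta> \<alpha> where "\<beta> = z d" and "\<alpha> = x d"
    have bx: "bij x" and bz: "bij z" using x(2) z(2) permutes_bij by blast+
    have \<beta>: "\<beta> \<in> \<Gamma>" "\<beta> \<noteq> d" using zd permutes_in_image[OF z(2), of d] by (auto simp: \<beta>_def)
    have \<alpha>: "\<alpha> \<in> \<Omega>" "\<alpha> \<notin> \<Gamma>" "\<alpha> \<noteq> d" using d d\<Delta> permutes_in_image[OF x(2), of d] by (auto simp: \<alpha>_def)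
    have xfix: "x u = u" if "u \<in> \<Gamma> \<or> u \<notin> \<Omega>" for u using x(2) that by (auto simp: permutes_def)
    have zfix: "z u = u" if "u \<notin> \<Gamma>" "u \<noteq> d" for u using z(2) that by (auto simp: permutes_def)
    have ix: "inv' x u = w \<longleftrightarrow> u = x w" and iz: "inv' z u = w \<longleftrightarrow> u = z w" for u w
      using bij_inv_eq_iff[OF bx, of w u] bij_inv_eq_iff[OF bz, of w u] by (simp_all add: eq_commute)
    have injx: "x u = x w \<longleftrightarrow> u = w" and injz: "z u = z w \<longleftrightarrow> u = w" for u w
      using bx bz by (auto simp: bij_def inj_eq)
    have "x (z (inv' x (inv' z u))) = (transpose \<beta> d \<circ> transpose d \<alpha>) u" for u
    proof -
      obtain w where w: "u = z w" using bz by (metis bij_pointE)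
      obtain v where v: "w = x v" using bx by (metis bij_pointE)
      have e: "inv' z u = w" "inv' x w = v" using ix iz w v by auto
      have "x (z v) = (transpose \<beta> d \<circ> transpose d \<alpha>) u"
      proof (cases "v = d")
        case True
        then have "w = \<alpha>" "u = \<alpha>" using v w zfix \<alpha> by (auto simp: \<alpha>_def)
        then show ?thesis using True xfix[of \<beta>] \<beta> \<alpha> by (subst three_cycle_apply) (auto simp: \<beta>_def)
      next
        case vd: False
        show ?thesis
        proof (cases "v \<in> \<Gamma>")
          case True
          then have wv: "w = v" using xfix v by simp
          show ?thesis
          proof (cases "z v = d")
            case True
            then show ?thesis using w wv \<beta> \<alpha> by (subst three_cycle_apply) (auto simp: \<alpha>_def)
          next
            case False
            have "u = z v" using w wv by simp
            moreover have "z v \<in> \<Gamma>" using permutes_in_image[OF z(2), of v] True False by auto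
            moreover have "z v \<noteq> \<beta>" using vd injz by (simp add: \<beta>_def)
            ultimately show ?thesis using False \<alpha> \<beta> xfix by (subst three_cycle_apply) auto
          qed
        next
          case False
          then have zv: "z v = v" using zfix vd by simp
          have w': "w \<notin> \<Gamma>" using v False xfix injx by metis
          show ?thesis
          proof (cases "w = d")
            case True
            then show ?thesis using w zv v \<beta> \<alpha> by (subst three_cycle_apply) (auto simp: \<beta>_def)
          next
            case wd: False
            then have "u = w" using w w' zfix by simp
            moreover have "w \<noteq> \<alpha>" using v vd injx by (simp add: \<alpha>_def)
            moreover have "w \<noteq> \<beta>" using w' \<beta> by auto
            ultimately show ?thesis using wd zv v \<beta> \<alpha> by (subst three_cycle_apply) auto
          qed
        qed
      qed
      then show ?thesis using e by simp
    qed
    then have "x \<circ> (z \<circ> (inv' x \<circ> inv' z)) = transpose \<beta> d \<circ> transpose d \<alpha>" by (auto simp: fun_eq_iff)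
    moreover have "x \<circ> (z \<circ> (inv' x \<circ> inv' z)) \<in> J" by (intro comp inv x(1) z(1))
    ultimately show False using no3[of \<beta> d \<alpha>] \<beta> \<alpha> d\<Delta> \<Gamma>\<Omega> by auto
  qed
  then show ?thesis using \<Gamma>\<Omega> triv by blast
qed

text \<open>In type \<open>E8\<close> the line \<open>{i, 8}\<close> is allowed, so all permutations \<open>p\<close> of the nine coordinates act, through \<open>a p\<close>. The bound
is one less than the number of lines, on which the reflections do not all act in the same way.\<close>

locale e8_action = reflection_action 8 Y t for Y :: "'y set" and t :: "nat set \<Rightarrow> 'y \<Rightarrow> 'y" +
  fixes a :: "(nat \<Rightarrow> nat) \<Rightarrow> 'y \<Rightarrow> 'y"
  assumes a_transpose: "\<And>i j y. \<lbrakk>i < 9; j < 9; i \<noteq> j\<rbrakk> \<Longrightarrow> a (transpose i j) y = t {i, j} y"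
    and a_comp: "\<And>p q y. \<lbrakk>p permutes {..<9}; q permutes {..<9}\<rbrakk> \<Longrightarrow> a (p \<circ> q) y = a p (a q y)"
    and small: "card Y \<le> 119"
begin

sublocale transposition_action 9 Y t
  by (rule transposition_action) auto

lemma pl: "i < 9 \<Longrightarrow> j < 9 \<Longrightarrow> i \<noteq> j \<Longrightarrow> {i, j} \<in> root_lines 8"
  by (auto simp: root_lines_8)

lemma a_id: "a id y = y"
proof -
  have "transpose 0 (1::nat) permutes {..<9}" by (rule permutes_swap_id) auto
  then have "a (transpose 0 1 \<circ> transpose 0 1) y = t {0,1} (t {0,1} y)" by (simp add: a_comp a_transpose del: transpose_comp_involutory)
  then show ?thesis using t_invol[of 0 1 y] by simp
qed

lemma a_induct:
  assumes "p permutes {..<9}" and "P id"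
    and "\<And>i j p. \<lbrakk>i < 9; j < 9; i \<noteq> j; p permutes {..<9}; P p; \<And>y. a (transpose i j \<circ> p) y = t {i, j} (a p y)\<rbrakk> \<Longrightarrow> P (transpose i j \<circ> p)"
  shows "P p"
  using assms(1) finite_lessThan
proof (induction rule: permutes_induct)
  case (swap i j p)
  have "transpose i j permutes {..<9}" using swap by (intro permutes_swap_id) auto
  then have "a (transpose i j \<circ> p) y = t {i, j} (a p y)" for y using a_comp a_transpose swap by simp
  moreover have "i < 9" "j < 9" using swap by auto
  ultimately show ?case using swap by (intro assms(3))
qed (rule assms(2))

lemma a_closed: 
  assumes "p permutes {..<9}" "y \<in> Y" shows "a p y \<in> Y"
proof (rule a_induct[OF assms(1)])
  show "a id y \<in> Y" using assms(2) by (simp add: a_id)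
  fix i j p assume "i < 9" "j < 9" "i \<noteq> j" "a p y \<in> Y" and e: "\<And>y. a (transpose i j \<circ> p) y = t {i, j} (a p y)"
  then show "a (transpose i j \<circ> p) y \<in> Y" unfolding e by (intro t_closed)
qed

lemma a_inv: "p permutes {..<9} \<Longrightarrow> a (inv' p) (a p y) = y"
  using a_comp[of "inv' p" p y] permutes_inv[of p] permutes_inv_o(2)[of p] a_id by simp

lemma a_eqD:
  assumes "p permutes {..<9}" "q permutes {..<9}" "a p y = a q z"
  shows "a (inv' q \<circ> p) y = z"
  using a_comp[of "inv' q" p y] permutes_inv[OF assms(2)] assms a_inv by simp

lemma alt_a:
  assumes "p permutes {..<9}" shows "alt (a p y) (p ` B) \<longleftrightarrow> alt y B"
proof (rule a_induct[OF assms])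
  show "alt (a id y) (id ` B) \<longleftrightarrow> alt y B" by (simp add: a_id)
  fix i j p assume ij: "i < 9" "j < 9" "i \<noteq> j" and IH: "alt (a p y) (p ` B) \<longleftrightarrow> alt y B"
    and e: "\<And>y. a (transpose i j \<circ> p) y = t {i, j} (a p y)"
  show "alt (a (transpose i j \<circ> p) y) ((transpose i j \<circ> p) ` B) \<longleftrightarrow> alt y B"
    unfolding e image_comp[symmetric] alt_transpose[OF ij] by (rule IH)
qed

lemma block_a:
  assumes p: "p permutes {..<9}" and B: "block y B" shows "block (a p y) (p ` B)"
proof -
  have inj: "inj p" using p permutes_inj by blast
  have "C \<subseteq> p ` B" if C: "alt (a p y) C" "3 \<le> card C" "C \<inter> p ` B \<noteq> {}" for C
  proof -
    define D where "D = inv' p ` C"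
    have CD: "C = p ` D" unfolding D_def using permutes_inverses(1)[OF p] by (simp add: image_image)
    have "alt y D" using C(1) alt_a[OF p] CD by simp
    moreover have "card D = card C" unfolding CD by (simp add: card_image inj_on_subset[OF inj])
    moreover have "D \<inter> B \<noteq> {}" using C(3) unfolding CD by (simp add: image_Int[OF inj, symmetric])
    ultimately have "D \<subseteq> B" using block_absorbs[OF B] C(2) by simp
    then show ?thesis unfolding CD by (rule image_mono)
  qed
  moreover have "card (p ` B) = card B" by (simp add: card_image inj_on_subset[OF inj])
  ultimately show ?thesis using B alt_a[OF p] by (simp add: block_def)
qed

lemma block_unique: "block y B \<Longrightarrow> block y B' \<Longrightarrow> 10 \<le> card B + card B' \<Longrightarrow> B = B'"
proof (rule block_eq)
  assume *: "block y B" "block y B'" "10 \<le> card B + card B'"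
  then have sub: "B \<subseteq> {..<9}" "B' \<subseteq> {..<9}" by (auto simp: block_def alt_def)
  then have fin: "finite B" "finite B'" by (auto intro: finite_subset)
  show "B \<inter> B' \<noteq> {}"
  proof
    assume "B \<inter> B' = {}"
    then have "card (B \<union> B') = card B + card B'" using fin by (simp add: card_Un_disjoint)
    moreover have "card (B \<union> B') \<le> card {..<9::nat}" using sub by (intro card_mono) auto
    ultimately show False using *(3) by simp
  qed
qed

lemma block_subset: "block y B \<Longrightarrow> B \<subseteq> {..<9}" "block y B \<Longrightarrow> finite B" "block y B \<Longrightarrow> 3 \<le> card B"
  by (auto simp: block_def alt_def intro: finite_subset)

lemma few_points: "inj_on f I \<Longrightarrow> f ` I \<subseteq> Y \<Longrightarrow> card I \<le> 119"
  using card_mono[OF finite_Y, of "f ` I"] small by (simp add: card_image)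

text \<open>Otherwise no three-cycle fixes \<open>y\<close>, and \<open>large_trivial_subset\<close> gives five letters whose symmetric group, of
order 120, contains no stabiliser of \<open>y\<close> but the identity.\<close>

lemma exists_alt:
  assumes y: "y \<in> Y" shows "\<exists>S. alt y S \<and> card S = 3"
proof (rule ccontr)
  assume no: "\<nexists>S. alt y S \<and> card S = 3"
  define J where "J = {p. p permutes {..<9} \<and> a p y = y}"
  have inv: "inv' p \<in> J" if "p \<in> J" for p
  proof -
    have p: "p permutes {..<9}" "a p y = y" using that by (simp_all add: J_def)
    have "a (inv' p) y = y" using a_inv[OF p(1), of y] unfolding p(2) .
    then show ?thesis using permutes_inv[OF p(1)] by (simp add: J_def)
  qed
  have comp: "p \<circ> q \<in> J" if "p \<in> J" "q \<in> J" for p q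
    using that by (simp add: J_def permutes_compose a_comp)
  have "transpose i j \<circ> transpose j k \<notin> J" if ijk: "i \<in> {..<9}" "j \<in> {..<9}" "k \<in> {..<9}" "distinct [i, j, k]" for i j k
  proof
    assume "transpose i j \<circ> transpose j k \<in> J"
    moreover have "transpose i j permutes {..<9}" "transpose j k permutes {..<9}"
      using ijk by (auto intro: permutes_swap_id)
    ultimately have "t {i, j} (t {j, k} y) = y" using ijk by (simp add: J_def a_comp a_transpose)
    then have "t {i, j} (t {i, j} (t {j, k} y)) = t {i, j} y" by simp
    then have "t {j, k} y = t {i, j} y" using ijk t_invol[of i j "t {j, k} y"] by simp
    then have "alt y {i, j, k}" using ijk by (intro alt_triple) auto
    then show False using no ijk by auto
  qed
  then obtain \<Gamma> where \<Gamma>: "\<Gamma> \<subseteq> {..<9}" "card {..<9::nat} \<le> 2 * card \<Gamma>" and triv: "\<And>p. p \<in> J \<Longrightarrow> p permutes \<Gamma> \<Longrightarrow> p = id"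
    using large_trivial_subset[of "{..<9}" J] inv comp by (auto simp: J_def)
  have p9: "p permutes {..<9}" if "p permutes \<Gamma>" for p using that \<Gamma>(1) permutes_subset by blast
  have "inj_on (\<lambda>p. a p y) {p. p permutes \<Gamma>}"
  proof (rule inj_onI)
    fix p q assume pq: "p \<in> {p. p permutes \<Gamma>}" "q \<in> {p. p permutes \<Gamma>}" "a p y = a q y"
    then have "inv' q \<circ> p permutes \<Gamma>" by (simp add: permutes_compose permutes_inv)
    moreover have "a (inv' q \<circ> p) y = y" using pq p9 by (intro a_eqD) auto
    ultimately have "inv' q \<circ> p = id" using triv p9 by (simp add: J_def)
    then have "q \<circ> (inv' q \<circ> p) = q" by simp
    then show "p = q" using permutes_inv_o(1)[of q \<Gamma>] pq by (simp add: o_assoc)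
  qed
  moreover have "(\<lambda>p. a p y) ` {p. p permutes \<Gamma>} \<subseteq> Y" using a_closed p9 y by auto
  ultimately have "card {p. p permutes \<Gamma>} \<le> 119" by (rule few_points)
  moreover have "finite \<Gamma>" using \<Gamma>(1) finite_subset by blast
  ultimately have "fact (card \<Gamma>) \<le> (119::nat)" using card_permutations[of \<Gamma> "card \<Gamma>"] by simp
  moreover have "fact 5 \<le> (fact (card \<Gamma>) :: nat)" using \<Gamma>(2) by (intro fact_mono) simp
  ultimately show False by (simp add: fact_numeral)
qed

text \<open>The \<open>84\<close> triples are recognisable from the translates of \<open>y\<close>. If the stabiliser of \<open>y\<close> were smaller than that of \<open>T\<close>,
each of them would belong to two different translates, \<open>168\<close> in all.\<close>

lemma stabilised_triple:
  assumes y: "y \<in> Y" and T: "T \<subseteq> {..<9}" "card T = 3"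
    and stab: "\<And>p. p permutes {..<9} \<Longrightarrow> a p y = y \<Longrightarrow> p ` T = T"
    and q: "q permutes {..<9}" "q ` T = T"
  shows "a q y = y"
proof (rule ccontr)
  assume neq: "a q y \<noteq> y"
  define I where "I = {S. S \<subseteq> {..<9::nat} \<and> card S = 3}"
  have "\<exists>p. p permutes {..<9} \<and> p ` T = S" if "S \<in> I" for S
    using exists_permutation[of "{..<9}" T "{}" S "{}"] T that by (auto simp: I_def)
  then obtain P where P: "\<And>S. S \<in> I \<Longrightarrow> P S permutes {..<9} \<and> P S ` T = S" by metis
  \<comment> \<open>for each triple \<open>S\<close>, two candidates for translates of \<open>y\<close> attached to \<open>S\<close>\<close>
  define f where "f = (\<lambda>(S, e). a (if e then P S else P S \<circ> q) y)"
  have perm: "(if e then P S else P S \<circ> q) permutes {..<9}" if "S \<in> I" for S e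
    using P[OF that] q by (simp add: permutes_compose)
  have img: "(if e then P S else P S \<circ> q) ` T = S" if "S \<in> I" for S e
    using P[OF that] q(2) image_comp[of "P S" q T] by simp
  have "inj_on f (I \<times> UNIV)"
  proof (rule inj_onI, clarify)
    fix S e S' e' assume *: "S \<in> I" "S' \<in> I" "f (S, e) = f (S', e')"
    let ?r = "if e then P S else P S \<circ> q" and ?r' = "if e' then P S' else P S' \<circ> q"
    have eq: "a ?r y = a ?r' y" using *(3) by (simp add: f_def)
    have "a (inv' ?r' \<circ> ?r) y = y" by (rule a_eqD[OF perm[OF *(1)] perm[OF *(2)] eq])
    then have "(inv' ?r' \<circ> ?r) ` T = T"
      using perm[OF *(1), of e] perm[OF *(2), of e'] by (intro stab permutes_compose permutes_inv)
    then have "?r' ` ((inv' ?r' \<circ> ?r) ` T) = ?r' ` T" by simp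
    moreover have "?r' ` ((inv' ?r' \<circ> ?r) ` T) = ?r ` T"
      unfolding image_comp o_assoc permutes_inv_o(1)[OF perm[OF *(2), of e']] by simp
    ultimately have S: "S = S'" using img[OF *(1), of e] img[OF *(2), of e'] by simp
    have PS: "P S permutes {..<9}" using P *(1) by blast
    have "e = e'"
    proof (rule ccontr)
      assume "e \<noteq> e'"
      then have "a (P S) y = a (P S) (a q y)" using eq S a_comp[OF PS q(1), of y] by (auto split: if_splits)
      then show False using neq a_inv[OF PS] by metis
    qed
    then show "S = S' \<and> e = e'" using S by simp
  qed
  moreover have "f ` (I \<times> UNIV) \<subseteq> Y" unfolding f_def using a_closed[OF perm y] by auto
  ultimately have "card (I \<times> (UNIV :: bool set)) \<le> 119" by (rule few_points)
  moreover have "card I = 84" unfolding I_def using n_subsets[of "{..<9::nat}" 3] by (simp add: numeral_eq_Suc)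
  ultimately show False by (simp add: card_cartesian_product)
qed

end

lemma transpose_image_eq: "(i \<in> T \<longleftrightarrow> j \<in> T) \<Longrightarrow> transpose i j ` T = T"
  by (auto simp: transpose_def image_iff)

context e8_action
begin

definition orb :: "'y \<Rightarrow> 'y set" where
  "orb y = (\<lambda>p. a p y) ` {p. p permutes {..<9}}"

lemma orb_subset: "y \<in> Y \<Longrightarrow> orb y \<subseteq> Y"
  using a_closed by (auto simp: orb_def)

lemma orb_card:
  assumes y: "y \<in> Y" and B: "B \<subseteq> {..<9}"
    and stab: "\<And>p. p permutes {..<9} \<Longrightarrow> a p y = y \<Longrightarrow> p ` B = B"
  shows "9 choose card B \<le> card (orb y)"
proof -
  define I where "I = {S. S \<subseteq> {..<9::nat} \<and> card S = card B}"
  have "\<exists>p. p permutes {..<9} \<and> p ` B = S" if "S \<in> I" for S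
    using exists_permutation[of "{..<9}" B "{}" S "{}"] B that by (auto simp: I_def)
  then obtain P where P: "\<And>S. S \<in> I \<Longrightarrow> P S permutes {..<9} \<and> P S ` B = S" by metis
  have "inj_on (\<lambda>S. a (P S) y) I"
  proof (rule inj_onI)
    fix S S' assume *: "S \<in> I" "S' \<in> I" "a (P S) y = a (P S') y"
    have p: "P S permutes {..<9}" "P S' permutes {..<9}" using P * by auto
    have "a (inv' (P S') \<circ> P S) y = y" by (rule a_eqD[OF p *(3)])
    then have "(inv' (P S') \<circ> P S) ` B = B" using p by (intro stab permutes_compose permutes_inv)
    then have "P S' ` ((inv' (P S') \<circ> P S) ` B) = P S' ` B" by simp
    moreover have "P S' ` ((inv' (P S') \<circ> P S) ` B) = P S ` B"
      unfolding image_comp o_assoc permutes_inv_o(1)[OF p(2)] by simp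
    ultimately show "S = S'" using P * by simp
  qed
  then have "card I = card ((\<lambda>S. a (P S) y) ` I)" by (simp add: card_image)
  also have "\<dots> \<le> card (orb y)"
    using P finite_subset[OF orb_subset[OF y] finite_Y] by (intro card_mono) (auto simp: orb_def)
  finally show ?thesis unfolding I_def using n_subsets[of "{..<9::nat}" "card B"] by simp
qed

lemma orb_disjoint: "z \<notin> orb y \<Longrightarrow> orb y \<inter> orb z = {}"
proof (rule ccontr)
  assume z: "z \<notin> orb y" and "orb y \<inter> orb z \<noteq> {}"
  then obtain p q where pq: "p permutes {..<9}" "q permutes {..<9}" "a p y = a q z" by (auto simp: orb_def)
  then have "a (inv' q \<circ> p) y = z" by (intro a_eqD)
  moreover have "inv' q \<circ> p permutes {..<9}" using pq by (intro permutes_compose permutes_inv)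
  ultimately show False using z by (auto simp: orb_def)
qed

lemma orb_bound:
  assumes "y \<in> Y" "z \<in> Y" "z \<notin> orb y" shows "card (orb y) + card (orb z) \<le> 119"
proof -
  have "card (orb y) + card (orb z) = card (orb y \<union> orb z)"
    using assms orb_disjoint orb_subset finite_subset[OF _ finite_Y] by (simp add: card_Un_disjoint)
  also have "\<dots> \<le> card Y" using assms orb_subset by (intro card_mono finite_Y) auto
  finally show ?thesis using small by simp
qed

lemma orb_small: "y \<in> Y \<Longrightarrow> card (orb y) \<le> 119"
  using card_mono[OF finite_Y orb_subset] small by fastforce

text \<open>Permutations moving one block to a set containing \<open>0\<close> and the other to a set containing \<open>1\<close> produce different points
for different pairs of sets: the marked letters tell which block is which even if their sizes are equal. There are
\<open>210\<close> such pairs, or \<open>140\<close> when both blocks have four letters.\<close>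

lemma two_small_blocks:
  assumes y: "y \<in> Y" and B: "block y B" "block y B'" and neq: "B \<noteq> B'" and le: "card B \<le> 4" "card B' \<le> 4"
  shows False
proof -
  have disj: "B \<inter> B' = {}" using block_eq[OF B] neq by blast
  have fin: "finite B" "finite B'" and sub: "B \<subseteq> {..<9}" "B' \<subseteq> {..<9}" using block_subset B by auto
  have c: "card B = 3 \<or> card B = 4" "card B' = 3 \<or> card B' = 4" using block_subset(3)[OF B(1)] block_subset(3)[OF B(2)] le by auto
  let ?A = "{U. U \<subseteq> {2..<9::nat} \<and> card U = card B - 1}"
  let ?A' = "\<lambda>U. {U'. U' \<subseteq> {2..<9::nat} - U \<and> card U' = card B' - 1}"
  let ?I = "Sigma ?A ?A'"
  have "\<exists>p. p permutes {..<9} \<and> p ` B = insert 0 (fst x) \<and> p ` B' = insert 1 (snd x)" if "x \<in> ?I" for x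
  proof -
    obtain U U' where x: "x = (U, U')" by (cases x)
    have U: "U \<subseteq> {2..<9}" "card U = card B - 1" "U' \<subseteq> {2..<9} - U" "card U' = card B' - 1" using that x by auto
    have fU: "finite U" "finite U'" using finite_subset[OF U(1)] finite_subset[OF U(3)] by auto
    have n: "0 \<notin> U" "1 \<notin> U'" "0 \<notin> U'" "1 \<notin> U" using U by auto
    show ?thesis unfolding x fst_conv snd_conv
    proof (rule exists_permutation[OF _ sub _ _ disj])
      show "insert 0 U \<subseteq> {..<9}" "insert 1 U' \<subseteq> {..<9}" using U by auto
      show "insert 0 U \<inter> insert 1 U' = {}" using U n by auto
      show "card B = card (insert 0 U)" "card B' = card (insert 1 U')" using U n fU c by auto
    qed simp
  qed
  then have "\<forall>x\<in>?I. \<exists>p. p permutes {..<9} \<and> p ` B = insert 0 (fst x) \<and> p ` B' = insert 1 (snd x)" by (intro ballI)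
  from bchoice[OF this] obtain P where
    P': "\<forall>x\<in>?I. P x permutes {..<9} \<and> P x ` B = insert 0 (fst x) \<and> P x ` B' = insert 1 (snd x)" by (elim exE)
  have P: "P x permutes {..<9}" "P x ` B = insert 0 (fst x)" "P x ` B' = insert 1 (snd x)" if "x \<in> ?I" for x
    using bspec[OF P' that] by simp_all
  have "inj_on (\<lambda>x. a (P x) y) ?I"
  proof (rule inj_onI)
    fix x x' assume *: "x \<in> ?I" "x' \<in> ?I" "a (P x) y = a (P x') y"
    have bl: "block (a (P x) y) (insert 0 (fst x))" "block (a (P x) y) (insert 1 (snd x))" if "x \<in> ?I" for x
      using block_a[OF P(1)[OF that] B(1)] block_a[OF P(1)[OF that] B(2)] unfolding P(2,3)[OF that] .
    have "insert 0 (fst x) = insert 0 (fst x')" 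
      using bl(1)[OF *(1)] bl(1)[OF *(2)] unfolding *(3) by (rule block_eq) auto
    moreover have "insert 1 (snd x) = insert 1 (snd x')" 
      using bl(2)[OF *(1)] bl(2)[OF *(2)] unfolding *(3) by (rule block_eq) auto
    moreover have "0 \<notin> fst x" "0 \<notin> fst x'" "1 \<notin> snd x" "1 \<notin> snd x'" using *(1,2) by auto
    ultimately show "x = x'" by (metis insert_ident prod_eqI)
  qed
  moreover have "(\<lambda>x. a (P x) y) ` ?I \<subseteq> Y" by (intro image_subsetI a_closed[OF P(1) y])
  ultimately have le119: "card ?I \<le> 119" by (rule few_points)
  have "card ?I = (\<Sum>U\<in>?A. card (?A' U))" by (rule card_SigmaI) (auto intro: finite_subset)
  also have "\<dots> = (\<Sum>U\<in>?A. (7 - (card B - 1)) choose (card B' - 1))"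
  proof (rule sum.cong[OF refl])
    fix U assume U: "U \<in> ?A"
    then have "finite U" using finite_subset by auto
    then have "card ({2..<9} - U) = 7 - (card B - 1)" using U by (subst card_Diff_subset) auto
    then show "card (?A' U) = (7 - (card B - 1)) choose (card B' - 1)" using n_subsets[of "{2..<9} - U" "card B' - 1"] by simp
  qed
  also have "\<dots> = (7 choose (card B - 1)) * ((7 - (card B - 1)) choose (card B' - 1))"
    using n_subsets[of "{2..<9::nat}" "card B - 1"] by simp
  finally have "(7 choose (card B - 1)) * ((7 - (card B - 1)) choose (card B' - 1)) \<le> 119" using le119 by simp
  then show False using c by (elim disjE) (simp_all add: numeral_eq_Suc One_nat_def)
qed

lemma stabilised_six:
  assumes y: "y \<in> Y" and B: "B \<subseteq> {..<9}" "card B = 6"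
    and stab: "\<And>p. p permutes {..<9} \<Longrightarrow> a p y = y \<Longrightarrow> p ` B = B"
    and q: "q permutes {..<9}" "q ` B = B"
  shows "a q y = y"
proof -
  have compl: "p ` ({..<9} - B) = {..<9} - B" if "p permutes {..<9}" "p ` B = B" for p
    using image_set_diff[OF permutes_inj[OF that(1)], of "{..<9}" B] permutes_image[OF that(1)] that(2) by simp
  show ?thesis
  proof (rule stabilised_triple[OF y _ _ _ q(1)])
    show "card ({..<9} - B) = 3" using B finite_subset[OF B(1)] by (simp add: card_Diff_subset)
    show "p ` ({..<9} - B) = {..<9} - B" if "p permutes {..<9}" "a p y = y" for p
      using compl[OF that(1) stab[OF that]] .
    show "q ` ({..<9} - B) = {..<9} - B" by (rule compl[OF q])
  qed simp
qed

text \<open>A largest block of size four or five is the only one of its size, since two small blocks are too many and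
two of size five do not fit; so it has \<open>9 choose 4 = 126\<close> translates. A unique block of size three has
\<open>y\<close> fixed by its full stabiliser, which contains three-cycles on the other six letters, and so a second block.\<close>

lemma big_block:
  assumes y: "y \<in> Y" obtains B where "block y B" "6 \<le> card B"
proof -
  obtain S where "alt y S" "card S = 3" using exists_alt[OF y] by blast
  then obtain B0 where B0: "block y B0" using exists_block[of y S] by auto
  have bound: "card B \<le> 9" if "block y B" for B
    using card_mono[of "{..<9}" B] block_subset[OF that] by simp
  obtain B where B: "block y B" and max: "\<And>B'. block y B' \<Longrightarrow> card B' \<le> card B"
    using ex_has_greatest_nat[of "block y" B0 card 10] B0 bound by fastforce
  note sub = block_subset[OF B]
  have "6 \<le> card B"
  proof (rule ccontr)
    assume "\<not> 6 \<le> card B"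
    then have c: "card B = 3 \<or> card B = 4 \<or> card B = 5" using sub(3) by linarith
    have only: "B' = B" if B': "block y B'" "card B' = card B" for B'
    proof (rule ccontr)
      assume neq: "B' \<noteq> B"
      then have "card B \<noteq> 5" using block_unique[OF B' (1) B] B'(2) by auto
      then show False using two_small_blocks[OF y B B'(1)] neq B'(2) c by auto
    qed
    have stab: "p ` B = B" if "p permutes {..<9}" "a p y = y" for p
    proof -
      have "block y (p ` B)" using block_a[OF that(1) B] that(2) by simp
      then show ?thesis using permutes_inj_on[OF that(1)] by (intro only) (auto simp: card_image)
    qed
    have "9 choose card B \<le> 119" using orb_card[OF y sub(1) stab] orb_small[OF y] by simp
    then have c3: "card B = 3" using c by (auto simp: numeral_eq_Suc One_nat_def)
    have "card ({..<9} - B) = 6" using sub c3 by (subst card_Diff_subset) auto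
    then have "3 \<le> card ({..<9} - B)" by simp
    then obtain C where C: "C \<subseteq> {..<9} - B" "card C = 3" by (rule obtain_subset_with_card_n)
    then obtain i j k where ijk: "C = {i, j, k}" "i \<noteq> j" "i \<noteq> k" "j \<noteq> k" by (auto simp: card_3_iff)
    have l: "i < 9" "j < 9" "k < 9" "i \<notin> B" "j \<notin> B" "k \<notin> B" using C ijk by auto
    have p: "transpose i j permutes {..<9}" "transpose j k permutes {..<9}" using l by (auto intro: permutes_swap_id)
    have "a (transpose i j \<circ> transpose j k) y = y"
    proof (rule stabilised_triple[OF y sub(1) c3 stab])
      have "(transpose i j \<circ> transpose j k) ` B = transpose i j ` (transpose j k ` B)" by (simp add: image_comp)
      then show "(transpose i j \<circ> transpose j k) ` B = B" using l by (simp add: transpose_image_eq)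
    qed (use p in \<open>auto intro: permutes_compose\<close>)
    then have "t {i, j} (t {j, k} y) = y" using p ijk l by (simp add: a_comp a_transpose)
    then have "t {i, j} (t {i, j} (t {j, k} y)) = t {i, j} y" by simp
    then have "t {j, k} y = t {i, j} y" using ijk l t_invol[of i j "t {j, k} y"] by simp
    then have "alt y C" unfolding ijk(1) using ijk l by (intro alt_triple) auto
    then obtain B' where B': "block y B'" "C \<subseteq> B'" using exists_block C(2) by (metis order_refl)
    have "B' \<noteq> B" using B' C ijk(1) by blast
    then show False using two_small_blocks[OF y B B'(1)] max[OF B'(1)] c3 by auto
  qed
  then show thesis using B that by blast
qed

text \<open>The full stabiliser of the block fixes \<open>y\<close>, by \<open>stabilised_triple\<close> for the complementary triple.\<close>

lemma six_fixed:
  assumes y: "y \<in> Y" and B: "block y B" "card B = 6" and ij: "i < 9" "j < 9" "i \<noteq> j"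
  shows "t {i, j} y = y \<longleftrightarrow> (i \<in> B \<longleftrightarrow> j \<in> B)"
proof
  note sub = block_subset[OF B(1)]
  have stab: "p ` B = B" if "p permutes {..<9}" "a p y = y" for p
  proof -
    have "block y (p ` B)" using block_a[OF that(1) B(1)] that(2) by simp
    then show ?thesis using permutes_inj_on[OF that(1)] B by (intro block_unique) (auto simp: card_image)
  qed
  have p: "transpose i j permutes {..<9}" using ij by (auto intro: permutes_swap_id)
  {
    assume "t {i, j} y = y"
    then have "transpose i j ` B = B" using stab[OF p] ij by (simp add: a_transpose)
    then show "i \<in> B \<longleftrightarrow> j \<in> B" by (metis imageI transpose_apply_first transpose_apply_second)
  next
    assume "i \<in> B \<longleftrightarrow> j \<in> B"
    then have "a (transpose i j) y = y"
      by (intro stabilised_six[OF y sub(1) B(2) stab p] transpose_image_eq)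
    then show "t {i, j} y = y" using ij by (simp add: a_transpose)
  }
qed

text \<open>A second orbit of points with a block of size six would bring the total to \<open>2 \<cdot> 84\<close>.\<close>

lemma six_unique:
  assumes "y \<in> Y" "z \<in> Y" "block y B" "block z B" "card B = 6" shows "y = z"
proof -
  note sub = block_subset[OF assms(3)]
  have stab: "p ` B = B" if "p permutes {..<9}" "a p y = y" "block y B" for p y
  proof -
    have "block y (p ` B)" using block_a[OF that(1,3)] that(2) by simp
    then show ?thesis using permutes_inj_on[OF that(1)] that assms(5) by (intro block_unique) (auto simp: card_image)
  qed
  have "9 choose 6 \<le> card (orb y)" "9 choose 6 \<le> card (orb z)"
    using orb_card[OF assms(1) sub(1) stab] orb_card[OF assms(2) sub(1) stab] assms by auto
  moreover have "9 choose 6 = (84::nat)" by (simp add: numeral_eq_Suc One_nat_def)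
  ultimately have "z \<in> orb y" using orb_bound[OF assms(1,2)] by fastforce
  then obtain p where p: "p permutes {..<9}" "z = a p y" by (auto simp: orb_def)
  have "block z (p ` B)" using block_a[OF p(1) assms(3)] p(2) by simp
  then have "p ` B = B" using permutes_inj_on[OF p(1)] assms by (intro block_unique[of z]) (auto simp: card_image)
  then have "a p y = y"
    by (intro stabilised_six[OF assms(1) sub(1) assms(5) stab[OF _ _ assms(3)] p(1)])
  then show ?thesis using p by simp
qed

text \<open>The two orbits would have \<open>84 + 36 = 120\<close> points.\<close>

lemma no_six_and_seven:
  assumes "y \<in> Y" "z \<in> Y" "block y B" "block z C" "card B = 6" "card C = 7" shows False
proof -
  have stab: "p ` D = D" if "p permutes {..<9}" "a p w = w" "block w D" "6 \<le> card D" for p w D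
  proof -
    have "block w (p ` D)" using block_a[OF that(1,3)] that(2) by simp
    then show ?thesis using permutes_inj_on[OF that(1)] that by (intro block_unique) (auto simp: card_image)
  qed
  have "9 choose 6 \<le> card (orb y)" "9 choose 7 \<le> card (orb z)"
    using orb_card[OF assms(1) block_subset(1)[OF assms(3)] stab] orb_card[OF assms(2) block_subset(1)[OF assms(4)] stab] assms by auto
  moreover have "9 choose 6 = (84::nat)" "9 choose 7 = (36::nat)" by (simp_all add: numeral_eq_Suc One_nat_def)
  ultimately have "z \<in> orb y" using orb_bound[OF assms(1,2)] by fastforce
  then obtain p where p: "p permutes {..<9}" "z = a p y" by (auto simp: orb_def)
  have "block z (p ` B)" using block_a[OF p(1) assms(3)] p(2) by simp
  moreover have "card (p ` B) = 6" using permutes_inj_on[OF p(1)] assms by (simp add: card_image)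
  ultimately have "p ` B = C" using assms by (intro block_unique[of z]) auto
  then show False using \<open>card (p ` B) = 6\<close> assms by simp
qed

end

lemma triple_root_line: "S \<subseteq> {..<9} \<Longrightarrow> card S = 3 \<Longrightarrow> S \<in> root_lines 8"
  by (simp add: root_lines_8)

lemma star_triple_pair:
  assumes "card S = 3" "k \<in> S" "l \<notin> S" shows "star S {k, l} = insert l (S - {k})"
proof -
  have "S \<inter> {k, l} = {k}" using assms by auto
  moreover have "card {k, l} = 2" using assms(2,3) by (cases "k = l") auto
  ultimately show ?thesis using assms by (auto simp: star_def adjacent_def third_def)
qed

lemma star_triple_pair_same:
  assumes "card S = 3" "k \<noteq> l" "k \<in> S \<longleftrightarrow> l \<in> S" shows "star S {k, l} = {k, l}"
proof -
  have "S \<inter> {k, l} = {} \<or> S \<inter> {k, l} = {k, l}" using assms by auto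
  moreover have "card {k, l} = 2" using assms by auto
  ultimately show ?thesis using assms by (auto simp: star_def adjacent_def)
qed

context e8_action
begin

lemma swap_triple:
  assumes "S \<subseteq> {..<9}" "card S = 3" "i < 9" "j < 9" "i \<noteq> j" "i \<in> S \<longleftrightarrow> j \<in> S"
  shows "t {i, j} (t S y) = t S (t {i, j} y)"
  using conj[OF pl[OF assms(3-5)] triple_root_line[OF assms(1,2)], of y] assms(5,6)
  by (simp add: star_pair transpose_image_eq)

lemma alt_triple_reflection:
  assumes S: "S \<subseteq> {..<9}" "card S = 3" and A: "A \<subseteq> S \<or> A \<inter> S = {}" "alt y A"
  shows "alt (t S y) A"
proof -
  have sub: "A \<subseteq> {..<9}" using A(2) by (simp add: alt_def)
  obtain v where v: "\<forall>i\<in>A. \<forall>j\<in>A. i \<noteq> j \<longrightarrow> t {i, j} y = v" using A(2) unfolding alt_def by (elim conjE exE)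
  have "t {i, j} (t S y) = t S v" if "i \<in> A" "j \<in> A" "i \<noteq> j" for i j
  proof -
    have "i < 9" "j < 9" "i \<in> S \<longleftrightarrow> j \<in> S" using sub that A(1) by auto
    then show ?thesis using swap_triple[OF S, of i j y] v that by simp
  qed
  then show ?thesis unfolding alt_def using sub by blast
qed

lemma t_inj: "R \<in> root_lines 8 \<Longrightarrow> t R x = t R y \<Longrightarrow> x = y"
  by (metis invol)

text \<open>The reflection in \<open>S\<close> commutes with the transpositions that preserve \<open>S\<close>, so by \<open>six_fixed\<close> the partitions of \<open>S\<close> and of its
complement induced by \<open>B\<close> and by \<open>B'\<close> coincide. Sizes exclude that the roles of inside and outside are exchanged
on either part, hence \<open>B' = B\<close> and uniqueness applies.\<close>

lemma six_complement:
  assumes y: "y \<in> Y" and B: "block y B" "card B = 6" and z: "block (t S y) B'" "card B' = 6"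
    and S: "S \<subseteq> {..<9}" "card S = 3" "\<not> S \<subseteq> B"
  shows "t S y = y"
proof -
  let ?z = "t S y"
  have zY: "?z \<in> Y" using closed[OF triple_root_line] S y by blast
  note sub = block_subset[OF B(1)] and sub' = block_subset[OF z(1)]
  have key: "(i \<in> B' \<longleftrightarrow> j \<in> B') \<longleftrightarrow> (i \<in> B \<longleftrightarrow> j \<in> B)"
    if ij: "i < 9" "j < 9" "i \<in> S \<longleftrightarrow> j \<in> S" for i j
  proof (cases "i = j")
    case False
    have "t {i, j} ?z = ?z \<longleftrightarrow> t {i, j} y = y"
      unfolding swap_triple[OF S(1,2) ij(1,2) False ij(3)] using t_inj[OF triple_root_line[OF S(1,2)]] by metis
    then show ?thesis using six_fixed[OF y B ij(1,2) False] six_fixed[OF zY z ij(1,2) False] by simp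
  qed simp
  have parts: "(\<forall>i\<in>A. i \<in> B' \<longleftrightarrow> i \<in> B) \<or> (\<forall>i\<in>A. i \<in> B' \<longleftrightarrow> i \<notin> B)"
    if A: "A \<subseteq> {..<9}" "A \<subseteq> S \<or> A \<inter> S = {}" for A
  proof (rule ccontr)
    assume "\<not> ?thesis"
    then obtain i j where "i \<in> A" "j \<in> A" "(i \<in> B') \<noteq> (i \<in> B)" "(j \<in> B') \<noteq> (j \<notin> B)" by blast
    moreover have "i < 9" "j < 9" "i \<in> S \<longleftrightarrow> j \<in> S" using A \<open>i \<in> A\<close> \<open>j \<in> A\<close> by auto
    ultimately show False using key by blast
  qed
  have fS: "finite S" using S(1) finite_subset by blast
  have cells: "B = (B \<inter> S) \<union> (B - S)" "B' = (B' \<inter> S) \<union> (B' - S)" by auto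
  have cB: "card (B \<inter> S) + card (B - S) = 6" using B(2) sub(2) by (metis Diff_disjoint Int_Diff_disjoint Int_Diff_Un card_Un_disjoint finite_Diff finite_Int)
  have cB': "card (B' \<inter> S) + card (B' - S) = 6" using z(2) sub'(2) by (metis Diff_disjoint Int_Diff_disjoint Int_Diff_Un card_Un_disjoint finite_Diff finite_Int)
  have c3: "card (B \<inter> S) < 3"
  proof -
    have "B \<inter> S \<subset> S" using S(3) by auto
    then show ?thesis using psubset_card_mono[OF fS] S(2) by simp
  qed
  have cS: "card (S - B) = 3 - card (B \<inter> S)" using fS S(2) card_Diff_subset_Int[of S B] sub(2) by (simp add: Int_commute)
  have cSc: "card ({..<9} - S - B) = 6 - card (B - S)"
  proof -
    have "card ({..<9} - S) = 6" using S fS by (simp add: card_Diff_subset)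
    moreover have "card ({..<9} - S - B) = card ({..<9} - S) - card (B - S)"
    proof -
      have "{..<9} - S - B = ({..<9} - S) - (B - S)" by auto
      moreover have "B - S \<subseteq> {..<9} - S" using sub by auto
      ultimately show ?thesis using sub(2) by (simp add: card_Diff_subset)
    qed
    ultimately show ?thesis by simp
  qed
  have in1: "B' \<inter> S = B \<inter> S \<or> B' \<inter> S = S - B" using parts[OF S(1)] by blast
  have in2: "B' - S = B - S \<or> B' - S = {..<9} - S - B" using parts[of "{..<9} - S"] sub(1) sub'(1) by auto
  have le: "card (B - S) \<le> 6" using cB by simp
  have "B' \<inter> S = B \<inter> S \<and> B' - S = B - S"
  proof (rule ccontr)
    assume neg: "\<not> ?thesis"
    from in1 in2 show False
    proof (elim disjE)
      assume "B' \<inter> S = B \<inter> S" "B' - S = B - S" then show False using neg by simp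
    next
      assume e: "B' \<inter> S = B \<inter> S" "B' - S = {..<9} - S - B"
      then have "card (B \<inter> S) + (6 - card (B - S)) = 6" using cB' cSc by simp
      then show False using cB c3 le by simp
    next
      assume e: "B' \<inter> S = S - B" "B' - S = B - S"
      then have "(3 - card (B \<inter> S)) + card (B - S) = 6" using cB' cS by simp
      then show False using cB c3 by presburger
    next
      assume e: "B' \<inter> S = S - B" "B' - S = {..<9} - S - B"
      then have "(3 - card (B \<inter> S)) + (6 - card (B - S)) = 6" using cB' cS cSc by simp
      then show False using cB c3 le by simp
    qed
  qed
  then have "B' = B" using cells by simp
  then show ?thesis using six_unique[OF zY y z(1) _ z(2)] B by simp
qed

text \<open>The block \<open>B'\<close> of \<open>t S y\<close> has size six, and then \<open>six_complement\<close> applies, or it misses at most one letter, since size seven is excluded. In that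
case its parts outside and inside \<open>S\<close> are carried back into \<open>B\<close>, which forces \<open>S \<subseteq> B\<close> or \<open>S \<inter> B = {}\<close>.\<close>

lemma triple_fixes_six:
  assumes y: "y \<in> Y" and B: "block y B" "card B = 6"
    and S: "S \<subseteq> {..<9}" "card S = 3" "\<not> S \<subseteq> B" "S \<inter> B \<noteq> {}"
  shows "t S y = y"
proof -
  let ?z = "t S y"
  have zY: "?z \<in> Y" using closed[OF triple_root_line] S y by blast
  obtain B' where B': "block ?z B'" "6 \<le> card B'" using big_block[OF zY] by blast
  note sub = block_subset[OF B(1)] and sub' = block_subset[OF B'(1)]
  have fS: "finite S" using S(1) finite_subset by blast
  have compl: "card ({..<9} - B') = 9 - card B'" using sub' by (simp add: card_Diff_subset)
  consider "card B' = 6" | "card B' = 7" | "8 \<le> card B'" using B'(2) by linarith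
  then show ?thesis
  proof cases
    case 1
    then show ?thesis using six_complement[OF y B B'(1)] S by simp
  next
    case 2
    then show ?thesis using no_six_and_seven[OF y zY B(1) B'(1) B(2)] by simp
  next
    case 3
    have undo: "t S ?z = y" using invol triple_root_line[OF S(1,2)] by simp
    have altz: "alt ?z B'" using B'(1) by (simp add: block_def)
    have absorb: "A \<subseteq> B" if A: "A \<subseteq> B'" "A \<subseteq> S \<or> A \<inter> S = {}" "3 \<le> card A" "A \<inter> B \<noteq> {}" for A
      using alt_triple_reflection[OF S(1,2) A(2) alt_subset[OF altz A(1)]] undo block_absorbs[OF B(1)] A(3,4) by simp
    have "card (B' - S) = card B' - card (B' \<inter> S)" using sub' by (simp add: card_Diff_subset_Int)
    moreover have "card (B' \<inter> S) \<le> card S" using fS by (intro card_mono) auto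
    ultimately have c5: "5 \<le> card (B' - S)" using 3 S(2) by simp
    have "(B' - S) \<inter> B \<noteq> {}"
    proof
      assume "(B' - S) \<inter> B = {}"
      then have "B' - S \<subseteq> {..<9} - B" using sub'(1) by auto
      then have "card (B' - S) \<le> card ({..<9} - B)" by (intro card_mono) auto
      then show False using c5 sub B(2) by (simp add: card_Diff_subset)
    qed
    then have BS: "B' - S \<subseteq> B" using c5 by (intro absorb) auto
    show ?thesis
    proof (cases "S \<subseteq> B'")
      case True
      then have "S \<subseteq> B" using S by (intro absorb) auto
      then show ?thesis using S(3) by simp
    next
      case False
      then obtain m where m: "m \<in> S" "m \<notin> B'" by blast
      have eq: "{m} = {..<9} - B'"
      proof (rule card_seteq)
        show "{m} \<subseteq> {..<9} - B'" using m S(1) by auto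
        show "card ({..<9} - B') \<le> card {m}" using compl 3 by simp
      qed simp
      have "{..<9} - B' \<subseteq> S" unfolding eq[symmetric] using m(1) by simp
      then have "{..<9} - S \<subseteq> B' - S" by blast
      then have "{..<9} - S \<subseteq> B" using BS by blast
      moreover have "card ({..<9} - S) = 6" using S fS by (simp add: card_Diff_subset)
      ultimately have "{..<9} - S = B" using sub(2) B(2) by (intro card_subset_eq) auto
      then have "S \<inter> B = {}" by blast
      then show ?thesis using S(4) by simp
    qed
  qed
qed

text \<open>Let \<open>T\<close> be the complement of the block and \<open>z = t T y\<close>. If \<open>z\<close> has a block of size six, then \<open>z = y\<close>; conjugating the
reflection in \<open>T\<close> by that in a triple \<open>S\<close> with \<open>\<bar>S \<inter> T\<bar> = 2\<close> gives a transposition across \<open>B\<close> that fixes \<open>y\<close>, a contradiction.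
If the block of \<open>z\<close> misses at most one letter, then \<open>z\<close> is fixed by all transpositions. A triple \<open>S\<close> with \<open>\<bar>S \<inter> T\<bar> = 1\<close>
is orthogonal to \<open>T\<close> and fixes \<open>y\<close>, so it fixes \<open>z\<close>; then all triples fix \<open>z\<close>, and \<open>T\<close> gives \<open>y = z\<close>.\<close>

lemma no_six:
  assumes y: "y \<in> Y" and B: "block y B" shows "card B \<noteq> 6"
proof
  assume six: "card B = 6"
  note sub = block_subset[OF B]
  define T where "T = {..<9} - B"
  have T: "T \<subseteq> {..<9}" "card T = 3" "T \<inter> B = {}" using sub six by (auto simp: T_def card_Diff_subset)
  have cover: "i \<in> T \<longleftrightarrow> i \<notin> B" if "i < 9" for i using that by (simp add: T_def)
  have Tr: "T \<in> root_lines 8" by (rule triple_root_line[OF T(1,2)])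
  obtain u j1 j2 where Tu: "T = {u, j1, j2}" "u \<noteq> j1" "u \<noteq> j2" "j1 \<noteq> j2" using T(2) by (auto simp: card_3_iff)
  have "2 \<le> card B" using six by simp
  then obtain I where "I \<subseteq> B" "card I = 2" by (rule obtain_subset_with_card_n)
  then obtain i1 i2 where I: "i1 \<in> B" "i2 \<in> B" "i1 \<noteq> i2" by (auto simp: card_2_iff)
  have l: "u < 9" "j1 < 9" "j2 < 9" "i1 < 9" "i2 < 9" using Tu T(1) I sub(1) by auto
  have ne: "i1 \<noteq> u" "i1 \<noteq> j1" "i1 \<noteq> j2" "i2 \<noteq> u" "i2 \<noteq> j1" "i2 \<noteq> j2" using I T(3) Tu(1) by auto
  have BT: "u \<notin> B" "j1 \<notin> B" "j2 \<notin> B" using T(3) Tu(1) by auto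
  let ?z = "t T y"
  have zY: "?z \<in> Y" using closed[OF Tr y] .
  obtain B' where B': "block ?z B'" "6 \<le> card B'" using big_block[OF zY] by blast
  note sub' = block_subset[OF B'(1)]
  have moved: "t {i1, j1} y \<noteq> y" using six_fixed[OF y B six, of i1 j1] l ne I BT by simp
  consider "card B' = 6" | "card B' = 7" | "8 \<le> card B'" using B'(2) by linarith
  then show False
  proof cases
    case 1
    have "?z = y" using six_complement[OF y B six B'(1) 1 T(1,2)] T(2,3) by (metis card.empty inf.absorb_iff2 inf_commute zero_neq_numeral)
    define S where "S = {u, j2, i1}"
    have S: "S \<subseteq> {..<9}" "card S = 3" "\<not> S \<subseteq> B" "S \<inter> B \<noteq> {}" using l ne Tu I BT by (auto simp: S_def)
    have Sy: "t S y = y" by (rule triple_fixes_six[OF y B six S])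
    have ST: "S \<inter> T = {u, j2}" "S - T = {i1}" "T - S = {j1}" using Tu ne unfolding S_def by auto
    have "card (S \<inter> T) = 2" unfolding ST using Tu by simp
    then have "star S T = {i1, j1}" using ST S(2) T(2) by (simp add: star_def adjacent_def third_def insert_commute)
    then have "t {i1, j1} y = y" using conj_star[OF Tr triple_root_line[OF S(1,2)], of y] Sy \<open>?z = y\<close> by simp
    then show False using moved by simp
  next
    case 2
    then show False using no_six_and_seven[OF y zY B B'(1) six] by simp
  next
    case 3
    have cell: "t {i, j} ?z = ?z" if "i < 9" "j < 9" "i \<noteq> j" "i \<in> B \<longleftrightarrow> j \<in> B" for i j
      using swap_triple[OF T(1,2) that(1-3), of y] six_fixed[OF y B six that(1-3)] cover that by simp
    have cB': "card ({..<9} - B') \<le> 1" using sub' 3 by (simp add: card_Diff_subset)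
    have miss: "i = j" if "i < 9" "j < 9" "i \<notin> B'" "j \<notin> B'" for i j
    proof (rule ccontr)
      assume "i \<noteq> j"
      then have "card {i, j} \<le> card ({..<9} - B')" using that by (intro card_mono) auto
      then show False using cB' \<open>i \<noteq> j\<close> by simp
    qed
    have altz: "alt ?z B'" using B'(1) by (simp add: block_def)
    have inner: "t {i, j} ?z = ?z" if ij: "i \<in> B'" "j \<in> B'" "i \<noteq> j" for i j
    proof -
      have "card B - 1 \<le> card (B \<inter> B')"
      proof -
        have "B - ({..<9} - B') = B \<inter> B'" using sub(1) by auto
        then show ?thesis using diff_card_le_card_Diff[of "{..<9} - B'" B] cB' by simp
      qed
      then have "2 \<le> card (B \<inter> B')" using six by simp
      then obtain K where "K \<subseteq> B \<inter> B'" "card K = 2" by (rule obtain_subset_with_card_n)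
      then obtain k k' where k: "k \<in> B \<inter> B'" "k' \<in> B \<inter> B'" "k \<noteq> k'" by (auto simp: card_2_iff)
      have "t {k, k'} ?z = ?z" using k sub(1) by (intro cell) auto
      then show ?thesis using altD[OF altz, of i j k k'] ij k by simp
    qed
    have outer: "t {i, j} ?z = ?z" if ij: "i < 9" "j < 9" "i \<notin> B'" "i \<noteq> j" for i j
    proof -
      have "\<exists>k. k < 9 \<and> k \<noteq> i \<and> k \<noteq> j \<and> (i \<in> B \<longleftrightarrow> k \<in> B)"
      proof (rule ccontr)
        assume no: "\<nexists>k. k < 9 \<and> k \<noteq> i \<and> k \<noteq> j \<and> (i \<in> B \<longleftrightarrow> k \<in> B)"
        have "B \<subseteq> {i, j} \<or> T \<subseteq> {i, j}" using no sub(1) T(1) cover by blast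
        moreover have "card {i, j} = 2" using ij by simp
        ultimately show False using card_mono[of "{i, j}" B] card_mono[of "{i, j}" T] six T(2) by auto
      qed
      then obtain k where k: "k < 9" "k \<noteq> i" "k \<noteq> j" "i \<in> B \<longleftrightarrow> k \<in> B" by blast
      have "k \<in> B'" "j \<in> B'" using miss[of i k] miss[of i j] k ij by auto
      then have "t {k, j} ?z = ?z" using inner k by blast
      moreover have "t {i, k} ?z = ?z" using cell[of i k] k ij by blast
      ultimately show ?thesis using clique[of i k j ?z ?z] k ij by simp
    qed
    have all: "t {i, j} ?z = ?z" if "i < 9" "j < 9" "i \<noteq> j" for i j
      using inner[of i j] outer[of i j] outer[of j i] that by (cases "i \<in> B'"; cases "j \<in> B'") (auto simp: insert_commute)
    define S where "S = {u, i1, i2}"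
    have S: "S \<subseteq> {..<9}" "card S = 3" "\<not> S \<subseteq> B" "S \<inter> B \<noteq> {}" using l ne Tu I BT by (auto simp: S_def)
    note Sr = triple_root_line[OF S(1,2)]
    have "S \<inter> T = {u}" using Tu ne by (auto simp: S_def)
    then have "\<not> adjacent S T" using S T by (simp add: adjacent_def)
    then have "t S ?z = t T (t S y)" by (rule commuting[OF Sr Tr])
    then have Sz: "t S ?z = ?z" using triple_fixes_six[OF y B six S] by simp
    define S2 where "S2 = {u, j1, i2}"
    have S2: "S2 \<subseteq> {..<9}" "card S2 = 3" using l ne Tu I BT by (auto simp: S2_def)
    note S2r = triple_root_line[OF S2]
    have "star {i1, j1} S = S2" using Tu ne I by (subst star_pair) (auto simp: S_def S2_def transpose_def)
    then have S2z: "t S2 ?z = ?z"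
      using conj_star[OF Sr pl[of i1 j1], of ?z] all[of i1 j1] l ne Sz by simp
    have "star {i2, j2} S2 = T" using Tu ne I by (subst star_pair) (auto simp: S2_def transpose_def)
    then have "t T ?z = ?z"
      using conj_star[OF S2r pl[of i2 j2], of ?z] all[of i2 j2] l ne S2z by simp
    then have "y = ?z" using invol[OF Tr, of y] by simp
    then have "t {i1, j1} y = y" using all[of i1 j1] l ne by metis
    then show False using moved by simp
  qed
qed

lemma huge_block:
  assumes "y \<in> Y" obtains B where "block y B" "7 \<le> card B"
proof -
  obtain B where B: "block y B" "6 \<le> card B" using big_block[OF assms] by blast
  then have "card B \<noteq> 6" using no_six[OF assms] by blast
  then show thesis using B by (intro that[of B]) auto
qed

lemma huge_block_absorbs:
  assumes B: "block y B" "7 \<le> card B" and A: "alt y A" "3 \<le> card A"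
  shows "A \<subseteq> B"
proof (rule block_absorbs[OF B(1) A])
  show "A \<inter> B \<noteq> {}"
  proof
    assume "A \<inter> B = {}"
    then have "A \<subseteq> {..<9} - B" using A(1) by (auto simp: alt_def)
    then have "card A \<le> card ({..<9} - B)" by (intro card_mono) auto
    then show False using A(2) B block_subset[OF B(1)] by (simp add: card_Diff_subset)
  qed
qed

text \<open>Reflections with the same value \<open>v\<close> at \<open>y\<close> exchange \<open>y\<close> and \<open>v\<close>, and so do their conjugates by each other.\<close>

lemma agree_star:
  assumes "t R y = v" "t Q y = v" "R \<in> root_lines 8" "Q \<in> root_lines 8"
  shows "t (star R Q) y = v"
proof -
  have "t R v = y" "t Q v = y" using invol[OF assms(3), of y] invol[OF assms(4), of y] assms(1,2) by simp_all
  then show ?thesis using conj_star[OF assms(4,3), of y] assms(1) by simp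
qed

text \<open>Exchange one letter \<open>l\<close> of the triple for a letter \<open>k\<close> of the block, giving \<open>S\<close>. The point \<open>t S y\<close> still has \<open>S\<close> and \<open>B - S\<close>
inside its only block, hence all of \<open>B\<close>. Comparing at \<open>t S y\<close> a transposition inside \<open>S\<close> with \<open>{k, l}\<close>, which the reflection
in \<open>S\<close> exchanges with the given triple, carries the value \<open>v\<close> over.\<close>

lemma block_triples:
  assumes y: "y \<in> Y" and B: "block y B" "7 \<le> card B" and v: "\<And>i j. \<lbrakk>i \<in> B; j \<in> B; i \<noteq> j\<rbrakk> \<Longrightarrow> t {i, j} y = v"
    and S': "S' \<subseteq> B" "card S' = 3"
  shows "t S' y = v"
proof -
  note sub = block_subset[OF B(1)]
  have altB: "alt y B" using B(1) by (simp add: block_def)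
  have fS': "finite S'" using S'(1) sub(2) finite_subset by blast
  obtain l where l: "l \<in> S'" using S'(2) by fastforce
  have "card (B - S') = card B - 3" using S' fS' by (simp add: card_Diff_subset)
  then have c: "card (B - S') \<noteq> 0" using B(2) by simp
  have "B - S' \<noteq> {}"
  proof
    assume e: "B - S' = {}"
    show False using c unfolding e by simp
  qed
  then obtain k where k: "k \<in> B" "k \<notin> S'" by blast
  define S where "S = insert k (S' - {l})"
  have S: "S \<subseteq> B" "card S = 3" "k \<in> S" "l \<notin> S" "l \<in> B" using S' l k fS' by (auto simp: S_def)
  have S9: "S \<subseteq> {..<9}" using S(1) sub(1) by blast
  have fS: "finite S" using S(1) sub(2) finite_subset by blast
  note Sr = triple_root_line[OF S9 S(2)]
  let ?z = "t S y"
  have zY: "?z \<in> Y" by (rule closed[OF Sr y])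
  obtain B' where B': "block ?z B'" "7 \<le> card B'" using huge_block[OF zY] by blast
  have "S \<subseteq> B'"
    using alt_triple_reflection[OF S9 S(2) _ alt_subset[OF altB S(1)]] S(2) by (intro huge_block_absorbs[OF B']) auto
  moreover have "B - S \<subseteq> B'"
  proof (rule huge_block_absorbs[OF B'])
    show "alt ?z (B - S)" by (rule alt_triple_reflection[OF S9 S(2) _ alt_subset[OF altB]]) auto
    show "3 \<le> card (B - S)" using S fS B(2) by (simp add: card_Diff_subset)
  qed
  ultimately have BB': "B \<subseteq> B'" by blast
  have altz: "alt ?z B" using alt_subset[OF _ BB'] B'(1) by (simp add: block_def)
  obtain m where m: "m \<in> S" "m \<noteq> k"
  proof -
    have "S \<noteq> {k}" using S(2) by auto
    then show thesis using S(3) that by blast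
  qed
  have "t {k, m} ?z = t S (t {k, m} y)" using swap_triple[OF S9 S(2)] S m sub(1) by (simp add: subset_iff)
  then have "t {k, m} ?z = t S v" using v[of k m] S m by auto
  then have "t {k, l} ?z = t S v" using altD[OF altz, of k l k m] S m by auto
  moreover have "t {k, l} ?z = t S (t (star S {k, l}) y)"
  proof -
    have "k \<noteq> l" "k < 9" "l < 9" using S k sub(1) by auto
    then show ?thesis using conj_star[OF pl[of k l] Sr, of y] invol[OF Sr] by simp
  qed
  ultimately have "t S (t (star S {k, l}) y) = t S v" by simp
  then have "t (star S {k, l}) y = v" by (rule t_inj[OF Sr])
  moreover have "star S {k, l} = S'" unfolding star_triple_pair[OF S(2-4)] using l k by (auto simp: S_def)
  ultimately show ?thesis by simp
qed

text \<open>At most one letter \<open>m\<close> is missing. The complement of a triple through \<open>m\<close> is the union of two triples in the block, and a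
pair through \<open>m\<close> is the third line of two triples, so \<open>agree_star\<close> reaches all lines.\<close>

lemma block_eight:
  assumes y: "y \<in> Y" and B: "block y B" "8 \<le> card B" and v: "\<And>i j. \<lbrakk>i \<in> B; j \<in> B; i \<noteq> j\<rbrakk> \<Longrightarrow> t {i, j} y = v"
    and R: "R \<in> root_lines 8"
  shows "t R y = v"
proof -
  note sub = block_subset[OF B(1)]
  have B7: "7 \<le> card B" using B(2) by simp
  have R': "R \<subseteq> {..<9}" "card R = 2 \<or> card R = 3" using R by (auto simp: root_lines_8)
  have inner: "t S y = v" if "S \<subseteq> B" "card S = 2 \<or> card S = 3" for S
    using that v block_triples[OF y B(1) B7 v] by (auto simp: card_2_iff)
  have c1: "card ({..<9} - B) \<le> 1" using sub B(2) by (simp add: card_Diff_subset)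
  have miss: "i = j" if "i < 9" "j < 9" "i \<notin> B" "j \<notin> B" for i j
  proof (rule ccontr)
    assume "i \<noteq> j"
    then have "card {i, j} \<le> card ({..<9} - B)" using that by (intro card_mono) auto
    then show False using c1 \<open>i \<noteq> j\<close> by simp
  qed
  have three: "t R y = v" if R: "R \<subseteq> {..<9}" "card R = 3" "\<not> R \<subseteq> B" for R
  proof -
    obtain C D where CD: "C \<union> D = {..<9} - R" "card C = 3" "card D = 3" "star C D = R"
      using complement_of_two_triples[OF R(1,2)] by blast
    have "{..<9} - R \<subseteq> B" using miss R(1,3) by blast
    then have "t C y = v" "t D y = v" using inner CD by auto
    moreover have "C \<in> root_lines 8" "D \<in> root_lines 8" using CD by (auto intro: triple_root_line)
    ultimately show ?thesis using agree_star CD(4) by blast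
  qed
  show ?thesis
  proof (cases "R \<subseteq> B")
    case True then show ?thesis using inner R' by blast
  next
    case False
    show ?thesis
    proof (cases "card R = 3")
      case True then show ?thesis using three R' False by blast
    next
      case n3: False
      obtain m where m: "m \<in> R" "m \<notin> B" using False by blast
      obtain x x' where "R = {x, x'}" "x \<noteq> x'" using n3 R'(2) by (auto simp: card_2_iff)
      then obtain i where i: "R = {m, i}" "i \<noteq> m" using m(1) by (cases "m = x") auto
      have l: "m < 9" "i < 9" using i R'(1) by auto
      then have iB: "i \<in> B" using miss m i by blast
      have "card (B - {i}) \<ge> 2" using B(2) iB by (simp add: card_Diff_singleton)
      then obtain P where P: "P \<subseteq> B - {i}" "card P = 2" by (rule obtain_subset_with_card_n)
      then obtain b c where bc: "P = {b, c}" "b \<noteq> c" by (auto simp: card_2_iff)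
      have d: "b \<in> B" "c \<in> B" "b \<noteq> i" "c \<noteq> i" "b \<noteq> m" "c \<noteq> m" "b < 9" "c < 9" using P bc m sub(1) by auto
      have c3: "card {i, b, c} = 3" "card {m, b, c} = 3" using d bc by auto
      have r: "{i, b, c} \<in> root_lines 8" "{m, b, c} \<in> root_lines 8" using c3 l d by (auto intro!: triple_root_line)
      have "t {i, b, c} y = v" using inner[of "{i, b, c}"] iB d c3 by simp
      moreover have "t {m, b, c} y = v" using three[of "{m, b, c}"] m l d c3 by auto
      moreover have "star {i, b, c} {m, b, c} = R"
      proof -
        have e: "{i, b, c} \<inter> {m, b, c} = {b, c}" "{i, b, c} - {m, b, c} = {i}" "{m, b, c} - {i, b, c} = {m}" using d i(2) by auto
        show ?thesis unfolding star_def adjacent_def third_def e using c3 bc(2) i(1) by (simp add: insert_commute)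
      qed
      ultimately show ?thesis using agree_star r by metis
    qed
  qed
qed

text \<open>With \<open>m, m'\<close> outside the block and \<open>i, j\<close> inside, take \<open>S = {i, j, m'}\<close>. At \<open>t S y\<close> the sets \<open>{i, j, m}\<close> and
\<open>B \<union> {m'} - {i, j}\<close> lie in the block of at least seven letters that every point has, so this block contains all nine. By
\<open>block_eight\<close> all reflections agree at \<open>t S y\<close>, hence also at \<open>y\<close>, whose block would contain all nine letters.\<close>

lemma no_seven:
  assumes y: "y \<in> Y" and B: "block y B" shows "card B \<noteq> 7"
proof
  assume seven: "card B = 7"
  note sub = block_subset[OF B]
  have "alt y B" using B by (simp add: block_def)
  then obtain v where v: "\<forall>i\<in>B. \<forall>j\<in>B. i \<noteq> j \<longrightarrow> t {i, j} y = v" unfolding alt_def by (elim conjE exE)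
  have inner: "t S y = v" if "S \<subseteq> B" "card S = 2 \<or> card S = 3" for S
    using that v block_triples[OF y B, of v S] seven by (auto simp: card_2_iff)
  have "card ({..<9} - B) = 2" using sub seven by (simp add: card_Diff_subset)
  then obtain m m' where mm: "{..<9} - B = {m, m'}" "m \<noteq> m'" by (auto simp: card_2_iff)
  have m: "m < 9" "m' < 9" "m \<notin> B" "m' \<notin> B" using mm(1) by auto
  have cov: "x = m \<or> x = m'" if "x < 9" "x \<notin> B" for x using mm(1) that by auto
  have "2 \<le> card B" using seven by simp
  then obtain I where "I \<subseteq> B" "card I = 2" by (rule obtain_subset_with_card_n)
  then obtain i j where I: "i \<in> B" "j \<in> B" "i \<noteq> j" by (auto simp: card_2_iff)
  have l: "i < 9" "j < 9" using I sub(1) by auto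
  have ne: "i \<noteq> m" "i \<noteq> m'" "j \<noteq> m" "j \<noteq> m'" using I m by auto
  have outer: "t {m, m', x} y = v" if x: "x \<in> B" for x
  proof -
    have "x \<noteq> m" "x \<noteq> m'" using x m by auto
    then have R: "{m, m', x} \<subseteq> {..<9}" "card {m, m', x} = 3" using m x mm(2) sub(1) by auto
    obtain C D where CD: "C \<union> D = {..<9} - {m, m', x}" "card C = 3" "card D = 3" "star C D = {m, m', x}"
      using complement_of_two_triples[OF R] by blast
    have "{..<9} - {m, m', x} \<subseteq> B" using cov by auto
    then have CB: "C \<subseteq> B" "D \<subseteq> B" using CD(1) by blast+
    then have "t C y = v" "t D y = v" using inner CD by auto
    moreover have "C \<in> root_lines 8" "D \<in> root_lines 8" using CB sub(1) CD by (auto intro: triple_root_line)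
    ultimately show ?thesis using agree_star CD(4) by metis
  qed
  define S where "S = {i, j, m'}"
  have S: "S \<subseteq> {..<9}" "card S = 3" using l m ne I by (auto simp: S_def)
  note Sr = triple_root_line[OF S]
  let ?z = "t S y"
  have zY: "?z \<in> Y" by (rule closed[OF Sr y])
  have moved: "t {k, l} (t S w) = t S (t (star S {k, l}) w)" if "k < 9" "l < 9" "k \<noteq> l" for k l w
    using conj_star[OF pl[OF that] Sr, of w] invol[OF Sr] by simp
  have A1: "alt ?z {i, j, m}"
  proof (rule alt_triple)
    have "star S {i, j} = {i, j}" using S I by (intro star_triple_pair_same) (auto simp: S_def)
    then have 1: "t {i, j} ?z = t S v" using moved[of i j y] l I inner[of "{i, j}"] by simp
    have "star S {j, m} = {m, m', i}" using S(2) ne mm(2) I by (subst star_triple_pair) (auto simp: S_def)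
    then have "t {j, m} ?z = t S v" using moved[of j m y] l m ne outer[of i] I by simp
    then show "t {i, j} ?z = t {j, m} ?z" using 1 by simp
  qed (use l m ne I in auto)
  have A2: "alt ?z (insert m' (B - {i, j}))"
  proof -
    have "t {k, l} ?z = t S v" if kl: "k \<in> insert m' (B - {i, j})" "l \<in> insert m' (B - {i, j})" "k \<noteq> l" for k l
    proof -
      have lt: "k < 9" "l < 9" using kl sub(1) m by auto
      have cross: "t {m', x} ?z = t S v" if x: "x \<in> B - {i, j}" for x
      proof -
        have "star S {m', x} = {i, j, x}" using S(2) x ne m by (subst star_triple_pair) (auto simp: S_def)
        moreover have "t {i, j, x} y = v" using x I by (intro inner) auto
        ultimately show ?thesis using moved[of m' x y] m x sub(1) by auto
      qed
      consider "k = m'" "l \<in> B - {i, j}" | "l = m'" "k \<in> B - {i, j}" | "k \<in> B - {i, j}" "l \<in> B - {i, j}"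
        using kl by blast
      then show ?thesis
      proof cases
        case 1 then show ?thesis using cross by simp
      next
        case 2 then show ?thesis using cross[of k] by (simp add: insert_commute)
      next
        case 3
        then have "star S {k, l} = {k, l}" using S kl m by (intro star_triple_pair_same) (auto simp: S_def)
        then show ?thesis using moved[OF lt kl(3), of y] inner[of "{k, l}"] 3 kl(3) by simp
      qed
    qed
    then show ?thesis unfolding alt_def using m sub(1) by blast
  qed
  obtain B' where B': "block ?z B'" "7 \<le> card B'" using huge_block[OF zY] by blast
  have "card (B - {i, j}) = 5" using I seven sub(2) by (simp add: card_Diff_subset)
  then have "3 \<le> card (insert m' (B - {i, j}))" using m sub(2) by simp
  then have "insert m' (B - {i, j}) \<subseteq> B'" by (rule huge_block_absorbs[OF B' A2])
  moreover have "3 \<le> card {i, j, m}" using I ne by simp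
  then have "{i, j, m} \<subseteq> B'" by (rule huge_block_absorbs[OF B' A1])
  ultimately have "{..<9} \<subseteq> B'" using cov by blast
  then have B'9: "B' = {..<9}" using block_subset(1)[OF B'(1)] by blast
  have "alt ?z {..<9}" using B' B'9 by (simp add: block_def)
  then obtain w where w: "\<forall>i\<in>{..<9}. \<forall>j\<in>{..<9}. i \<noteq> j \<longrightarrow> t {i, j} ?z = w" unfolding alt_def by (elim conjE exE)
  have all: "t R ?z = w" if "R \<in> root_lines 8" for R
    by (rule block_eight[OF zY B'(1) _ _ that]) (use w B'9 in auto)
  have "t {k, l} y = t S w" if kl: "k < 9" "l < 9" "k \<noteq> l" for k l
  proof -
    have "star S {k, l} \<in> root_lines 8"
    proof -
      consider "k \<in> S \<longleftrightarrow> l \<in> S" | "k \<in> S" "l \<notin> S" | "l \<in> S" "k \<notin> S" by blast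
      then show ?thesis
      proof cases
        case 1 then show ?thesis using star_triple_pair_same[OF S(2) kl(3)] pl kl by simp
      next
        case 2
        then have "card (insert l (S - {k})) = 3" using S finite_subset[OF S(1)] by simp
        then show ?thesis unfolding star_triple_pair[OF S(2) 2] using S(1) kl by (intro triple_root_line) auto
      next
        case 3
        then have "card (insert k (S - {l})) = 3" using S finite_subset[OF S(1)] by simp
        then show ?thesis unfolding insert_commute[of k l] star_triple_pair[OF S(2) 3] using S(1) kl by (intro triple_root_line) auto
      qed
    qed
    then show ?thesis using moved[OF kl, of ?z] all invol[OF Sr] by simp
  qed
  then have "alt y {..<9}" unfolding alt_def by blast
  then have "{..<9} \<subseteq> B" using B seven by (intro huge_block_absorbs) auto
  then show False using m by auto
qed

theorem E8_action_constant:
  assumes y: "y \<in> Y" and R: "R \<in> root_lines 8" and Q: "Q \<in> root_lines 8" shows "t R y = t Q y"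
proof -
  obtain B where B: "block y B" "7 \<le> card B" using huge_block[OF y] by blast
  then have 8: "8 \<le> card B" using no_seven[OF y B(1)] by simp
  have "alt y B" using B by (simp add: block_def)
  then obtain v where v: "\<forall>i\<in>B. \<forall>j\<in>B. i \<noteq> j \<longrightarrow> t {i, j} y = v" unfolding alt_def by (elim conjE exE)
  have "t R y = v" "t Q y = v" using block_eight[OF y B(1) 8 _ R] block_eight[OF y B(1) 8 _ Q] v by blast+
  then show ?thesis by simp
qed

end

section \<open>Weyl groups in nine coordinates\<close>

text \<open>The linear combination of the simple roots \<open>e\<^sub>0 - e\<^sub>1\<close>, \<open>(e\<^sub>0 + \<dots> + e\<^sub>8)/3 - e\<^sub>0 - e\<^sub>1 - e\<^sub>2\<close>, \<open>e\<^sub>1 - e\<^sub>2\<close>, \<open>e\<^sub>2 - e\<^sub>3\<close>, \<dots>, \<open>e\<^sub>6 - e\<^sub>7\<close>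
with coefficients \<open>v\<close>, in the order of the nodes of the diagram.\<close>

definition to9 :: "(nat \<Rightarrow> real) \<Rightarrow> nat \<Rightarrow> real" where
  "to9 v k = (if k = 0 then v 1 - 2/3 * v 2 else if k = 1 then - v 1 + v 3 - 2/3 * v 2
    else if k = 2 then - v 3 + v 4 - 2/3 * v 2 else if k < 8 then - v (k + 1) + v (k + 2) + v 2 / 3
    else if k = 8 then v 2 / 3 else 0)"

definition from9 :: "(nat \<Rightarrow> real) \<Rightarrow> nat \<Rightarrow> real" where
  "from9 x j = (if j = 1 then x 0 + 2 * x 8 else if j = 2 then 3 * x 8 else if j = 3 then x 0 + x 1 + 4 * x 8
    else if 4 \<le> j \<and> j \<le> 8 then (\<Sum>i<j - 1. x i) + (10 - real j) * x 8 else 0)"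

definition coord_space :: "nat \<Rightarrow> (nat \<Rightarrow> real) set" where
  "coord_space n = {x. (\<forall>k\<ge>9. x k = 0) \<and> (\<Sum>k<9. x k) = 0 \<and> (\<forall>k\<in>{n..<9}. x k = x 8)}"

lemma coord_spaceD:
  assumes "x \<in> coord_space n"
  shows "\<forall>k\<ge>9. x k = 0" and "(\<Sum>k<9. x k) = 0" and "\<forall>k\<in>{n..<9}. x k = x 8"
proof -
  have *: "(\<forall>k\<ge>9. x k = 0) \<and> (\<Sum>k<9. x k) = 0 \<and> (\<forall>k\<in>{n..<9}. x k = x 8)"
    using assms unfolding coord_space_def mem_Collect_eq .
  show "\<forall>k\<ge>9. x k = 0" by (rule conjunct1[OF *])
  show "(\<Sum>k<9. x k) = 0" by (rule conjunct1[OF conjunct2[OF *]])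
  show "\<forall>k\<in>{n..<9}. x k = x 8" by (rule conjunct2[OF conjunct2[OF *]])
qed

lemma sum_nine: fixes f :: "nat \<Rightarrow> real" shows "(\<Sum>k<9. f k) = f 0 + f 1 + f 2 + f 3 + f 4 + f 5 + f 6 + f 7 + f 8"
proof -
  have "(\<Sum>k<9. f k) = sum f {0,1,2,3,4,5,6,7,8}" by (rule sum.cong) auto
  then show ?thesis by simp
qed

lemma sum_below:
  fixes f :: "nat \<Rightarrow> real"
  shows "(\<Sum>k<3. f k) = f 0 + f 1 + f 2" "(\<Sum>k<4. f k) = f 0 + f 1 + f 2 + f 3"
  "(\<Sum>k<5. f k) = f 0 + f 1 + f 2 + f 3 + f 4" "(\<Sum>k<6. f k) = f 0 + f 1 + f 2 + f 3 + f 4 + f 5"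
  "(\<Sum>k<7. f k) = f 0 + f 1 + f 2 + f 3 + f 4 + f 5 + f 6"
  by (simp_all add: numeral_eq_Suc One_nat_def)

lemma nine_cases: "k = 0 \<or> k = 1 \<or> k = 2 \<or> k = 3 \<or> k = 4 \<or> k = 5 \<or> k = 6 \<or> k = 7 \<or> k = 8 \<or> 9 \<le> (k::nat)"
  by presburger

lemma from9_values:
  "from9 x 1 = x 0 + 2 * x 8" "from9 x 2 = 3 * x 8" "from9 x 3 = x 0 + x 1 + 4 * x 8"
  "from9 x 4 = x 0 + x 1 + x 2 + 6 * x 8" "from9 x 5 = x 0 + x 1 + x 2 + x 3 + 5 * x 8"
  "from9 x 6 = x 0 + x 1 + x 2 + x 3 + x 4 + 4 * x 8" "from9 x 7 = x 0 + x 1 + x 2 + x 3 + x 4 + x 5 + 3 * x 8"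
  "from9 x 8 = x 0 + x 1 + x 2 + x 3 + x 4 + x 5 + x 6 + 2 * x 8" "from9 x 0 = 0" "9 \<le> j \<Longrightarrow> from9 x j = 0"
  by (simp_all add: from9_def sum_below)

lemma to9_values:
  "to9 v 0 = v 1 - 2/3 * v 2" "to9 v 1 = - v 1 + v 3 - 2/3 * v 2" "to9 v 2 = - v 3 + v 4 - 2/3 * v 2"
  "to9 v 3 = - v 4 + v 5 + v 2 / 3" "to9 v 4 = - v 5 + v 6 + v 2 / 3" "to9 v 5 = - v 6 + v 7 + v 2 / 3"
  "to9 v 6 = - v 7 + v 8 + v 2 / 3" "to9 v 7 = - v 8 + v 9 + v 2 / 3" "to9 v 8 = v 2 / 3" "9 \<le> k \<Longrightarrow> to9 v k = 0"
  by (simp_all add: to9_def)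

lemma root_space_zero: "v \<in> root_space n \<Longrightarrow> n \<le> 8 \<Longrightarrow> v 0 = 0 \<and> (\<forall>j\<ge>9. v j = 0)"
  by (auto simp: root_space_def)

lemma from9_to9: "v \<in> root_space n \<Longrightarrow> n \<le> 8 \<Longrightarrow> from9 (to9 v) = v"
proof
  fix j assume "v \<in> root_space n" "n \<le> 8"
  then have z: "v 0 = 0" "v 9 = 0" "9 \<le> j \<Longrightarrow> v j = 0" using root_space_zero by auto
  show "from9 (to9 v) j = v j"
    using nine_cases[of j] z by (elim disjE) (simp_all add: from9_values to9_values)
qed

lemma to9_from9: "x \<in> coord_space n \<Longrightarrow> to9 (from9 x) = x"
proof
  fix k assume "x \<in> coord_space n"
  then have z: "9 \<le> k \<Longrightarrow> x k = 0" "x 0 + x 1 + x 2 + x 3 + x 4 + x 5 + x 6 + x 7 + x 8 = 0"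
    using coord_spaceD(1,2)[of x n] by (simp_all add: sum_nine)
  show "to9 (from9 x) k = x k"
    using nine_cases[of k] z by (elim disjE) (simp_all add: from9_values to9_values)
qed

lemma to9_space: "n \<in> {6, 7, 8} \<Longrightarrow> v \<in> root_space n \<Longrightarrow> to9 v \<in> coord_space n"
proof -
  assume n: "n \<in> {6, 7, 8}" and v: "v \<in> root_space n"
  have z: "v j = 0" if "j = 0 \<or> n < j" for j using v that by (auto simp: root_space_def)
  have "v 9 = 0" using z n by auto
  then have "(\<Sum>k<9. to9 v k) = 0" by (simp add: sum_nine to9_values)
  moreover have "to9 v k = to9 v 8" if "k \<in> {n..<9}" for k
  proof -
    have "v 8 = 0" if "n < 8" using z that by simp
    moreover have "v 7 = 0" if "n < 7" using z that by simp
    moreover have "k = 8 \<or> k = 7 \<and> n < 8 \<or> k = 6 \<and> n < 7" using that n by (auto simp: upto9)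
    ultimately show ?thesis using \<open>v 9 = 0\<close> by (elim disjE conjE) (simp_all add: to9_values)
  qed
  ultimately show ?thesis by (simp add: coord_space_def to9_values)
qed

lemma from9_space:
  assumes n: "n \<in> {6, 7, 8}" and x: "x \<in> coord_space n" shows "from9 x \<in> root_space n"
proof -
  have s: "x 0 + x 1 + x 2 + x 3 + x 4 + x 5 + x 6 + x 7 + x 8 = 0" using coord_spaceD(2)[OF x] by (simp add: sum_nine)
  have "from9 x i = 0" if "i \<notin> {1..n}" for i
  proof -
    have "i = 0 \<or> 9 \<le> i \<or> (n < i \<and> (i = 7 \<or> i = 8))" using that n by auto
    moreover have "from9 x i = 0" if "n < i" "i = 7 \<or> i = 8"
    proof -
      have c: "x k = x 8" if "n \<le> k" "k < 9" for k by (rule bspec[OF coord_spaceD(3)[OF x]]) (use that in simp)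
      have "i = 8 \<and> n \<le> 7 \<or> i = 7 \<and> n \<le> 6" using that by auto
      then show ?thesis
      proof
        assume i: "i = 8 \<and> n \<le> 7"
        then have "x 7 = x 8" using c[of 7] by simp
        then show ?thesis using i s by (simp add: from9_values)
      next
        assume i: "i = 7 \<and> n \<le> 6"
        then have "x 7 = x 8" "x 6 = x 8" using c[of 7] c[of 6] by simp_all
        then show ?thesis using i s by (simp add: from9_values)
      qed
    qed
    ultimately show ?thesis by (auto simp: from9_values)
  qed
  then show ?thesis by (simp add: root_space_def)
qed

definition ip :: "(nat \<Rightarrow> real) \<Rightarrow> (nat \<Rightarrow> real) \<Rightarrow> real" where
  "ip x y = (\<Sum>k<9. x k * y k)"

text \<open>A root on the given line. Pairs are oriented from the smaller to the larger index.\<close>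

definition rv :: "nat set \<Rightarrow> nat \<Rightarrow> real" where
  "rv R k = (if card R = 3 then if k < 9 then (if k \<in> R then 2/3 else -1/3) else 0
     else if k = Min R then 1 else if k = Max R then -1 else 0)"

definition reflect :: "nat set \<Rightarrow> (nat \<Rightarrow> real) \<Rightarrow> nat \<Rightarrow> real" where
  "reflect R x k = x k - ip (rv R) x * rv R k"

lemma rv_pair: "i < j \<Longrightarrow> rv {i, j} k = (if k = i then 1 else if k = j then -1 else 0)"
  by (simp add: rv_def)

lemma ip_add: "ip x (\<lambda>k. a * y k + b * z k) = a * ip x y + b * ip x z"
  by (simp add: ip_def sum.distrib sum_distrib_left algebra_simps)

lemma ip_commute: "ip x y = ip y x" by (simp add: ip_def mult.commute)

lemma ip_pair: "i < j \<Longrightarrow> j < 9 \<Longrightarrow> ip (rv {i, j}) x = x i - x j"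
proof -
  assume ij: "i < j" "j < 9"
  have "ip (rv {i, j}) x = (\<Sum>k<9. (if k = i then x i else 0) - (if k = j then x j else 0))"
    unfolding ip_def rv_pair[OF ij(1)] using ij by (intro sum.cong) auto
  then show ?thesis using ij by (simp add: sum_subtractf)
qed

lemma ip_triple: "card R = 3 \<Longrightarrow> R \<subseteq> {..<9} \<Longrightarrow> ip (rv R) x = sum x R - (\<Sum>k<9. x k) / 3"
proof -
  assume R: "card R = 3" "R \<subseteq> {..<9}"
  have "ip (rv R) x = (\<Sum>k<9. (if k \<in> R then x k else 0) - x k / 3)"
    unfolding ip_def rv_def using R(1) by (intro sum.cong) auto
  also have "\<dots> = sum x ({..<9} \<inter> R) - (\<Sum>k<9. x k) / 3"
    by (simp add: sum_subtractf sum.If_cases sum_divide_distrib)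
  finally show ?thesis using R(2) by (simp add: inf_absorb2)
qed

lemma line_cases:
  assumes "R \<in> root_lines n"
  obtains i j where "i < j" "j < 9" "R = {i, j}" | "card R = 3" "R \<subseteq> {..<9}"
proof -
  have R: "R \<subseteq> {..<9}" "card R = 2 \<or> card R = 3" using assms by (auto simp: root_lines_def)
  show thesis
  proof (cases "card R = 3")
    case False
    then obtain a b where ab: "R = {a, b}" "a \<noteq> b" using R(2) by (auto simp: card_2_iff)
    then show thesis using that(1)[of a b] that(1)[of b a] R(1) by (cases "a < b") (auto simp: insert_commute)
  qed (use that(2) R in blast)
qed

lemma rv_space:
  assumes n: "n \<in> {6, 7, 8}" and R: "R \<in> root_lines n" shows "rv R \<in> coord_space n"
  using R
proof (cases rule: line_cases)
  case (1 i j)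
  have "(\<Sum>k<9. rv {i, j} k) = (\<Sum>k<9. (if k = i then 1 else 0) - (if k = j then 1 else 0))"
    unfolding rv_pair[OF 1(1)] using 1 by (intro sum.cong) auto
  then have "(\<Sum>k<9. rv R k) = 0" using 1 by (simp add: sum_subtractf)
  moreover have "R \<inter> {n..<9} = {} \<or> n = 8" using R 1 n by (auto simp: root_lines_def)
  then have "rv R k = rv R 8" if "k \<in> {n..<9}" for k
    using that n 1 by (auto simp: rv_pair upto9)
  ultimately show ?thesis using 1 by (auto simp: coord_space_def rv_pair)
next
  case 2
  have "(\<Sum>k<9. rv R k) = (\<Sum>k<9. (if k \<in> R then 1 else 0) - 1/3)"
    unfolding rv_def using 2 by (intro sum.cong) auto
  also have "\<dots> = real (card ({..<9} \<inter> R)) - 3" by (simp add: sum_subtractf sum.If_cases)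
  finally have sum: "(\<Sum>k<9. rv R k) = 0" using 2 by (simp add: inf_absorb2)
  have or: "R \<inter> {n..<9} = {} \<or> {n..<9} \<subseteq> R" using R unfolding root_lines_def by blast
  have 8: "8 \<in> {n..<9}" using n by auto
  have const: "rv R k = rv R 8" if "k \<in> {n..<9}" for k
  proof -
    have "k \<in> R \<longleftrightarrow> 8 \<in> R" using that or 8 by blast
    then show ?thesis using that by (simp add: rv_def 2(1))
  qed
  have "rv R k = 0" if "9 \<le> k" for k using that by (simp add: rv_def 2(1))
  then show ?thesis unfolding coord_space_def using sum const by blast
qed

lemma ip_rv_self: assumes R: "R \<in> root_lines n" shows "ip (rv R) (rv R) = 2"
  using R
proof (cases rule: line_cases)
  case (1 i j)
  then show ?thesis by (simp add: ip_pair rv_pair)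
next
  case 2
  have "R \<in> root_lines 8" using 2 by (simp add: root_lines_8)
  then have "(\<Sum>k<9. rv R k) = 0" using coord_spaceD(2)[OF rv_space[of 8 R]] by simp
  moreover have "sum (rv R) R = (\<Sum>k\<in>R. 2/3)" using 2 by (intro sum.cong) (auto simp: rv_def)
  ultimately show ?thesis using 2 by (simp add: ip_triple)
qed

lemma coord_space_linear: "x \<in> coord_space n \<Longrightarrow> y \<in> coord_space n \<Longrightarrow> (\<lambda>k. a * x k + b * y k) \<in> coord_space n"
proof -
  assume x: "x \<in> coord_space n" and y: "y \<in> coord_space n"
  have "(\<Sum>k<9. a * x k + b * y k) = 0"
    using coord_spaceD(2)[OF x] coord_spaceD(2)[OF y] by (simp add: sum.distrib sum_distrib_left[symmetric])
  moreover have "a * x k + b * y k = a * x 8 + b * y 8" if "k \<in> {n..<9}" for k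
    using bspec[OF coord_spaceD(3)[OF x] that] bspec[OF coord_spaceD(3)[OF y] that] by simp
  moreover have "a * x k + b * y k = 0" if "9 \<le> k" for k
    using that coord_spaceD(1)[OF x] coord_spaceD(1)[OF y] by simp
  ultimately show "(\<lambda>k. a * x k + b * y k) \<in> coord_space n"
    unfolding coord_space_def mem_Collect_eq by (intro conjI allI impI ballI)
qed

lemma reflect_space: "n \<in> {6, 7, 8} \<Longrightarrow> R \<in> root_lines n \<Longrightarrow> x \<in> coord_space n \<Longrightarrow> reflect R x \<in> coord_space n"
  using coord_space_linear[of x n "rv R" 1 "- ip (rv R) x"] rv_space[of n R] by (simp add: reflect_def[abs_def])

lemma reflect_linear: "reflect R (\<lambda>k. a * x k + b * y k) = (\<lambda>k. a * reflect R x k + b * reflect R y k)"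
  by (simp add: reflect_def ip_add fun_eq_iff algebra_simps)

lemma reflect_ip: "R \<in> root_lines n \<Longrightarrow> ip (reflect R x) (reflect R y) = ip x y"
proof -
  assume R: "R \<in> root_lines n"
  have e: "reflect R y = (\<lambda>k. 1 * y k + (- ip (rv R) y) * rv R k)" for y by (simp add: reflect_def fun_eq_iff)
  show ?thesis
    unfolding e[of y] ip_add ip_commute[of "reflect R x"] unfolding e[of x] ip_add
    using ip_rv_self[OF R] by (simp add: ip_commute[of y x] ip_commute[of y "rv R"] ip_commute[of x "rv R"] algebra_simps)
qed

lemma reflect_reflect: "R \<in> root_lines n \<Longrightarrow> reflect R (reflect R x) = x"
proof
  fix k assume R: "R \<in> root_lines n"
  have e: "reflect R x = (\<lambda>k. 1 * x k + (- ip (rv R) x) * rv R k)" by (simp add: reflect_def fun_eq_iff)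
  have "ip (rv R) (reflect R x) = - ip (rv R) x" unfolding e ip_add using ip_rv_self[OF R] by simp
  then show "reflect R (reflect R x) k = x k" by (simp add: reflect_def)
qed

lemma reflect_pair: "i < 9 \<Longrightarrow> j < 9 \<Longrightarrow> i \<noteq> j \<Longrightarrow> reflect {i, j} x = x \<circ> transpose i j"
proof -
  have *: "reflect {i, j} x = x \<circ> transpose i j" if "i < j" "j < 9" for i j
    using that by (auto simp: reflect_def fun_eq_iff ip_pair rv_pair transpose_def)
  assume "i < 9" "j < 9" "i \<noteq> j"
  then show ?thesis using *[of i j] *[of j i] by (cases "i < j") (auto simp: insert_commute transpose_commute)
qed

lemma reflect_conj:
  assumes R: "R \<in> root_lines n" and s: "s = 1 \<or> s = -1" and rv: "reflect R (rv S) = (\<lambda>k. s * rv Q k)"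
  shows "reflect R (reflect S x) = reflect Q (reflect R x)"
proof
  fix k
  have e: "reflect S x = (\<lambda>k. 1 * x k + (- ip (rv S) x) * rv S k)" by (simp add: reflect_def fun_eq_iff)
  have 1: "reflect R (reflect S x) = (\<lambda>k. 1 * reflect R x k + (- ip (rv S) x) * (s * rv Q k))"
    unfolding e reflect_linear rv ..
  have "ip (rv S) x = ip (reflect R (rv S)) (reflect R x)" by (simp only: reflect_ip[OF R])
  also have "\<dots> = s * ip (rv Q) (reflect R x)"
    unfolding rv using ip_add[of "reflect R x" s "rv Q" 0 "rv Q"] by (simp add: ip_commute)
  finally show "reflect R (reflect S x) k = reflect Q (reflect R x) k"
    unfolding 1 using s by (auto simp: reflect_def)
qed

lemma rv_image:
  assumes p: "bij p" and img: "\<And>k. p k < 9 \<longleftrightarrow> k < 9" and R: "R \<in> root_lines 8"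
  shows "\<exists>s. (s = 1 \<or> s = -1) \<and> rv R = (\<lambda>k. s * rv (p ` R) (p k))"
  using R
proof (cases rule: line_cases)
  case (1 i j)
  have inj: "p a = p b \<longleftrightarrow> a = b" for a b using p by (auto simp: bij_def inj_eq)
  have "p i \<noteq> p j" using 1 inj by simp
  then consider "p i < p j" | "p j < p i" by linarith
  then show ?thesis
  proof cases
    case c: 1
    have "rv R = (\<lambda>k. 1 * rv (p ` R) (p k))" using 1 c by (auto simp: rv_pair inj fun_eq_iff)
    then show ?thesis by blast
  next
    case c: 2
    then have "p ` R = {p j, p i}" using 1 by auto
    then have "rv R = (\<lambda>k. (-1) * rv (p ` R) (p k))" using 1 c by (auto simp: rv_pair inj fun_eq_iff)
    then show ?thesis by blast
  qed
next
  case 2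
  have "card (p ` R) = 3" using 2 inj_on_subset[OF bij_is_inj[OF p]] by (simp add: card_image)
  moreover have "p k \<in> p ` R \<longleftrightarrow> k \<in> R" for k using p by (auto simp: bij_def inj_eq)
  ultimately have "rv R = (\<lambda>k. 1 * rv (p ` R) (p k))" using 2 img by (auto simp: rv_def fun_eq_iff)
  then show ?thesis by blast
qed

text \<open>Conjugating the reflection in a vector by an isometry gives the reflection in the image. So it suffices
that the reflection in \<open>R\<close> maps the root of \<open>S\<close> to one on \<open>star R S\<close>; for a pair \<open>R\<close> this is a transposition of coordinates,
and for a triple \<open>R\<close> and a pair \<open>S\<close> the roles are exchanged.\<close>

lemma reflect_star:
  assumes R: "R \<in> root_lines 8" and S: "S \<in> root_lines 8"
  shows "star R S \<in> root_lines 8" and "reflect R (reflect S x) = reflect (star R S) (reflect R x)"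
proof -
  have pair: "star {i, j} S \<in> root_lines 8 \<and> (\<exists>s. (s = 1 \<or> s = -1) \<and> reflect {i, j} (rv S) = (\<lambda>k. s * rv (star {i, j} S) k))"
    if ij: "i < 9" "j < 9" "i \<noteq> j" and S: "S \<in> root_lines 8" for i j S
  proof -
    let ?p = "transpose i j"
    have p: "bij ?p" by simp
    have lt: "?p k < 9 \<longleftrightarrow> k < 9" for k using ij by (auto simp: transpose_def)
    have "?p ` S \<subseteq> {..<9}" using S lt by (auto simp: root_lines_8)
    moreover have "card (?p ` S) = card S" using inj_on_subset[OF bij_is_inj[OF p]] by (simp add: card_image)
    ultimately have 1: "star {i, j} S \<in> root_lines 8" using S unfolding star_pair[OF ij(3)] by (simp add: root_lines_8)
    obtain s where s: "s = 1 \<or> s = -1" "rv S = (\<lambda>k. s * rv (?p ` S) (?p k))" using rv_image[OF p lt S] by blast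
    have "reflect {i, j} (rv S) k = s * rv (?p ` S) k" for k
      unfolding reflect_pair[OF ij] o_def using fun_cong[OF s(2), of "?p k"] by simp
    then show ?thesis using 1 s(1) unfolding star_pair[OF ij(3)] by (auto simp: fun_eq_iff)
  qed
  have tt: "star R S \<in> root_lines 8 \<and> (\<exists>s. (s = 1 \<or> s = -1) \<and> reflect R (rv S) = (\<lambda>k. s * rv (star R S) k))"
    if R: "card R = 3" "R \<subseteq> {..<9}" and S: "card S = 3" "S \<subseteq> {..<9}"
  proof -
    have fin: "finite R" "finite S" using R S finite_subset by auto
    have rvR: "rv R k = (if k < 9 then (if k \<in> R then 2/3 else -1/3) else 0)"
      and rvS: "rv S k = (if k < 9 then (if k \<in> S then 2/3 else -1/3) else 0)" for k using R(1) S(1) by (simp_all add: rv_def)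
    have "S \<in> root_lines 8" using S by (simp add: root_lines_8)
    then have s0: "(\<Sum>k<9. rv S k) = 0" using coord_spaceD(2)[OF rv_space[of 8 S]] by simp
    have "sum (rv S) R = (\<Sum>k\<in>R. (if k \<in> S then 1 else 0) - 1/3)" unfolding rvS using R(2) by (intro sum.cong) auto
    also have "\<dots> = real (card (R \<inter> S)) - 1" using fin R by (simp add: sum_subtractf sum.If_cases Int_commute)
    finally have ip: "ip (rv R) (rv S) = real (card (R \<inter> S)) - 1" using R s0 by (simp add: ip_triple)
    have "card (R \<inter> S) \<le> 3" using card_mono[OF fin(1), of "R \<inter> S"] R(1) by simp
    then consider "card (R \<inter> S) = 0" | "card (R \<inter> S) = 1" | "card (R \<inter> S) = 2" | "card (R \<inter> S) = 3" by linarith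
    then show ?thesis
    proof cases
      case 1
      then have e: "R \<inter> S = {}" using fin by simp
      then have st: "star R S = {..<9} - (R \<union> S)" using R S by (simp add: star_def adjacent_def third_def)
      have c: "card ({..<9} - (R \<union> S)) = 3" using R S fin e by (simp add: card_Diff_subset card_Un_disjoint)
      have "reflect R (rv S) k = (-1) * rv (star R S) k" for k
      proof -
        have Q: "rv ({..<9} - (R \<union> S)) k = (if k < 9 then (if k \<in> R \<or> k \<in> S then -1/3 else 2/3) else 0)"
          using c by (simp add: rv_def)
        have "\<not> (k \<in> R \<and> k \<in> S)" using e by blast
        then show ?thesis unfolding reflect_def ip 1 st Q rvR rvS by (simp split: if_split)
      qed
      then show ?thesis using c unfolding st by (auto simp: root_lines_8 fun_eq_iff)
    next
      case 2
      then have st: "star R S = S" using R S by (simp add: star_def adjacent_def)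
      have "reflect R (rv S) k = 1 * rv (star R S) k" for k unfolding reflect_def ip 2 st by simp
      then show ?thesis unfolding st using S by (auto simp: root_lines_8 fun_eq_iff)
    next
      case 3
      then have "card (R - S) = 1" "card (S - R) = 1" using R S fin
        by (simp_all add: card_Diff_subset_Int Int_commute)
      then obtain a b where ab: "R - S = {a}" "S - R = {b}" by (elim card_1_singletonE)
      have st: "star R S = {a, b}" using 3 R S ab by (auto simp: star_def adjacent_def third_def)
      have d: "a \<noteq> b" "a \<in> R" "a \<notin> S" "b \<in> S" "b \<notin> R" and iff: "\<And>k. k \<noteq> a \<Longrightarrow> k \<noteq> b \<Longrightarrow> k \<in> R \<longleftrightarrow> k \<in> S" using ab by blast+
      have l: "a < 9" "b < 9" using d R S by auto
      have val: "reflect R (rv S) k = (if k = b then 1 else if k = a then -1 else 0)" for k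
        unfolding reflect_def ip 3 rvR rvS using d iff[of k] l by auto
      have "\<exists>s. (s = 1 \<or> s = -1) \<and> reflect R (rv S) = (\<lambda>k. s * rv (star R S) k)"
      proof (cases "b < a")
        case True
        then have "reflect R (rv S) = (\<lambda>k. 1 * rv (star R S) k)" unfolding val fun_eq_iff st insert_commute[of a b] by (simp add: rv_pair)
        then show ?thesis by blast
      next
        case False
        then have "a < b" using d(1) by simp
        then have "reflect R (rv S) = (\<lambda>k. (-1) * rv (star R S) k)" unfolding val fun_eq_iff st using d(1) by (simp add: rv_pair)
        then show ?thesis by blast
      qed
      then show ?thesis unfolding st using l d(1) by (auto simp: root_lines_8)
    next
      case 4
      have "card (R \<inter> S) = card R" "card (R \<inter> S) = card S" using 4 R S by simp_all
      then have "R \<inter> S = R" "R \<inter> S = S" using card_subset_eq[OF _ Int_lower1, of R S] card_subset_eq[OF _ Int_lower2, of S R] fin by blast+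
      then have RS: "R = S" by simp
      then have st: "star R S = S" using R by (simp add: star_def adjacent_def)
      have "reflect R (rv S) k = (-1) * rv (star R S) k" for k unfolding reflect_def RS ip_rv_self[OF \<open>S \<in> root_lines 8\<close>] st[unfolded RS] by simp
      then show ?thesis unfolding st using S by (auto simp: root_lines_8 fun_eq_iff)
    qed
  qed
  have "star R S \<in> root_lines 8 \<and> (\<forall>x. reflect R (reflect S x) = reflect (star R S) (reflect R x))"
    using R
  proof (cases rule: line_cases)
    case (1 i j)
    then have "star {i, j} S \<in> root_lines 8 \<and> (\<exists>s. (s = 1 \<or> s = -1) \<and> reflect {i, j} (rv S) = (\<lambda>k. s * rv (star {i, j} S) k))"
      using pair[of i j S] S by simp
    then show ?thesis unfolding 1(3)[symmetric] using reflect_conj[OF R] by blast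
  next
    case R3: 2
    show ?thesis using S
    proof (cases rule: line_cases)
      case 2
      then show ?thesis using tt[OF R3 2] reflect_conj[OF R] by blast
    next
      case (1 i j)
      have c2: "card S = 2" using 1 by simp
      have ij: "i < 9" "j < 9" "i \<noteq> j" using 1 by auto
      obtain s where s: "s = 1 \<or> s = -1" "reflect S (rv R) = (\<lambda>k. s * rv (star S R) k)" and mem: "star S R \<in> root_lines 8"
        using pair[OF ij R] unfolding 1(3)[symmetric] by blast
      show ?thesis
      proof (cases "adjacent R S")
        case True
        then have st: "star R S = star S R" by (simp add: star_def adjacent_commute third_commute)
        have "card (R \<inter> S) = 1" using True c2 by (simp add: adjacent_def)
        then have "(i \<in> R) \<noteq> (j \<in> R)" using 1(3) ij(3) by (auto simp: Int_insert_right split: if_splits)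
        then have ip: "ip (rv R) (rv S) = 1 \<or> ip (rv R) (rv S) = -1"
          unfolding ip_commute[of "rv R"] 1(3) ip_pair[OF 1(1,2)] using R3(1) 1(1,2) by (auto simp: rv_def)
        let ?e = "ip (rv R) (rv S)"
        have "reflect R (rv S) k = (- ?e * s) * rv (star R S) k" for k
        proof -
          have "(- ?e) * reflect S (rv R) k = reflect R (rv S) k"
            using ip unfolding reflect_def ip_commute[of "rv S"] by auto
          then show ?thesis unfolding s(2) st by simp
        qed
        then have "reflect R (rv S) = (\<lambda>k. (- ?e * s) * rv (star R S) k)" by (simp add: fun_eq_iff)
        moreover have "- ?e * s = 1 \<or> - ?e * s = -1" using ip s(1) by auto
        ultimately have "reflect R (reflect S x) = reflect (star R S) (reflect R x)" for x using reflect_conj[OF R] by blast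
        then show ?thesis using mem st by simp
      next
        case False
        then have st: "star R S = S" "star S R = R" by (simp_all add: star_def adjacent_commute)
        have "reflect S (reflect R x) = reflect R (reflect S x)" for x using reflect_conj[OF S s] st(2) by simp
        then show ?thesis using st(1) S by simp
      qed
    qed
  qed
  then show "star R S \<in> root_lines 8" "reflect R (reflect S x) = reflect (star R S) (reflect R x)" by blast+
qed

lemma root_lines_8_supset: "n \<le> 8 \<Longrightarrow> root_lines n \<subseteq> root_lines 8"
  by (auto simp: root_lines_def upto9)

definition word :: "nat set list \<Rightarrow> (nat \<Rightarrow> real) \<Rightarrow> nat \<Rightarrow> real" where
  "word Rs = foldr reflect Rs"

lemma word_simps [simp]: "word [] x = x" "word (R # Rs) x = reflect R (word Rs x)" "word (Rs @ Ss) x = word Rs (word Ss x)"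
  by (simp_all add: word_def)

lemma word_Nil: "word [] = (\<lambda>x. x)" and word_Cons: "reflect R \<circ> word Rs = word (R # Rs)" and word_append: "word Rs \<circ> word Ss = word (Rs @ Ss)"
  by (rule ext, simp)+

lemma word_space: "n \<in> {6, 7, 8} \<Longrightarrow> set Rs \<subseteq> root_lines n \<Longrightarrow> x \<in> coord_space n \<Longrightarrow> word Rs x \<in> coord_space n"
  by (induction Rs) (auto intro: reflect_space)

lemma word_linear: "word Rs (\<lambda>k. a * x k + b * y k) = (\<lambda>k. a * word Rs x k + b * word Rs y k)"
  by (induction Rs) (simp_all add: reflect_linear)

lemma word_ip: "set Rs \<subseteq> root_lines n \<Longrightarrow> ip (word Rs x) (word Rs y) = ip x y"
  by (induction Rs) (auto simp: reflect_ip)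

text \<open>A transformation of the nine-coordinate model, transported to the space of coefficient vectors.\<close>

definition T :: "nat \<Rightarrow> ((nat \<Rightarrow> real) \<Rightarrow> nat \<Rightarrow> real) \<Rightarrow> (nat \<Rightarrow> real) \<Rightarrow> nat \<Rightarrow> real" where
  "T n f = (\<lambda>v\<in>root_space n. from9 (f (to9 v)))"

text \<open>The line of the \<open>i\<close>-th simple root.\<close>

definition simple_line :: "nat \<Rightarrow> nat set" where
  "simple_line i = (if i = 1 then {0, 1} else if i = 2 then {0, 1, 2} else {i - 2, i - 1})"

lemma from9_linear: "from9 (\<lambda>k. a * x k + b * y k) j = a * from9 x j + b * from9 y j"
  by (simp add: from9_def sum.distrib sum_distrib_left algebra_simps)

lemma E8_index: "i \<in> {1..8} \<Longrightarrow> i = 1 \<or> i = 2 \<or> i = 3 \<or> i = 4 \<or> i = 5 \<or> i = 6 \<or> i = 7 \<or> i = (8::nat)"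
  by auto

lemma simple_line_values:
  "simple_line 1 = {0, 1}" "simple_line 2 = {0, 1, 2}" "simple_line 3 = {1, 2}" "simple_line 4 = {2, 3}"
  "simple_line 5 = {3, 4}" "simple_line 6 = {4, 5}" "simple_line 7 = {5, 6}" "simple_line 8 = {6, 7}"
  by (simp_all add: simple_line_def One_nat_def)

lemma simple_reflection_eq:
  assumes n: "n \<le> 8" and i: "i \<in> {1..n}"
  shows "simple_reflection cartan_E n i = T n (reflect (simple_line i))"
proof
  fix v
  show "simple_reflection cartan_E n i v = T n (reflect (simple_line i)) v"
  proof (cases "v \<in> root_space n")
    case True
    define s where "s = (if i = 2 then - 1 else 1 :: real)"
    define c where "c = (\<Sum>j=1..n. cartan_E i j * v j)"
    have z: "v j = 0" if "j = 0 \<or> n < j" for j using True that by (auto simp: root_space_def)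
    have "v 9 = 0" using z n by auto
    have "c = (\<Sum>j=1..8. cartan_E i j * v j)"
      unfolding c_def using n z by (intro sum.mono_neutral_left) auto
    also have "\<dots> = sum (\<lambda>j. cartan_E i j * v j) {1,2,3,4,5,6,7,8}" by (rule sum.cong) auto
    finally have c: "c = cartan_E i 1 * v 1 + cartan_E i 2 * v 2 + cartan_E i 3 * v 3 + cartan_E i 4 * v 4
        + cartan_E i 5 * v 5 + cartan_E i 6 * v 6 + cartan_E i 7 * v 7 + cartan_E i 8 * v 8" by simp
    have i8: "i = 1 \<or> i = 2 \<or> i = 3 \<or> i = 4 \<or> i = 5 \<or> i = 6 \<or> i = 7 \<or> i = 8" using i n by (intro E8_index) auto
    have ip: "ip (rv (simple_line i)) (to9 v) = s * c"
      using i8 \<open>v 9 = 0\<close>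
      by (elim disjE) (simp_all add: c s_def simple_line_values ip_pair ip_triple sum_nine to9_values cartan_E_def E_adjacent_def doubleton_eq_iff)
    have unit: "from9 (rv (simple_line i)) j = (if j = i then s else 0)" for j
      using i8 nine_cases[of j]
      by (elim disjE) (simp_all add: s_def simple_line_values from9_values rv_def)
    have "v(i := v i - c) = from9 (reflect (simple_line i) (to9 v))"
    proof
      fix j
      have e: "reflect (simple_line i) (to9 v) = (\<lambda>k. 1 * to9 v k + (- ip (rv (simple_line i)) (to9 v)) * rv (simple_line i) k)"
        by (simp add: reflect_def fun_eq_iff)
      show "(v(i := v i - c)) j = from9 (reflect (simple_line i) (to9 v)) j"
        unfolding e from9_linear unit ip from9_to9[OF True n] by (simp add: s_def)
    qed
    then show ?thesis using True by (simp add: simple_reflection_def T_def c_def)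
  qed (simp add: simple_reflection_def T_def)
qed

lemma W_E_mult: "f \<in> carrier (W_E n) \<Longrightarrow> g \<in> carrier (W_E n) \<Longrightarrow> f \<otimes>\<^bsub>W_E n\<^esub> g = compose (root_space n) f g"
  and W_E_one: "\<one>\<^bsub>W_E n\<^esub> = (\<lambda>v\<in>root_space n. v)"
proof -
  have sub: "carrier (W_E n) \<subseteq> Bij (root_space n)"
    unfolding W_E_def weyl_group_def using group.carrier_subgroup_generated_subset[OF group_BijGroup]
    by (metis BijGroup_def partial_object.select_convs(1))
  show "f \<in> carrier (W_E n) \<Longrightarrow> g \<in> carrier (W_E n) \<Longrightarrow> f \<otimes>\<^bsub>W_E n\<^esub> g = compose (root_space n) f g"
    using sub by (auto simp: W_E_def weyl_group_def subgroup_generated_def BijGroup_def)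
  show "\<one>\<^bsub>W_E n\<^esub> = (\<lambda>v\<in>root_space n. v)"
    by (simp add: W_E_def weyl_group_def subgroup_generated_def BijGroup_def)
qed

lemma compose_T:
  assumes n: "n \<in> {6, 7, 8}" and g: "\<And>x. x \<in> coord_space n \<Longrightarrow> g x \<in> coord_space n"
  shows "compose (root_space n) (T n f) (T n g) = T n (f \<circ> g)"
proof
  fix v
  show "compose (root_space n) (T n f) (T n g) v = T n (f \<circ> g) v"
  proof (cases "v \<in> root_space n")
    case True
    then have "g (to9 v) \<in> coord_space n" using g to9_space[OF n] by blast
    then have "from9 (g (to9 v)) \<in> root_space n" "to9 (from9 (g (to9 v))) = g (to9 v)"
      using from9_space[OF n] to9_from9 by blast+
    then show ?thesis using True by (simp add: compose_def T_def)
  qed (simp add: compose_def T_def)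
qed

lemma T_cong: "n \<in> {6, 7, 8} \<Longrightarrow> (\<And>x. x \<in> coord_space n \<Longrightarrow> f x = g x) \<Longrightarrow> T n f = T n g"
  unfolding T_def by (rule restrict_ext) (simp add: to9_space)

lemma T_eqD:
  assumes "n \<in> {6, 7, 8}" "T n f = T n g" "x \<in> coord_space n" "f x \<in> coord_space n" "g x \<in> coord_space n"
  shows "f x = g x"
proof -
  have "from9 (f (to9 (from9 x))) = from9 (g (to9 (from9 x)))"
    using fun_cong[OF assms(2), of "from9 x"] from9_space[OF assms(1,3)] by (simp add: T_def)
  then have "to9 (from9 (f x)) = to9 (from9 (g x))" using to9_from9[OF assms(3)] by simp
  then show ?thesis using to9_from9[OF assms(4)] to9_from9[OF assms(5)] by simp
qed

lemma T_one: "n \<in> {6, 7, 8} \<Longrightarrow> T n (\<lambda>x. x) = \<one>\<^bsub>W_E n\<^esub>"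
  unfolding T_def W_E_one by (rule restrict_ext) (auto intro: from9_to9)

lemma T_mult:
  assumes n: "n \<in> {6, 7, 8}" and "T n f \<in> carrier (W_E n)" "T n g \<in> carrier (W_E n)"
    and "\<And>x. x \<in> coord_space n \<Longrightarrow> g x \<in> coord_space n"
  shows "T n f \<otimes>\<^bsub>W_E n\<^esub> T n g = T n (f \<circ> g)"
  using W_E_mult[OF assms(2,3)] compose_T[OF n assms(4)] by simp

lemma reflect_in_W_E:
  assumes n: "n \<in> {6, 7, 8}" and R: "R \<in> root_lines n"
  shows "T n (reflect R) \<in> carrier (W_E n)"
proof -
  interpret W: group "W_E n" by (rule group_W_E)
  define Z where "Z = {R. T n (reflect R) \<in> carrier (W_E n)}"
  have n8: "n \<le> 8" using n by auto
  have simple: "simple_line i \<in> Z" if "i \<in> {1..n}" for i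
    using W_E_generators[OF that] simple_reflection_eq[OF n8 that] by (simp add: Z_def)
  have "root_lines n \<subseteq> Z"
  proof (rule root_lines_generated[OF n])
    fix i assume i: "i + 1 < n"
    show "{i, i + 1} \<in> Z"
    proof (cases "i = 0")
      case True then show ?thesis using simple[of 1] i by (simp add: simple_line_def)
    next
      case False
      have "i + 2 - 1 = i + 1" by simp
      then have "simple_line (i + 2) = {i, i + 1}" using False by (simp only: simple_line_def) simp
      then show ?thesis using simple[of "i + 2"] i by simp
    qed
  next
    fix R S assume *: "R \<in> Z" "S \<in> Z" "R \<in> root_lines n" "S \<in> root_lines n" "star R S \<in> root_lines n"
    have R8: "R \<in> root_lines 8" "S \<in> root_lines 8" using * root_lines_8_supset[OF n8] by blast+
    have RZ: "T n (reflect R) \<in> carrier (W_E n)" "T n (reflect S) \<in> carrier (W_E n)" using * by (simp_all add: Z_def)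
    have 1: "T n (reflect S) \<otimes>\<^bsub>W_E n\<^esub> T n (reflect R) = T n (reflect S \<circ> reflect R)"
      by (rule T_mult[OF n RZ(2,1) reflect_space[OF n *(3)]])
    then have in1: "T n (reflect S \<circ> reflect R) \<in> carrier (W_E n)" using W.m_closed[OF RZ(2,1)] by simp
    have "T n (reflect R) \<otimes>\<^bsub>W_E n\<^esub> T n (reflect S \<circ> reflect R) = T n (reflect R \<circ> (reflect S \<circ> reflect R))"
      by (rule T_mult[OF n RZ(1) in1]) (simp add: reflect_space[OF n] *(3,4))
    moreover have "reflect R \<circ> (reflect S \<circ> reflect R) = reflect (star R S)"
      by (simp add: fun_eq_iff reflect_star(2)[OF R8] reflect_reflect[OF R8(1)])
    ultimately show "star R S \<in> Z" using W.m_closed[OF RZ(1) in1] by (simp add: Z_def)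
  qed (use simple[of 2] n in \<open>auto simp: simple_line_values\<close>)
  then show ?thesis using R by (auto simp: Z_def)
qed

lemma word_in_W_E:
  assumes n: "n \<in> {6, 7, 8}" and Rs: "set Rs \<subseteq> root_lines n"
  shows "T n (word Rs) \<in> carrier (W_E n)"
  using Rs
proof (induction Rs)
  case Nil
  interpret W: group "W_E n" by (rule group_W_E)
  show ?case unfolding word_Nil T_one[OF n] by (rule W.one_closed)
next
  case (Cons R Rs)
  interpret W: group "W_E n" by (rule group_W_E)
  have c: "T n (reflect R) \<in> carrier (W_E n)" "T n (word Rs) \<in> carrier (W_E n)" using Cons reflect_in_W_E[OF n] by auto
  have "T n (reflect R) \<otimes>\<^bsub>W_E n\<^esub> T n (word Rs) = T n (reflect R \<circ> word Rs)"
    using Cons.prems by (intro T_mult[OF n c] word_space[OF n]) auto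
  then show ?case using W.m_closed[OF c] unfolding word_Cons by (simp only:)
qed

lemma T_word_mult:
  assumes n: "n \<in> {6, 7, 8}" and "set Rs \<subseteq> root_lines n" "set Ss \<subseteq> root_lines n"
  shows "T n (word Rs) \<otimes>\<^bsub>W_E n\<^esub> T n (word Ss) = T n (word (Rs @ Ss))"
proof -
  have "T n (word Rs) \<otimes>\<^bsub>W_E n\<^esub> T n (word Ss) = T n (word Rs \<circ> word Ss)"
    by (rule T_mult[OF n word_in_W_E[OF n assms(2)] word_in_W_E[OF n assms(3)] word_space[OF n assms(3)]])
  then show ?thesis unfolding word_append .
qed

text \<open>Simple reflections are reflections in lines of roots, and such words are closed under products and inverses.\<close>

theorem W_E_words:
  assumes n: "n \<in> {6, 7, 8}" and g: "g \<in> carrier (W_E n)"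
  shows "\<exists>Rs. set Rs \<subseteq> root_lines n \<and> g = T n (word Rs)"
proof -
  let ?G = "BijGroup (root_space n)" and ?S = "simple_reflection cartan_E n ` {1..n}"
  interpret B: group ?G by (rule group_BijGroup)
  have n8: "n \<le> 8" using n by auto
  have line: "simple_line i \<in> root_lines n" if "i \<in> {1..n}" for i
    using that n by (auto simp: simple_line_def root_lines_def upto9 card_insert_if)
  have gen: "\<exists>R\<in>root_lines n. h = T n (word [R])" if "h \<in> carrier ?G \<inter> ?S" for h
    using that line simple_reflection_eq[OF n8] by (auto simp: word_def)
  have "g \<in> generate ?G (carrier ?G \<inter> ?S)" using g by (simp add: W_E_def weyl_group_def carrier_subgroup_generated)
  then show ?thesis
  proof (induction g rule: generate.induct)
    case one
    have "\<one>\<^bsub>?G\<^esub> = T n (word [])" unfolding word_Nil T_one[OF n] by (simp add: W_E_one BijGroup_def)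
    then show ?case by (intro exI[of _ "[]"] conjI) (simp_all only: list.set empty_subsetI)
  next
    case (incl h)
    then show ?case using gen by force
  next
    case (inv h)
    then obtain R where R: "R \<in> root_lines n" "h = T n (word [R])" using gen by blast
    have sq: "word [R] \<circ> word [R] = (\<lambda>x. x)" by (rule ext) (simp add: reflect_reflect[OF R(1)])
    have "set [R] \<subseteq> root_lines n" using R(1) by simp
    then have "compose (root_space n) h h = T n (\<lambda>x. x)"
      unfolding R(2) sq[symmetric] by (intro compose_T[OF n] word_space[OF n])
    then have "h \<otimes>\<^bsub>?G\<^esub> h = \<one>\<^bsub>?G\<^esub>" using inv T_one[OF n] by (simp add: BijGroup_def W_E_one)
    then have iv: "inv\<^bsub>?G\<^esub> h = h" using inv by (intro B.inv_equality) auto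
    show ?case unfolding iv using \<open>set [R] \<subseteq> root_lines n\<close> R(2) by (intro exI[of _ "[R]"] conjI)
  next
    case (eng h1 h2)
    then obtain Rs Ss where *: "set Rs \<subseteq> root_lines n" "h1 = T n (word Rs)" "set Ss \<subseteq> root_lines n" "h2 = T n (word Ss)" by blast
    have "h1 \<otimes>\<^bsub>?G\<^esub> h2 = h1 \<otimes>\<^bsub>W_E n\<^esub> h2" by (simp add: W_E_def weyl_group_def subgroup_generated_def)
    also have "\<dots> = T n (word (Rs @ Ss))" unfolding * by (rule T_word_mult[OF n *(1,3)])
    finally have "h1 \<otimes>\<^bsub>?G\<^esub> h2 = T n (word (Rs @ Ss))" .
    moreover have "set (Rs @ Ss) \<subseteq> root_lines n" using *(1,3) by simp
    ultimately show ?case by (intro exI[of _ "Rs @ Ss"] conjI)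
  qed
qed

section \<open>Lower bounds for the degree\<close>

text \<open>Only the line \<open>{7, 8}\<close>, excluded for \<open>n = 7\<close>, needs care: it is not in the plane of two lines that are both constant on the last coordinates.\<close>

lemma star_line:
  assumes n: "n \<in> {6, 7, 8}" and R: "R \<in> root_lines n" and S: "S \<in> root_lines n"
  shows "star R S \<in> root_lines n"
proof (cases "adjacent R S")
  case False
  then show ?thesis using S by (simp add: star_def)
next
  case True
  let ?D = "{n..<9}" and ?Q = "third R S"
  have n8: "n \<le> 8" using n by auto
  have R8: "R \<in> root_lines 8" and S8: "S \<in> root_lines 8" using R S root_lines_8_supset[OF n8] by blast+
  have "?Q \<in> root_lines 8" using reflect_star(1)[OF R8 S8] True by (simp add: star_def)
  then have Q: "?Q \<subseteq> {..<9}" "card ?Q = 2 \<or> card ?Q = 3" by (auto simp: root_lines_8)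
  have sub: "R \<subseteq> {..<9}" "S \<subseteq> {..<9}" "card R \<in> {2, 3}" "card S \<in> {2, 3}" using R8 S8 by (auto simp: root_lines_8)
  have fin: "finite R" "finite S" using sub finite_subset by auto
  have Ror: "R \<inter> ?D = {} \<or> ?D \<subseteq> R" and Sor: "S \<inter> ?D = {} \<or> ?D \<subseteq> S" using R S unfolding root_lines_def by blast+
  have "?D \<subseteq> {..<9}" by auto
  then have Qor: "?Q \<inter> ?D = {} \<or> ?D \<subseteq> ?Q" using Ror Sor unfolding third_def by (cases "R \<inter> S = {}") (simp, blast, simp, blast)
  have "card ?Q = 3 \<or> n = 8" if D: "?D \<subseteq> ?Q"
  proof (rule ccontr)
    assume "\<not> ?thesis"
    then have c: "card ?Q = 2" "n \<noteq> 8" using Q by auto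
    have finQ: "finite ?Q" using Q(1) finite_subset by auto
    have "card ?D \<le> 2" using card_mono[OF finQ D] c by simp
    then have cD: "card ?D = 2" using c(2) n by auto
    then have QD: "?Q = ?D" using card_subset_eq[OF finQ D] c by simp
    have no: False if "?D \<subseteq> A" "B \<inter> ?D = {}" "B - A \<subseteq> ?D" "card A \<in> {2, 3}" "card B \<in> {2, 3}" "finite A" for A B
    proof -
      have "B \<subseteq> A - ?D" using that by blast
      then have "card B \<le> card (A - ?D)" using that(6) by (intro card_mono) auto
      also have "\<dots> = card A - 2" using card_Diff_subset[OF _ that(1)] cD by simp
      finally show False using that(4,5) by auto
    qed
    show False
    proof (cases "R \<inter> S = {}")
      case True
      then have "card (R \<union> S) = card R + card S" using fin by (simp add: card_Un_disjoint)
      moreover have "card ?Q = 9 - card (R \<union> S)" using True sub fin by (simp add: third_def card_Diff_subset)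
      ultimately show False using c sub(3,4) by auto
    next
      case False
      then have Qe: "?Q = (R - S) \<union> (S - R)" by (simp add: third_def)
      obtain d where "d \<in> ?D" using cD by fastforce
      then have "(?D \<subseteq> R \<and> S \<inter> ?D = {}) \<or> (?D \<subseteq> S \<and> R \<inter> ?D = {})" using Ror Sor D unfolding Qe by blast
      moreover have "S - R \<subseteq> ?D" "R - S \<subseteq> ?D" using QD unfolding Qe by blast+
      ultimately show False using no[of R S] no[of S R] sub fin by blast
    qed
  qed
  then have "?Q \<in> root_lines n" using Q Qor unfolding root_lines_def by blast
  then show ?thesis using True by (simp add: star_def)
qed

definition minus_one :: "nat \<Rightarrow> nat set list \<Rightarrow> bool" where
  "minus_one n Rs \<longleftrightarrow> set Rs \<subseteq> root_lines n \<and> (\<forall>x\<in>coord_space n. word Rs x = (\<lambda>k. - x k))"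

text \<open>Reflections in lines orthogonal to \<open>R\<close> preserve the component along \<open>R\<close>.\<close>

lemma ip_word_orthogonal:
  "\<forall>S\<in>set Rs. ip (rv R) (rv S) = 0 \<Longrightarrow> ip (rv R) (word Rs x) = ip (rv R) x"
proof (induction Rs)
  case (Cons S Rs)
  have e: "reflect S (word Rs x) = (\<lambda>k. 1 * word Rs x k + (- ip (rv S) (word Rs x)) * rv S k)"
    by (simp add: reflect_def fun_eq_iff)
  show ?case using Cons unfolding word_simps e ip_add by simp
qed simp

lemma word_orthogonal:
  "sorted_wrt (\<lambda>R S. ip (rv R) (rv S) = 0) Rs \<Longrightarrow> word Rs x k = x k - (\<Sum>R\<leftarrow>Rs. ip (rv R) x * rv R k)"
  by (induction Rs) (simp_all add: ip_word_orthogonal reflect_def)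

text \<open>Orthogonal frames consisting of lines of roots. They exist in types \<open>E7\<close> and \<open>E8\<close>, and the product of the reflections in such a frame is \<open>-1\<close>.\<close>

definition frame_7 :: "nat set list" where
  "frame_7 = [{0, 1}, {2, 3}, {4, 5}, {0, 1, 6}, {2, 3, 6}, {4, 5, 6}, {6, 7, 8}]"

definition frame_8 :: "nat set list" where
  "frame_8 = [{0, 1}, {2, 3}, {4, 5}, {6, 7}, {0, 1, 8}, {2, 3, 8}, {4, 5, 8}, {6, 7, 8}]"

lemma minus_one_E7: "minus_one 7 frame_7"
  unfolding minus_one_def
proof (intro conjI ballI ext)
  show "set frame_7 \<subseteq> root_lines 7" by (auto simp: frame_7_def lines_eval)
  fix x :: "nat \<Rightarrow> real" and k assume x: "x \<in> coord_space 7"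
  have s: "x 0 + x 1 + x 2 + x 3 + x 4 + x 5 + x 6 + x 7 + x 8 = 0" using coord_spaceD(2)[OF x] by (simp add: sum_nine)
  have 7: "x 7 = x 8" using bspec[OF coord_spaceD(3)[OF x], of 7] by simp
  have z: "x k = 0" if "9 \<le> k" using that coord_spaceD(1)[OF x] by simp
  have o: "sorted_wrt (\<lambda>R S. ip (rv R) (rv S) = 0) frame_7"
    by (simp add: frame_7_def ip_pair ip_triple sum_nine) (simp add: rv_def)
  show "word frame_7 x k = - x k"
    unfolding word_orthogonal[OF o] 
    by (insert nine_cases[of k] s 7 z, (elim disjE; (simp add: frame_7_def ip_pair ip_triple sum_nine rv_def field_simps)?))
qed

lemma minus_one_E8: "minus_one 8 frame_8"
  unfolding minus_one_def
proof (intro conjI ballI ext)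
  show "set frame_8 \<subseteq> root_lines 8" by (auto simp: frame_8_def lines_eval)
  fix x :: "nat \<Rightarrow> real" and k assume x: "x \<in> coord_space 8"
  have s: "x 0 + x 1 + x 2 + x 3 + x 4 + x 5 + x 6 + x 7 + x 8 = 0" using coord_spaceD(2)[OF x] by (simp add: sum_nine)
  have z: "x k = 0" if "9 \<le> k" using that coord_spaceD(1)[OF x] by simp
  have o: "sorted_wrt (\<lambda>R S. ip (rv R) (rv S) = 0) frame_8"
    by (simp add: frame_8_def ip_pair ip_triple sum_nine) (simp add: rv_def)
  show "word frame_8 x k = - x k"
    unfolding word_orthogonal[OF o] 
    by (insert nine_cases[of k] s z, (elim disjE; (simp add: frame_8_def ip_pair ip_triple sum_nine rv_def field_simps)?))
qed

lemma permutation_word: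
  assumes "p permutes {..<9}"
  shows "\<exists>Rs. set Rs \<subseteq> root_lines 8 \<and> word Rs = (\<lambda>x. x \<circ> inv' p)"
  using assms finite_lessThan
proof (induction rule: permutes_induct)
  case id
  have "word [] = (\<lambda>x. x \<circ> inv' id)" by (rule ext) simp
  then show ?case by (intro exI[of _ "[]"] conjI) simp_all
next
  case (swap i j p)
  then obtain Rs where Rs: "set Rs \<subseteq> root_lines 8" "word Rs = (\<lambda>x. x \<circ> inv' p)" by blast
  have ij: "i < 9" "j < 9" "i \<noteq> j" using swap by auto
  have inv: "inv' (transpose i j \<circ> p) = inv' p \<circ> transpose i j"
    using permutes_bij[OF swap(4)] by (simp add: o_inv_distrib)
  have "word ({i, j} # Rs) x = x \<circ> inv' (transpose i j \<circ> p)" for x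
    using reflect_pair[OF ij, of "x \<circ> inv' p"] unfolding inv word_simps Rs(2) by (simp add: o_assoc)
  then have "word ({i, j} # Rs) = (\<lambda>x. x \<circ> inv' (transpose i j \<circ> p))" by (rule ext)
  moreover have "{i, j} \<in> root_lines 8" using ij by (simp add: root_lines_8)
  then have "set ({i, j} # Rs) \<subseteq> root_lines 8" using Rs(1) by simp
  ultimately show ?case by (intro exI[of _ "{i, j} # Rs"] conjI)
qed

locale permutation_representation =
  fixes n m :: nat and \<phi> :: "((nat \<Rightarrow> real) \<Rightarrow> (nat \<Rightarrow> real)) \<Rightarrow> nat \<Rightarrow> nat"
  assumes n: "n \<in> {6, 7, 8}" and \<phi>: "\<phi> \<in> mon (W_E n) (sym_group m)"
begin

definition act :: "nat set list \<Rightarrow> nat \<Rightarrow> nat" where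
  "act Rs = \<phi> (T n (word Rs))"

definition t :: "nat set \<Rightarrow> nat \<Rightarrow> nat" where
  "t R = act [R]"

lemma act_append:
  assumes "set Rs \<subseteq> root_lines n" "set Ss \<subseteq> root_lines n"
  shows "act (Rs @ Ss) x = act Rs (act Ss x)"
proof -
  have "\<phi> \<in> hom (W_E n) (sym_group m)" using \<phi> by (simp add: mon_def)
  from hom_mult[OF this word_in_W_E[OF n assms(1)] word_in_W_E[OF n assms(2)]]
  have "act (Rs @ Ss) = act Rs \<circ> act Ss" unfolding act_def T_word_mult[OF n assms] sym_group_mult .
  then show ?thesis by simp
qed

lemma act_permutes: "set Rs \<subseteq> root_lines n \<Longrightarrow> act Rs permutes {1..m}"
  using hom_in_carrier[of \<phi> "W_E n" "sym_group m"] \<phi> word_in_W_E[OF n]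
  unfolding act_def by (auto simp: mon_def sym_group_carrier)

lemma act_cong: "(\<And>x. x \<in> coord_space n \<Longrightarrow> word Rs x = word Ss x) \<Longrightarrow> act Rs = act Ss"
  unfolding act_def using T_cong[OF n, of "word Rs" "word Ss"] by simp

lemma act_eqD:
  assumes "act Rs = act Ss" and Rs: "set Rs \<subseteq> root_lines n" and Ss: "set Ss \<subseteq> root_lines n"
    and x: "x \<in> coord_space n"
  shows "word Rs x = word Ss x"
proof -
  have "inj_on \<phi> (carrier (W_E n))" using \<phi> by (simp add: mon_def)
  then have "T n (word Rs) = T n (word Ss)"
    using assms(1) word_in_W_E[OF n Rs] word_in_W_E[OF n Ss] unfolding act_def by (rule inj_onD)
  then show ?thesis by (rule T_eqD[where f = "word Rs" and g = "word Ss", OF n _ x word_space[OF n Rs x] word_space[OF n Ss x]])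
qed

lemma act_Nil: "act [] x = x"
proof -
  have "act [] (act [] x) = act [] x" using act_append[of "[]" "[]" x] by simp
  moreover have "inj (act [])" using act_permutes[of "[]"] permutes_inj by simp
  ultimately show ?thesis by (simp add: inj_eq)
qed

lemma act_Cons: "R \<in> root_lines n \<Longrightarrow> set Rs \<subseteq> root_lines n \<Longrightarrow> act (R # Rs) x = t R (act Rs x)"
  using act_append[of "[R]" Rs x] by (simp add: t_def)

lemma n8: "n \<le> 8" using n by auto

sublocale reflection_action n "{1..m}" t
proof
  show "finite {1..m}" by simp
  show "t R y \<in> {1..m}" if "R \<in> root_lines n" "y \<in> {1..m}" for R y
    using permutes_in_image[OF act_permutes[of "[R]"]] that unfolding t_def by simp
  show "t R (t R y) = y" if R: "R \<in> root_lines n" for R y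
  proof -
    have "act [R, R] = act []" by (rule act_cong) (simp add: reflect_reflect[OF R])
    then show ?thesis using act_Cons[of R "[R]" y] R act_Nil by (simp add: t_def)
  qed
  show "t R (t Q y) = t (star R Q) (t R y)" if R: "R \<in> root_lines n" and Q: "Q \<in> root_lines n" for R Q y
  proof -
    have R8: "R \<in> root_lines 8" "Q \<in> root_lines 8" using R Q root_lines_8_supset[OF n8] by blast+
    have "act [R, Q] = act [star R Q, R]" by (rule act_cong) (simp add: reflect_star(2)[OF R8])
    then show ?thesis
      using act_Cons[of R "[Q]" y] act_Cons[of "star R Q" "[R]" y] R Q star_line[OF n R Q] by (simp add: t_def)
  qed
qed

lemma simple_lines: "{0, 1} \<in> root_lines n" "{1, 2} \<in> root_lines n" "adjacent {0, 1} {1, 2}"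
  using n by (auto simp: lines_eval adjacent_def)

lemma first_line_space: "rv {0, 1} \<in> coord_space n"
  by (rule rv_space[OF n simple_lines(1)])

text \<open>In a faithful representation different reflections have different images.\<close>

lemma distinguished_point: "\<exists>x\<in>{1..m}. t {0, 1} x \<noteq> t {1, 2} x"
proof (rule ccontr)
  assume c: "\<not> ?thesis"
  have "act [{0, 1}] = act [{1, 2}]"
  proof
    fix x
    show "act [{0, 1}] x = act [{1, 2}] x"
    proof (cases "x \<in> {1..m}")
      case True
      then show ?thesis using c unfolding t_def by blast
    next
      case False
      then show ?thesis
        using permutes_not_in[OF act_permutes[of "[{0, 1}]"]] permutes_not_in[OF act_permutes[of "[{1, 2}]"]]
          simple_lines by simp
    qed
  qed
  then have "word [{0, 1}] (rv {0, 1}) = word [{1, 2}] (rv {0, 1})"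
    by (rule act_eqD[OF _ _ _ first_line_space]) (use simple_lines in simp_all)
  then have "word [{0, 1}] (rv {0, 1}) 0 = word [{1, 2}] (rv {0, 1}) 0" by (rule fun_cong)
  then show False by (simp add: reflect_pair rv_pair transpose_def)
qed

end

locale central_representation = permutation_representation +
  fixes Ns :: "nat set list"
  assumes minus_one: "minus_one n Ns"
begin

definition z :: "nat \<Rightarrow> nat" where "z = act Ns"

definition moved :: "nat set" where "moved = {x \<in> {1..m}. z x \<noteq> x}"

lemma Ns: "set Ns \<subseteq> root_lines n" "x \<in> coord_space n \<Longrightarrow> word Ns x = (\<lambda>k. - x k)"
  using minus_one by (auto simp: minus_one_def)

lemma minus_space: "x \<in> coord_space n \<Longrightarrow> (\<lambda>k. - x k) \<in> coord_space n"
  using coord_space_linear[of x n x "-1" 0] by simp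

lemma z_z: "z (z x) = x"
proof -
  have "act (Ns @ Ns) = act []" by (rule act_cong) (simp add: Ns minus_space)
  then show ?thesis using act_append[OF Ns(1) Ns(1)] act_Nil by (simp add: z_def)
qed

lemma z_t: "R \<in> root_lines n \<Longrightarrow> z (t R x) = t R (z x)"
proof -
  assume R: "R \<in> root_lines n"
  have "act (Ns @ [R]) = act ([R] @ Ns)"
  proof (rule act_cong)
    fix x assume x: "x \<in> coord_space n"
    have "reflect R (\<lambda>k. - x k) = (\<lambda>k. - reflect R x k)" using reflect_linear[of R "-1" x 0 x] by simp
    then show "word (Ns @ [R]) x = word ([R] @ Ns) x"
      using Ns(2)[OF x] Ns(2)[OF reflect_space[OF n R x]] by simp
  qed
  then show ?thesis using act_append[OF Ns(1), of "[R]" x] act_append[OF _ Ns(1), of "[R]" x] R by (simp add: z_def t_def)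
qed

lemma z_closed: "x \<in> {1..m} \<Longrightarrow> z x \<in> {1..m}"
  unfolding z_def using permutes_in_image[OF act_permutes[OF Ns(1)]] by blast

lemma z_moved: "x \<in> moved \<Longrightarrow> z x \<in> moved"
  using z_closed[of x] z_z[of x] by (auto simp: moved_def)

lemma t_moved: "R \<in> root_lines n \<Longrightarrow> x \<in> moved \<Longrightarrow> t R x \<in> moved"
proof -
  assume R: "R \<in> root_lines n" and x: "x \<in> moved"
  have "t R (z x) \<noteq> t R x" using invol[OF R, of x] invol[OF R, of "z x"] x by (auto simp: moved_def)
  then show ?thesis using closed[OF R, of x] x unfolding moved_def by (simp add: z_t[OF R])
qed

lemma moved_nonempty: "moved \<noteq> {}"
proof
  assume e: "moved = {}"
  have "act Ns = act []"
  proof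
    fix x
    show "act Ns x = act [] x"
    proof (cases "x \<in> {1..m}")
      case True
      then have "z x = x" using e by (auto simp: moved_def)
      then show ?thesis by (simp add: z_def act_Nil)
    next
      case False
      then show ?thesis using permutes_not_in[OF act_permutes[OF Ns(1)]] by (simp add: act_Nil)
    qed
  qed
  then have "word Ns (rv {0, 1}) = word [] (rv {0, 1})"
    by (rule act_eqD[OF _ Ns(1) _ first_line_space]) simp
  then have "- rv {0, 1} 0 = rv {0, 1} 0" unfolding Ns(2)[OF first_line_space] word_simps by (rule fun_cong)
  then show False by (simp add: rv_pair)
qed

lemma card_moved: "2 \<le> card moved"
proof -
  obtain x where x: "x \<in> moved" using moved_nonempty by blast
  have "card {x, z x} \<le> card moved" using x z_moved[OF x] by (intro card_mono) (auto simp: moved_def)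
  moreover have "z x \<noteq> x" using x by (simp add: moved_def)
  ultimately show ?thesis by (simp add: card_insert_if)
qed

text \<open>The element \<open>-1\<close> is central, so the group acts on its orbits of length two.\<close>

definition pairs :: "nat set set" where "pairs = (\<lambda>x. {x, z x}) ` moved"

lemma card_pairs: "2 * card pairs = card moved"
proof -
  have U: "\<Union>pairs = moved" using z_moved by (auto simp: pairs_def)
  have "card (\<Union>pairs) = sum card pairs"
  proof (rule card_Union_disjoint)
    show "pairwise disjnt pairs"
    proof (intro pairwiseI)
      fix A B assume "A \<in> pairs" "B \<in> pairs" and ne: "A \<noteq> B"
      then obtain x y where A: "A = {x, z x}" and B: "B = {y, z y}" by (auto simp: pairs_def)
      show "disjnt A B"
      proof (rule ccontr)
        assume "\<not> disjnt A B"
        then have "x = y \<or> x = z y \<or> z x = y \<or> z x = z y" unfolding A B by (auto simp: disjnt_def)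
        moreover have "x = y" if "z x = z y" using arg_cong[OF that, of z] unfolding z_z .
        moreover have "x = z y" if "z x = y" using arg_cong[OF that, of z] unfolding z_z .
        ultimately have "x = y \<or> x = z y" by blast
        then have "A = B" unfolding A B by (elim disjE) (simp_all add: z_z insert_commute)
        then show False using ne by blast
      qed
    qed
    show "finite A" if "A \<in> pairs" for A using that by (auto simp: pairs_def)
  qed
  also have "\<dots> = (\<Sum>A\<in>pairs. 2)" by (rule sum.cong) (auto simp: pairs_def moved_def)
  finally show ?thesis using U by simp
qed

lemma pairs_action: "reflection_action n pairs (\<lambda>R. (`) (t R))"
proof
  show "finite pairs" by (simp add: pairs_def moved_def)
  show "t R ` A \<in> pairs" if R: "R \<in> root_lines n" and A: "A \<in> pairs" for R A
  proof -
    obtain x where x: "x \<in> moved" "A = {x, z x}" using A by (auto simp: pairs_def)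
    have "t R ` A = {t R x, z (t R x)}" unfolding x(2) z_t[OF R] by simp
    then show ?thesis using t_moved[OF R x(1)] by (auto simp: pairs_def)
  qed
  show "t R ` t R ` A = A" if "R \<in> root_lines n" for R A
    using invol[OF that] by (simp add: image_image)
  show "t R ` t Q ` A = t (star R Q) ` t R ` A" if "R \<in> root_lines n" "Q \<in> root_lines n" for R Q A
    using conj[OF that] by (simp add: image_image)
qed

text \<open>If the two adjacent reflections agree on pairs, the rotation that is their product either fixes \<open>x\<close> or exchanges \<open>x\<close>
with \<open>z x\<close>. The latter is impossible for an element of order three.\<close>

lemma moved_agree:
  assumes pairs: "\<And>A. A \<in> pairs \<Longrightarrow> t {0, 1} ` A = t {1, 2} ` A" and x: "x \<in> moved"
  shows "t {0, 1} x = t {1, 2} x"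
proof (rule ccontr)
  assume ne: "\<not> ?thesis"
  let ?R = "{0, 1 :: nat}" and ?Q = "{1, 2 :: nat}"
  note RQ = simple_lines
  have "{x, z x} \<in> pairs" using x by (simp add: pairs_def)
  then have "t ?R ` {x, z x} = t ?Q ` {x, z x}" by (rule pairs)
  then have "t ?R x \<in> {t ?Q x, t ?Q (z x)}" by auto
  then have "t ?R x = t ?Q (z x)" using ne by simp
  then have u: "t ?Q (t ?R x) = z x" using invol[OF RQ(2)] by simp
  have step: "t ?Q (t ?R (z y)) = z (t ?Q (t ?R y))" for y by (simp add: z_t[OF RQ(1)] z_t[OF RQ(2)])
  have "t ?Q (t ?R (t ?Q (t ?R (t ?Q (t ?R x))))) = z x" by (simp add: u step z_z)
  moreover have "t ?Q (t ?R (t ?Q (t ?R (t ?Q (t ?R x))))) = x"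
    by (rule rotation_cubed[OF RQ(2,1)]) (use RQ(3) in \<open>simp add: adjacent_commute\<close>)
  ultimately show False using x by (simp add: moved_def)
qed

end

theorem E6_lower_bound:
  assumes "\<phi> \<in> mon (W_E 6) (sym_group m)"
  shows "27 \<le> m"
proof (rule ccontr)
  assume m: "\<not> ?thesis"
  interpret permutation_representation 6 m \<phi> by unfold_locales (simp_all add: assms)
  have "reflection_action 6 {1..m} t" ..
  then have "t {0, 1} x = t {1, 2} x" if "x \<in> {1..m}" for x
    by (rule E6_action_constant[OF _ _ that simple_lines(1,2)]) (use m in simp)
  then show False using distinguished_point by blast
qed

text \<open>At least two of the at most \<open>29\<close> points are moved by \<open>-1\<close>, so at most \<open>27\<close> are fixed and there are at most \<open>14\<close> pairs. The
reflections agree on both kinds of points, against faithfulness.\<close>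

theorem E7_lower_bound:
  assumes "\<phi> \<in> mon (W_E 7) (sym_group m)"
  shows "30 \<le> m"
proof (rule ccontr)
  assume m: "\<not> ?thesis"
  interpret central_representation 7 m \<phi> frame_7 by unfold_locales (simp_all add: assms minus_one_E7)
  have sub: "moved \<subseteq> {1..m}" by (auto simp: moved_def)
  then have cm: "card moved \<le> m" using card_mono[of "{1..m}" moved] by simp
  have fixed: "t {0, 1} x = t {1, 2} x" if x: "x \<in> {1..m} - moved" for x
  proof -
    have "reflection_action 7 ({1..m} - moved) t"
    proof
      show "finite ({1..m} - moved)" by simp
      show "t R y \<in> {1..m} - moved" if R: "R \<in> root_lines 7" and y: "y \<in> {1..m} - moved" for R y
        using t_moved[OF R, of "t R y"] invol[OF R, of y] closed[OF R, of y] y by auto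
    qed (simp_all add: invol conj)
    moreover have "card ({1..m} - moved) \<le> 27"
      using card_moved m card_Diff_subset[OF finite_subset[OF sub] sub] by simp
    ultimately show ?thesis using E7_action_constant[OF _ _ x simple_lines(1,2)] by blast
  qed
  have "t {0, 1} x = t {1, 2} x" if x: "x \<in> moved" for x
  proof (rule moved_agree[OF _ x])
    fix A assume "A \<in> pairs"
    then show "t {0, 1} ` A = t {1, 2} ` A"
      by (intro E7_action_constant[OF pairs_action]) (use card_pairs cm m simple_lines in auto)
  qed
  then show False using fixed distinguished_point by blast
qed

text \<open>At most \<open>119\<close> pairs are moved by \<open>-1\<close>, so the reflections agree on the points moved. The product of two reflections is
then trivial there, and so is \<open>-1\<close>, a product of eight.\<close>

theorem E8_lower_bound:
  assumes "\<phi> \<in> mon (W_E 8) (sym_group m)"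
  shows "240 \<le> m"
proof (rule ccontr)
  assume m: "\<not> ?thesis"
  interpret central_representation 8 m \<phi> frame_8 by unfold_locales (simp_all add: assms minus_one_E8)
  have sub: "moved \<subseteq> {1..m}" by (auto simp: moved_def)
  then have cm: "card moved \<le> m" using card_mono[of "{1..m}" moved] by simp
  obtain w where w: "set (w p) \<subseteq> root_lines 8" "word (w p) = (\<lambda>x. x \<circ> inv' p)" if "p permutes {..<9}" for p
    using permutation_word by metis
  interpret P: e8_action pairs "\<lambda>R. (`) (t R)" "\<lambda>p. (`) (act (w p))"
  proof (intro e8_action.intro pairs_action e8_action_axioms.intro)
    fix i j :: nat and A assume ij: "i < 9" "j < 9" "i \<noteq> j"
    have p: "transpose i j permutes {..<9}" using ij by (intro permutes_swap_id) auto
    have "act (w (transpose i j)) = act [{i, j}]"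
      by (rule act_cong) (simp add: w(2)[OF p] reflect_pair[OF ij])
    then show "act (w (transpose i j)) ` A = t {i, j} ` A" by (simp add: t_def)
  next
    fix p q :: "nat \<Rightarrow> nat" and A assume p: "p permutes {..<9}" and q: "q permutes {..<9}"
    have pq: "p \<circ> q permutes {..<9}" by (rule permutes_compose[OF q p])
    have inv: "inv' (p \<circ> q) = inv' q \<circ> inv' p" by (rule o_inv_distrib[OF permutes_bij[OF p] permutes_bij[OF q]])
    have "act (w (p \<circ> q)) = act (w p @ w q)"
      by (rule act_cong) (simp add: w(2)[OF p] w(2)[OF q] w(2)[OF pq] inv o_assoc)
    then have "act (w (p \<circ> q)) x = act (w p) (act (w q) x)" for x
      using act_append[OF w(1)[OF p] w(1)[OF q]] by simp
    then show "act (w (p \<circ> q)) ` A = act (w p) ` act (w q) ` A" by (simp add: image_image)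
  next
    show "card pairs \<le> 119" using card_pairs cm m by simp
  qed
  have base: "t {0, 1} x = t {1, 2} x" if x: "x \<in> moved" for x
    by (rule moved_agree[OF _ x]) (rule P.E8_action_constant[OF _ simple_lines(1,2)])
  have cancel: "t R (t Q x) = x" if x: "x \<in> moved" and R: "R \<in> root_lines 8" and Q: "Q \<in> root_lines 8" for x R Q
    using all_lines_agree[OF n t_moved base t_moved[OF Q x] R Q] invol[OF Q] by simp
  obtain x where x: "x \<in> moved" using moved_nonempty by blast
  have lines: "{0, 1} \<in> root_lines 8" "{2, 3} \<in> root_lines 8" "{4, 5} \<in> root_lines 8" "{6, 7} \<in> root_lines 8"
    "{0, 1, 8} \<in> root_lines 8" "{2, 3, 8} \<in> root_lines 8" "{4, 5, 8} \<in> root_lines 8" "{6, 7, 8} \<in> root_lines 8"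
    by (simp_all add: root_lines_8)
  have "act frame_8 x = x" unfolding frame_8_def by (simp add: act_Cons act_Nil lines cancel[OF x])
  then show False using x by (simp add: moved_def z_def)
qed

section \<open>Faithful actions of small degree\<close>

text \<open>An action is described on words in the reflections; that it depends only on the transformation which a word
represents is the condition \<open>cong\<close>.\<close>

theorem mon_of_word_action:
  fixes \<alpha> :: "nat set list \<Rightarrow> 'o \<Rightarrow> 'o"
  assumes n: "n \<in> {6, 7, 8}" and fin: "finite \<Omega>" and card: "card \<Omega> \<le> m"
    and closed: "\<And>Rs \<omega>. set Rs \<subseteq> root_lines n \<Longrightarrow> \<omega> \<in> \<Omega> \<Longrightarrow> \<alpha> Rs \<omega> \<in> \<Omega>"
    and empty: "\<And>\<omega>. \<omega> \<in> \<Omega> \<Longrightarrow> \<alpha> [] \<omega> = \<omega>"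
    and append: "\<And>Rs Ss \<omega>. set Rs \<subseteq> root_lines n \<Longrightarrow> set Ss \<subseteq> root_lines n \<Longrightarrow> \<omega> \<in> \<Omega> \<Longrightarrow> \<alpha> (Rs @ Ss) \<omega> = \<alpha> Rs (\<alpha> Ss \<omega>)"
    and cong: "\<And>Rs Ss \<omega>. (\<And>x. x \<in> coord_space n \<Longrightarrow> word Rs x = word Ss x) \<Longrightarrow> \<omega> \<in> \<Omega> \<Longrightarrow> \<alpha> Rs \<omega> = \<alpha> Ss \<omega>"
    and faithful: "\<And>Rs x. set Rs \<subseteq> root_lines n \<Longrightarrow> (\<And>\<omega>. \<omega> \<in> \<Omega> \<Longrightarrow> \<alpha> Rs \<omega> = \<omega>) \<Longrightarrow> x \<in> coord_space n \<Longrightarrow> word Rs x = x"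
  shows "\<exists>\<phi>. \<phi> \<in> mon (W_E n) (sym_group m)"
proof -
  interpret W: group "W_E n" by (rule group_W_E)
  obtain w where w: "set (w g) \<subseteq> root_lines n" "g = T n (word (w g))" if "g \<in> carrier (W_E n)" for g
    using W_E_words[OF n] by metis
  have wD: "\<alpha> (w g) \<omega> = \<alpha> Rs \<omega>" if g: "g \<in> carrier (W_E n)" and Rs: "set Rs \<subseteq> root_lines n" "g = T n (word Rs)" and \<omega>: "\<omega> \<in> \<Omega>" for g Rs \<omega>
  proof (rule cong[OF _ \<omega>])
    fix x assume x: "x \<in> coord_space n"
    have "T n (word (w g)) = T n (word Rs)" using w(2)[OF g] Rs(2) by simp
    then show "word (w g) x = word Rs x"
      by (rule T_eqD[where f = "word (w g)" and g = "word Rs", OF n _ x word_space[OF n w(1)[OF g] x] word_space[OF n Rs(1) x]])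
  qed
  have w_mult: "\<alpha> (w (g \<otimes>\<^bsub>W_E n\<^esub> h)) \<omega> = \<alpha> (w g) (\<alpha> (w h) \<omega>)"
    if g: "g \<in> carrier (W_E n)" and h: "h \<in> carrier (W_E n)" and \<omega>: "\<omega> \<in> \<Omega>" for g h \<omega>
  proof -
    have gh: "g \<otimes>\<^bsub>W_E n\<^esub> h = T n (word (w g @ w h))"
      using T_word_mult[OF n w(1)[OF g] w(1)[OF h]] unfolding w(2)[OF g, symmetric] w(2)[OF h, symmetric] .
    have "set (w g @ w h) \<subseteq> root_lines n" using w(1)[OF g] w(1)[OF h] by simp
    from wD[OF W.m_closed[OF g h] this gh \<omega>] show ?thesis unfolding append[OF w(1)[OF g] w(1)[OF h] \<omega>] .
  qed
  have w_one: "\<alpha> (w \<one>\<^bsub>W_E n\<^esub>) \<omega> = \<omega>" if \<omega>: "\<omega> \<in> \<Omega>" for \<omega>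
  proof -
    have "\<one>\<^bsub>W_E n\<^esub> = T n (word [])" unfolding word_Nil T_one[OF n] ..
    from wD[OF W.one_closed _ this \<omega>] show ?thesis unfolding empty[OF \<omega>] by simp
  qed
  define c where "c = card \<Omega>"
  have "card \<Omega> = card {1..c}" unfolding c_def card_atLeastAtMost diff_Suc_1 ..
  from finite_same_card_bij[OF fin finite_atLeastAtMost this] obtain b where b: "bij_betw b \<Omega> {1..c}" ..
  define b' where "b' = the_inv_into \<Omega> b"
  have b'b: "b' (b \<omega>) = \<omega>" if "\<omega> \<in> \<Omega>" for \<omega>
    unfolding b'_def by (rule the_inv_into_f_f[OF bij_betw_imp_inj_on[OF b] that])
  have bb': "b (b' k) = k" if "k \<in> {1..c}" for k
    unfolding b'_def by (rule f_the_inv_into_f_bij_betw[OF b]) (rule that)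
  have b'\<Omega>: "b' k \<in> \<Omega>" if "k \<in> {1..c}" for k
    using bij_betw_the_inv_into[OF b] that unfolding b'_def by (rule bij_betwE[THEN bspec])
  have b\<Omega>: "b \<omega> \<in> {1..c}" if "\<omega> \<in> \<Omega>" for \<omega> using bij_betwE[OF b] that by blast
  define \<phi> where "\<phi> g k = (if k \<in> {1..c} then b (\<alpha> (w g) (b' k)) else k)" for g k
  have \<phi>_in: "\<phi> g k \<in> {1..c}" if "g \<in> carrier (W_E n)" "k \<in> {1..c}" for g k
    using b\<Omega>[OF closed[OF w(1)[OF that(1)] b'\<Omega>[OF that(2)]]] that(2) by (simp add: \<phi>_def)
  have \<phi>_out: "\<phi> g k = k" if "k \<notin> {1..c}" for g k using that unfolding \<phi>_def by (rule if_not_P)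
  have \<phi>_mult: "\<phi> (g \<otimes>\<^bsub>W_E n\<^esub> h) k = \<phi> g (\<phi> h k)" if g: "g \<in> carrier (W_E n)" and h: "h \<in> carrier (W_E n)" for g h k
  proof (cases "k \<in> {1..c}")
    case True
    have "\<alpha> (w h) (b' k) \<in> \<Omega>" by (rule closed[OF w(1)[OF h] b'\<Omega>[OF True]])
    then show ?thesis using \<phi>_in[OF h True] w_mult[OF g h b'\<Omega>[OF True]] True by (simp add: \<phi>_def b'b)
  next
    case False
    show ?thesis by (simp only: \<phi>_out[OF False])
  qed
  have \<phi>_one: "\<phi> \<one>\<^bsub>W_E n\<^esub> k = k" for k
    by (cases "k \<in> {1..c}") (simp_all only: \<phi>_def w_one b'\<Omega> bb' if_True if_False)
  have perm: "\<phi> g permutes {1..m}" if g: "g \<in> carrier (W_E n)" for g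
  proof (rule permutes_subset)
    have inv: "inv\<^bsub>W_E n\<^esub> g \<in> carrier (W_E n)" using g by simp
    have "\<phi> (inv\<^bsub>W_E n\<^esub> g) (\<phi> g k) = k" "\<phi> g (\<phi> (inv\<^bsub>W_E n\<^esub> g) k) = k" for k
      using \<phi>_mult[OF inv g, of k] \<phi>_mult[OF g inv, of k] g \<phi>_one by simp_all
    then have "bij_betw (\<phi> g) {1..c} {1..c}"
      using \<phi>_in[OF g] \<phi>_in[OF inv] by (intro bij_betw_byWitness[where f' = "\<phi> (inv\<^bsub>W_E n\<^esub> g)"]) auto
    then show "\<phi> g permutes {1..c}" by (rule bij_imp_permutes) (rule \<phi>_out)
    show "{1..c} \<subseteq> {1..m}" using card by (simp add: c_def)
  qed
  have "\<phi> \<in> hom (W_E n) (sym_group m)"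
    by (rule homI) (use perm \<phi>_mult in \<open>auto simp: sym_group_carrier sym_group_mult\<close>)
  moreover have "g = \<one>\<^bsub>W_E n\<^esub>" if g: "g \<in> carrier (W_E n)" and id: "\<phi> g = \<one>\<^bsub>sym_group m\<^esub>" for g
  proof -
    have fixed: "\<alpha> (w g) \<omega> = \<omega>" if \<omega>: "\<omega> \<in> \<Omega>" for \<omega>
    proof -
      have "\<phi> g (b \<omega>) = b \<omega>" using id by (simp add: sym_group_one)
      then have "b (\<alpha> (w g) \<omega>) = b \<omega>" using b\<Omega>[OF \<omega>] b'b[OF \<omega>] by (simp add: \<phi>_def)
      then show ?thesis by (rule inj_onD[OF bij_betw_imp_inj_on[OF b] _ closed[OF w(1)[OF g] \<omega>] \<omega>])
    qed
    have "T n (word (w g)) = T n (\<lambda>x. x)"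
      by (rule T_cong[OF n]) (rule faithful[OF w(1)[OF g] fixed])
    then show ?thesis using w(2)[OF g] T_one[OF n] by simp
  qed
  ultimately have "\<phi> \<in> mon (W_E n) (sym_group m)"
    using mon_iff_hom_one[OF group_W_E sym_group_is_group] by blast
  then show ?thesis by blast
qed

definition neg :: "(nat \<Rightarrow> real) \<Rightarrow> nat \<Rightarrow> real" where "neg x = (\<lambda>k. - x k)"

lemma neg_neg [simp]: "neg (neg x) = x" by (simp add: neg_def)

lemma word_neg: "word Rs (neg x) = neg (word Rs x)"
  using word_linear[of Rs "-1" x 0 x] by (simp add: neg_def)

lemma reflect_neg: "reflect R (neg x) = neg (reflect R x)"
  using reflect_linear[of R "-1" x 0 x] by (simp add: neg_def)

lemma ip_neg: "ip x (neg y) = - ip x y" "ip (neg x) y = - ip x y"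
  by (simp_all add: ip_def neg_def sum_negf)

definition roots :: "nat \<Rightarrow> (nat \<Rightarrow> real) set" where
  "roots n = rv ` root_lines n \<union> neg ` rv ` root_lines n"

lemma reflect_self: "S \<in> root_lines n \<Longrightarrow> reflect S (rv S) = neg (rv S)"
  by (simp add: reflect_def neg_def ip_rv_self fun_eq_iff)

text \<open>The multiples of a root that have the length of a root are the root and its negative.\<close>

lemma norm_two_multiple:
  assumes w: "\<And>k. w k = (c / 2) * q k" and c: "ip q w = c" and ww: "ip w w = 2"
  shows "w = q \<or> w = neg q"
proof -
  have "w = (\<lambda>k. (c / 2) * q k + 0 * q k)" by (rule ext) (simp add: w)
  then have "ip w w = ip w (\<lambda>k. (c / 2) * q k + 0 * q k)" by (rule arg_cong)
  also have "\<dots> = (c / 2) * c" unfolding ip_add ip_commute[of w] c by simp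
  finally have "c * c = 2 * 2" using ww by simp
  then have "c = 2 \<or> c = - 2" using square_eq_iff[of c 2] by simp
  then have "(\<forall>k. w k = q k) \<or> (\<forall>k. w k = - q k)"
  proof
    assume "c = 2"
    then show ?thesis using w by simp
  next
    assume "c = - 2"
    then show ?thesis using w by simp
  qed
  then show ?thesis unfolding neg_def fun_eq_iff .
qed

text \<open>By \<open>reflect_star\<close> the image of the root of \<open>S\<close> is negated by the reflection in \<open>star R S\<close>, so it is a multiple of its root.\<close>

lemma reflect_root_vector:
  assumes R: "R \<in> root_lines 8" and S: "S \<in> root_lines 8"
  shows "reflect R (rv S) = rv (star R S) \<or> reflect R (rv S) = neg (rv (star R S))"
proof -
  let ?Q = "star R S" and ?w = "reflect R (rv S)"
  let ?c = "ip (rv ?Q) ?w"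
  have Q: "?Q \<in> root_lines 8" by (rule reflect_star(1)[OF R S])
  have "reflect ?Q ?w = neg ?w" using reflect_star(2)[OF R S, of "rv S"] reflect_self[OF S] by (simp add: reflect_neg)
  then have *: "?w k - ?c * rv ?Q k = - ?w k" for k unfolding reflect_def[of ?Q] neg_def by (rule fun_cong)
  have half: "?w k = (?c / 2) * rv ?Q k" for k using *[of k] by linarith
  show ?thesis by (rule norm_two_multiple[OF half HOL.refl]) (simp add: reflect_ip[OF R] ip_rv_self[OF S])
qed

lemma reflect_roots: "n \<in> {6, 7, 8} \<Longrightarrow> R \<in> root_lines n \<Longrightarrow> x \<in> roots n \<Longrightarrow> reflect R x \<in> roots n"
proof -
  assume n: "n \<in> {6, 7, 8}" and R: "R \<in> root_lines n" and x: "x \<in> roots n"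
  have n8: "n \<le> 8" using n by auto
  have *: "reflect R (rv S) \<in> roots n \<and> neg (reflect R (rv S)) \<in> roots n" if S: "S \<in> root_lines n" for S
  proof -
    have R8: "R \<in> root_lines 8" "S \<in> root_lines 8" using R S root_lines_8_supset[OF n8] by blast+
    have m: "rv (star R S) \<in> roots n" "neg (rv (star R S)) \<in> roots n" using star_line[OF n R S] by (auto simp: roots_def)
    from reflect_root_vector[OF R8] show ?thesis
    proof
      assume e: "reflect R (rv S) = rv (star R S)"
      show ?thesis unfolding e using m by (rule conjI)
    next
      assume e: "reflect R (rv S) = neg (rv (star R S))"
      show ?thesis unfolding e neg_neg using m(2,1) by (rule conjI)
    qed
  qed
  have "(\<exists>S\<in>root_lines n. x = rv S) \<or> (\<exists>S\<in>root_lines n. x = neg (rv S))" using x by (auto simp: roots_def)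
  then show ?thesis using * by (elim disjE bexE) (simp_all add: reflect_neg)
qed

lemma finite_root_lines: "finite (root_lines n)"
  by (rule finite_subset[of _ "Pow {..<9}"]) (auto simp: root_lines_def)

text \<open>The orthogonal projection onto the vectors constant on the coordinates from \<open>n\<close> on.\<close>

definition proj :: "nat \<Rightarrow> (nat \<Rightarrow> real) \<Rightarrow> nat \<Rightarrow> real" where
  "proj n x k = (if k \<in> {n..<9} then (\<Sum>j=n..<9. x j) / (9 - real n) else x k)"

lemma proj_linear: "proj n (\<lambda>k. a * x k + b * y k) = (\<lambda>k. a * proj n x k + b * proj n y k)"
  by (simp add: proj_def fun_eq_iff sum.distrib sum_distrib_left[symmetric] add_divide_distrib)

lemma proj_neg: "proj n (neg x) = neg (proj n x)"
  using proj_linear[of n "-1" x 0 x] by (simp add: neg_def)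

lemma proj_space: 
  assumes n: "n \<in> {6, 7, 8}" and x: "x \<in> coord_space 8" shows "proj n x \<in> coord_space n"
proof -
  have s: "x 0 + x 1 + x 2 + x 3 + x 4 + x 5 + x 6 + x 7 + x 8 = 0" using coord_spaceD(2)[OF x] by (simp add: sum_nine)
  have "(\<Sum>k<9. proj n x k) = 0" using n s unfolding sum_nine by (auto simp: proj_def upto9 add_divide_distrib)
  moreover have "proj n x k = 0" if "9 \<le> k" for k using that coord_spaceD(1)[OF x] by (simp add: proj_def)
  moreover have "proj n x k = proj n x 8" if "k \<in> {n..<9}" for k
  proof -
    have "8 \<in> {n..<9}" using n by auto
    then show ?thesis using that unfolding proj_def by simp
  qed
  ultimately show ?thesis unfolding coord_space_def mem_Collect_eq by (intro conjI allI impI ballI)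
qed

lemma ip_proj:
  assumes n: "n \<in> {6, 7, 8}" and y: "y \<in> coord_space n" shows "ip y (proj n x) = ip y x"
proof -
  have c: "y k = y 8" if "n \<le> k" "k < 9" for k by (rule bspec[OF coord_spaceD(3)[OF y]]) (use that in simp)
  consider "n = 6" "y 6 = y 8" "y 7 = y 8" | "n = 7" "y 7 = y 8" | "n = 8" using n c[of 6] c[of 7] by auto
  then show ?thesis by cases (simp_all add: ip_def sum_nine proj_def upto9 field_simps)
qed

lemma proj_id: "n \<in> {6, 7, 8} \<Longrightarrow> x \<in> coord_space n \<Longrightarrow> proj n x = x"
proof
  fix k assume n: "n \<in> {6, 7, 8}" and x: "x \<in> coord_space n"
  have "(\<Sum>j=n..<9. x j) = (\<Sum>j=n..<9. x 8)" by (rule sum.cong[OF HOL.refl]) (rule bspec[OF coord_spaceD(3)[OF x]])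
  moreover have "x k = x 8" if "k \<in> {n..<9}" by (rule bspec[OF coord_spaceD(3)[OF x] that])
  ultimately show "proj n x k = x k" using n by (auto simp: proj_def)
qed

lemma reflect_proj:
  assumes n: "n \<in> {6, 7, 8}" and R: "R \<in> root_lines n"
  shows "reflect R (proj n x) = proj n (reflect R x)"
proof -
  note rvn = rv_space[OF n R]
  have "reflect R x = (\<lambda>k. 1 * x k + (- ip (rv R) x) * rv R k)" by (simp add: reflect_def fun_eq_iff)
  then have "proj n (reflect R x) = (\<lambda>k. 1 * proj n x k + (- ip (rv R) x) * proj n (rv R) k)" by (simp only: proj_linear)
  then show ?thesis unfolding proj_id[OF n rvn] by (simp add: reflect_def fun_eq_iff ip_proj[OF n rvn])
qed

text \<open>For \<open>n = 6\<close> and \<open>n = 7\<close> these are some of the weights of the minuscule representations of dimensions 27 and 56; for \<open>n = 8\<close> they are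
roots. They span the space.\<close>

definition weight :: "nat \<Rightarrow> nat \<Rightarrow> nat \<Rightarrow> real" where
  "weight n i = neg (proj n (rv {i, n}))"

lemma weight_separates:
  assumes n: "n \<in> {6, 7, 8}" and y: "y \<in> coord_space n" and orth: "\<And>i. i < n \<Longrightarrow> ip y (weight n i) = 0"
  shows "y = (\<lambda>k. 0)"
proof -
  have n9: "n < 9" using n by auto
  have low: "y i = y n" if "i < n" for i
  proof -
    have "ip y (weight n i) = - ip y (rv {i, n})" by (simp add: weight_def ip_neg ip_proj[OF n y])
    then show ?thesis using orth[OF that] ip_pair[OF that n9, of y] ip_commute[of y "rv {i, n}"] by simp
  qed
  have high: "y k = y 8" if "n \<le> k" "k < 9" for k by (rule bspec[OF coord_spaceD(3)[OF y]]) (use that in simp)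
  have all: "y k = y 8" if "k < 9" for k
    by (cases "k < n") (use low[of k] high[of n] high[of k] that n9 in simp_all)
  have "(\<Sum>k<9. y k) = (\<Sum>k<9::nat. y 8)" by (rule sum.cong[OF HOL.refl]) (rule all, simp)
  then have "y 8 = 0" using coord_spaceD(2)[OF y] by simp
  then have "y k = 0" for k using all[of k] coord_spaceD(1)[OF y] by (cases "k < 9") simp_all
  then show ?thesis by (rule ext)
qed

lemma weight_space: "n \<in> {6, 7, 8} \<Longrightarrow> i < n \<Longrightarrow> weight n i \<in> coord_space n"
proof -
  assume n: "n \<in> {6, 7, 8}" and i: "i < n"
  have "{i, n} \<in> root_lines 8" using n i by (auto simp: root_lines_8)
  then have "proj n (rv {i, n}) \<in> coord_space n" using proj_space[OF n] rv_space by simp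
  then show ?thesis using coord_space_linear[of _ n _ "-1" 0] by (simp add: weight_def neg_def)
qed

text \<open>Isometries acting as the same scalar on a spanning set are scalars.\<close>

lemma word_sign:
  assumes n: "n \<in> {6, 7, 8}" and Rs: "set Rs \<subseteq> root_lines n" and c: "c = 1 \<or> c = -1"
    and fixed: "\<And>i. i < n \<Longrightarrow> word Rs (weight n i) = (\<lambda>k. c * weight n i k)" and x: "x \<in> coord_space n"
  shows "word Rs x = (\<lambda>k. c * x k)"
proof -
  let ?y = "\<lambda>k. 1 * word Rs x k + (- c) * x k"
  have "?y = (\<lambda>k. 0)"
  proof (rule weight_separates[OF n])
    show "?y \<in> coord_space n" by (rule coord_space_linear[OF word_space[OF n Rs x] x])
    fix i assume i: "i < n"
    have "ip (weight n i) x = ip (word Rs x) (\<lambda>k. c * weight n i k + 0 * weight n i k)"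
      using word_ip[OF Rs, of "weight n i" x] fixed[OF i] by (simp add: ip_commute)
    then have 1: "ip (weight n i) x = c * ip (weight n i) (word Rs x)" unfolding ip_add by (simp add: ip_commute)
    have "ip (weight n i) ?y = ip (weight n i) (word Rs x) - c * ip (weight n i) x" unfolding ip_add by simp
    then have "ip (weight n i) ?y = 0" unfolding 1 using c by auto
    then show "ip ?y (weight n i) = 0" by (simp add: ip_commute)
  qed
  then have "?y k = 0" for k by (rule fun_cong)
  then show ?thesis by (simp add: fun_eq_iff)
qed

lemma word_closed:
  assumes "\<And>R x. R \<in> root_lines n \<Longrightarrow> x \<in> \<Omega> \<Longrightarrow> reflect R x \<in> \<Omega>" and "set Rs \<subseteq> root_lines n" "x \<in> \<Omega>"
  shows "word Rs x \<in> \<Omega>"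
  using assms(2) by (induction Rs) (simp_all add: assms(1,3))

theorem mon_of_vectors:
  assumes n: "n \<in> {6, 7, 8}" and fin: "finite \<Omega>" "card \<Omega> \<le> m" and sub: "\<Omega> \<subseteq> coord_space n"
    and closed: "\<And>R x. R \<in> root_lines n \<Longrightarrow> x \<in> \<Omega> \<Longrightarrow> reflect R x \<in> \<Omega>"
    and weights: "\<And>i. i < n \<Longrightarrow> weight n i \<in> \<Omega>"
  shows "\<exists>\<phi>. \<phi> \<in> mon (W_E n) (sym_group m)"
proof (rule mon_of_word_action[OF n fin, of word])
  show "word Rs x \<in> \<Omega>" if "set Rs \<subseteq> root_lines n" "x \<in> \<Omega>" for Rs x
    using word_closed[of n \<Omega>, OF closed] that by blast
  show "word Rs x = word Ss x" if "\<And>x. x \<in> coord_space n \<Longrightarrow> word Rs x = word Ss x" "x \<in> \<Omega>" for Rs Ss x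
    using that sub by blast
  show "word Rs x = x" if Rs: "set Rs \<subseteq> root_lines n" and f: "\<And>\<omega>. \<omega> \<in> \<Omega> \<Longrightarrow> word Rs \<omega> = \<omega>" and x: "x \<in> coord_space n" for Rs x
    using word_sign[OF n Rs, of 1 x] f[OF weights] x by simp
qed simp_all

lemma roots_space: "n \<in> {6, 7, 8} \<Longrightarrow> x \<in> roots n \<Longrightarrow> x \<in> coord_space n"
  using rv_space[of n] coord_space_linear[of _ n _ "-1" 0] by (auto simp: roots_def neg_def)

lemma card_lines: "card {R. R \<subseteq> {..<N::nat} \<and> card R = k} = N choose k"
  using n_subsets[of "{..<N}" k] by simp

lemma finite_lines: "finite {R. R \<subseteq> {..<N::nat} \<and> card R = k}"
  by (rule finite_subset[of _ "Pow {..<N}"]) auto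

lemma binomials: "(9::nat) choose 2 = 36" "(9::nat) choose 3 = 84" "(7::nat) choose 2 = 21" "(7::nat) choose 3 = 35" "(6::nat) choose 2 = 15"
  by (simp_all add: binomial_fact_lemma numeral_eq_Suc One_nat_def)

lemma finite_roots: "finite (roots n)"
  by (simp add: roots_def finite_root_lines)

lemma card_roots_8: "card (roots 8) \<le> 240"
proof -
  have "root_lines 8 = {R. R \<subseteq> {..<9} \<and> card R = 2} \<union> {R. R \<subseteq> {..<9} \<and> card R = 3}" by (auto simp: root_lines_8)
  then have "card (root_lines 8) \<le> 36 + 84"
    using card_Un_le[of "{R. R \<subseteq> {..<9::nat} \<and> card R = 2}" "{R. R \<subseteq> {..<9} \<and> card R = 3}"] unfolding card_lines binomials by simp
  moreover have "card (rv ` root_lines 8) \<le> card (root_lines 8)" "card (neg ` rv ` root_lines 8) \<le> card (rv ` root_lines 8)"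
    by (simp_all add: card_image_le finite_root_lines)
  ultimately show ?thesis using card_Un_le[of "rv ` root_lines 8" "neg ` rv ` root_lines 8"] unfolding roots_def by linarith
qed

theorem E8_upper_bound: "\<exists>\<phi>. \<phi> \<in> mon (W_E 8) (sym_group 240)"
proof (rule mon_of_vectors[OF _ finite_roots card_roots_8])
  show "roots 8 \<subseteq> coord_space 8" using roots_space[of 8] by auto
  show "reflect R x \<in> roots 8" if "R \<in> root_lines 8" "x \<in> roots 8" for R x using reflect_roots[of 8] that by simp
  show "weight 8 i \<in> roots 8" if i: "i < 8" for i
  proof -
    have "{i, 8} \<in> root_lines 8" using i by (auto simp: root_lines_8)
    then show ?thesis using proj_id[of 8] rv_space[of 8] by (simp add: weight_def roots_def)
  qed
qed simp

text \<open>The reflections of type \<open>E\<^sub>n\<close> add a common constant to the coordinates from \<open>n\<close> on, so they preserve this part of the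
root system of \<open>E8\<close>. For \<open>n = 6\<close> and \<open>n = 7\<close> its projection is the set of weights of a minuscule representation.\<close>

definition charged :: "nat \<Rightarrow> (nat \<Rightarrow> real) set" where
  "charged n = {r \<in> roots 8. r n - r 8 = 1 \<and> (\<forall>k\<in>{n + 1..<9}. r k = r 8)}"

lemma chargedD:
  assumes "r \<in> charged n"
  shows "r \<in> roots 8" and "r n - r 8 = 1" and "k \<in> {n + 1..<9} \<Longrightarrow> r k = r 8"
proof -
  have *: "r \<in> roots 8 \<and> r n - r 8 = 1 \<and> (\<forall>k\<in>{n + 1..<9}. r k = r 8)" using assms unfolding charged_def mem_Collect_eq .
  show "r \<in> roots 8" by (rule conjunct1[OF *])
  show "r n - r 8 = 1" by (rule conjunct1[OF conjunct2[OF *]])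
  show "r k = r 8" if "k \<in> {n + 1..<9}" by (rule bspec[OF conjunct2[OF conjunct2[OF *]] that])
qed

lemma reflect_charged:
  assumes n: "n \<in> {6, 7}" and R: "R \<in> root_lines n" and r: "r \<in> charged n"
  shows "reflect R r \<in> charged n"
proof -
  have n': "n \<in> {6, 7, 8}" "n \<le> 8" using n by auto
  have R8: "R \<in> root_lines 8" using R root_lines_8_supset[OF n'(2)] by blast
  have c: "rv R k = rv R 8" if "k \<in> {n..<9}" for k by (rule bspec[OF coord_spaceD(3)[OF rv_space[OF n'(1) R]] that])
  note 1 = chargedD(2)[OF r] and 2 = chargedD(3)[OF r]
  have "reflect R r \<in> roots 8" by (rule reflect_roots[OF _ R8 chargedD(1)[OF r]]) simp
  moreover have "reflect R r n - reflect R r 8 = 1" using 1 c[of n] n'(2) by (simp add: reflect_def)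
  moreover have "reflect R r k = reflect R r 8" if "k \<in> {n + 1..<9}" for k
    using 2[OF that] c[of k] that by (simp add: reflect_def)
  ultimately show ?thesis unfolding charged_def mem_Collect_eq by (intro conjI ballI)
qed

lemma root_cases:
  assumes "r \<in> roots 8"
  obtains (pair) i j where "i < j" "j < 9" "r = rv {i, j}" | (minus_pair) i j where "i < j" "j < 9" "r = neg (rv {i, j})"
    | (triple) S where "card S = 3" "S \<subseteq> {..<9}" "r = rv S" | (minus_triple) S where "card S = 3" "S \<subseteq> {..<9}" "r = neg (rv S)"
proof -
  obtain S where S: "S \<in> root_lines 8" "r = rv S \<or> r = neg (rv S)" using assms by (auto simp: roots_def)
  show thesis using S(1)
  proof (cases rule: line_cases)
    case (1 i j) then show thesis using S(2) pair[OF 1(1,2)] minus_pair[OF 1(1,2)] by metis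
  next
    case 2 then show thesis using S(2) triple[OF 2] minus_triple[OF 2] by metis
  qed
qed

lemma rv_triple: "card S = 3 \<Longrightarrow> k < 9 \<Longrightarrow> rv S k = (if k \<in> S then 2/3 else -1/3)"
  by (simp add: rv_def)

lemma charged_6:
  "charged 6 \<subseteq> (\<lambda>i. neg (rv {i, 6})) ` {..<6} \<union> (\<lambda>P. rv (insert 6 P)) ` {P. P \<subseteq> {..<6} \<and> card P = 2}
     \<union> (\<lambda>i. neg (rv {i, 7, 8})) ` {..<6}" (is "_ \<subseteq> ?A \<union> ?B \<union> ?C")
proof
  fix r assume r: "r \<in> charged 6"
  have root: "r \<in> roots 8" and 6: "r 6 - r 8 = 1" and 7: "r 7 = r 8" using chargedD(1,2)[OF r] chargedD(3)[OF r, of 7] by simp_all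
  from root show "r \<in> ?A \<union> ?B \<union> ?C"
  proof (cases rule: root_cases)
    case (pair i j)
    have False using 6 7 pair(1,2) unfolding pair(3) rv_pair[OF pair(1)] by (auto split: if_splits)
    then show ?thesis ..
  next
    case (minus_pair i j)
    have "j = 6" using 6 7 minus_pair(1,2) unfolding minus_pair(3) neg_def rv_pair[OF minus_pair(1)] by (auto split: if_splits)
    then have "r \<in> ?A" using minus_pair by simp
    then show ?thesis by simp
  next
    case (triple S)
    have *: "6 \<in> S" "7 \<notin> S" "8 \<notin> S" using 6 7 unfolding triple(3) by (simp_all add: rv_triple[OF triple(1)] split: if_splits)
    have "finite S" using triple(2) finite_subset by blast
    then have c: "card (S - {6}) = 2" using triple(1) *(1) by simp
    have "S - {6} \<subseteq> {..<6}"
    proof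
      fix k assume k: "k \<in> S - {6}"
      then have "k < 9" "k \<noteq> 6" "k \<noteq> 7" "k \<noteq> 8" using triple(2) * by auto
      then show "k \<in> {..<6}" by simp
    qed
    then have "S - {6} \<in> {P. P \<subseteq> {..<6} \<and> card P = 2}" using c by simp
    then have "rv (insert 6 (S - {6})) \<in> ?B" by (rule imageI)
    then have "r \<in> ?B" unfolding triple(3) insert_Diff[OF *(1)] .
    then show ?thesis by simp
  next
    case (minus_triple S)
    have *: "6 \<notin> S" "7 \<in> S" "8 \<in> S"
      using 6 7 unfolding minus_triple(3) neg_def by (simp_all add: rv_triple[OF minus_triple(1)] split: if_splits)
    have "finite S" using minus_triple(2) finite_subset by blast
    then have "card (S - {7, 8}) = 1" using minus_triple(1) *(2,3) by (simp add: card_Diff_insert card_Diff_singleton)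
    then obtain i where i: "S - {7, 8} = {i}" by (rule card_1_singletonE)
    have "i \<in> S" "i \<noteq> 7" "i \<noteq> 8" using i by auto
    then have "i < 9" "i \<noteq> 6" using minus_triple(2) *(1) by auto
    then have "i < 6" using \<open>i \<noteq> 7\<close> \<open>i \<noteq> 8\<close> by simp
    moreover have "S = {i, 7, 8}" using i *(2,3) by blast
    ultimately have "r \<in> ?C" unfolding minus_triple(3) by simp
    then show ?thesis by simp
  qed
qed

lemma card_image_bound: "finite A \<Longrightarrow> card A \<le> k \<Longrightarrow> card (f ` A) \<le> k"
  using card_image_le[of A f] by simp

lemma card_charged_6: "finite (charged 6)" "card (charged 6) \<le> 27"
proof -
  let ?A = "(\<lambda>i. neg (rv {i, 6})) ` {..<6}" and ?B = "(\<lambda>P. rv (insert 6 P)) ` {P. P \<subseteq> {..<6::nat} \<and> card P = 2}"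
    and ?C = "(\<lambda>i. neg (rv {i, 7, 8})) ` {..<6}"
  show "finite (charged 6)" using finite_roots[of 8] by (simp add: charged_def)
  have "card ?A \<le> 6" "card ?B \<le> 15" "card ?C \<le> 6"
    by (rule card_image_bound; simp add: finite_lines card_lines binomials)+
  then have "card (?A \<union> ?B \<union> ?C) \<le> 27" using card_Un_le[of "?A \<union> ?B" ?C] card_Un_le[of ?A ?B] by linarith
  moreover have "finite (?A \<union> ?B \<union> ?C)" by (simp add: finite_lines)
  ultimately show "card (charged 6) \<le> 27" using card_mono[OF _ charged_6] by linarith
qed

lemma weight_charged: "n \<in> {6, 7} \<Longrightarrow> i < n \<Longrightarrow> neg (rv {i, n}) \<in> charged n"
proof -
  assume n: "n \<in> {6, 7}" and i: "i < n"
  have "{i, n} \<in> root_lines 8" using n i by (auto simp: root_lines_8)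
  then have "neg (rv {i, n}) \<in> roots 8" by (auto simp: roots_def)
  then show ?thesis using n i by (auto simp: charged_def neg_def rv_pair)
qed

text \<open>The action on the 27 weights \<open>-e\<^sub>i + \<dots>\<close> (six), \<open>e\<^sub>i + e\<^sub>j + \<dots>\<close> (fifteen) and \<open>-e\<^sub>i + \<dots>\<close> (six), where the dots are multiples of
constant vectors on \<open>{..<9}\<close> and on \<open>{6..<9}\<close>.\<close>

theorem E6_upper_bound: "\<exists>\<phi>. \<phi> \<in> mon (W_E 6) (sym_group 27)"
proof (rule mon_of_vectors)
  show "finite (proj 6 ` charged 6)" using card_charged_6(1) by simp
  show "card (proj 6 ` charged 6) \<le> 27" by (rule card_image_bound[OF card_charged_6])
  show "proj 6 ` charged 6 \<subseteq> coord_space 6"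
    using proj_space[of 6] roots_space[of 8] by (auto simp: charged_def)
  show "reflect R x \<in> proj 6 ` charged 6" if R: "R \<in> root_lines 6" and x: "x \<in> proj 6 ` charged 6" for R x
    using x reflect_proj[of 6 R] reflect_charged[of 6 R] R by auto
  show "weight 6 i \<in> proj 6 ` charged 6" if "i < 6" for i
    using weight_charged[of 6 i] that by (simp add: weight_def proj_neg[symmetric])
qed simp

lemma charged_7:
  "charged 7 \<subseteq> rv ` (\<lambda>i. {i, 8}) ` {..<7} \<union> neg ` rv ` (\<lambda>i. {i, 7}) ` {..<7}
     \<union> rv ` insert 7 ` {P. P \<subseteq> {..<7} \<and> card P = 2} \<union> neg ` rv ` insert 8 ` {P. P \<subseteq> {..<7} \<and> card P = 2}"
  (is "_ \<subseteq> ?A \<union> ?B \<union> ?C \<union> ?D")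
proof
  fix r assume r: "r \<in> charged 7"
  have root: "r \<in> roots 8" and 7: "r 7 - r 8 = 1" using chargedD(1,2)[OF r] .
  have rest: "S \<in> insert a ` {P. P \<subseteq> {..<7} \<and> card P = 2}"
    if S: "card S = 3" "S \<subseteq> {..<9}" and ab: "a \<in> S" "b \<notin> S" "{a, b} = {7, 8 :: nat}" for S a b
  proof -
    have "finite S" using S(2) finite_subset by blast
    then have c: "card (S - {a}) = 2" using S(1) ab(1) by simp
    have "k < 7" if "k \<in> S - {a}" for k
    proof -
      have "k < 9" "k \<notin> {a, b}" using that S(2) ab(2) by auto
      then show ?thesis unfolding ab(3) by simp
    qed
    then have "S - {a} \<in> {P. P \<subseteq> {..<7} \<and> card P = 2}" using c by auto
    then have "insert a (S - {a}) \<in> insert a ` {P. P \<subseteq> {..<7} \<and> card P = 2}" by (rule imageI)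
    then show ?thesis unfolding insert_Diff[OF ab(1)] .
  qed
  from root show "r \<in> ?A \<union> ?B \<union> ?C \<union> ?D"
  proof (cases rule: root_cases)
    case (pair i j)
    have "j = 8 \<and> i < 7" using 7 pair(1,2) unfolding pair(3) rv_pair[OF pair(1)] by (auto split: if_splits)
    then have "r \<in> ?A" using pair by simp
    then show ?thesis by simp
  next
    case (minus_pair i j)
    have "j = 7" using 7 minus_pair(1,2) unfolding minus_pair(3) neg_def rv_pair[OF minus_pair(1)] by (auto split: if_splits)
    then have "r \<in> ?B" using minus_pair by simp
    then show ?thesis by simp
  next
    case (triple S)
    have *: "7 \<in> S" "8 \<notin> S" using 7 unfolding triple(3) by (simp_all add: rv_triple[OF triple(1)] split: if_splits)
    have "r \<in> ?C" unfolding triple(3) by (intro imageI rest[OF triple(1,2) *]) simp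
    then show ?thesis by simp
  next
    case (minus_triple S)
    have *: "8 \<in> S" "7 \<notin> S"
      using 7 unfolding minus_triple(3) neg_def by (simp_all add: rv_triple[OF minus_triple(1)] split: if_splits)
    have "r \<in> ?D" unfolding minus_triple(3) by (intro imageI rest[OF minus_triple(1,2) *]) (rule insert_commute)
    then show ?thesis by simp
  qed
qed

text \<open>The 56 weights of \<open>E7\<close> form 28 pairs of opposite vectors. On these the group acts with kernel \<open>{1, -1}\<close>.\<close>

definition weight_lines :: "(nat \<Rightarrow> real) set set" where
  "weight_lines = (\<lambda>r. {proj 7 r, neg (proj 7 r)}) ` charged 7"

lemma proj_7_swap:
  "i < 7 \<Longrightarrow> proj 7 (rv {i, 7}) = proj 7 (rv {i, 8})"
  "P \<subseteq> {..<7} \<Longrightarrow> card P = 2 \<Longrightarrow> proj 7 (rv (insert 8 P)) = proj 7 (rv (insert 7 P))"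
proof -
  have *: "proj 7 (x \<circ> transpose 7 8) = proj 7 x" for x
    by (auto simp: proj_def upto9 fun_eq_iff transpose_def)
  show "proj 7 (rv {i, 7}) = proj 7 (rv {i, 8})" if "i < 7"
  proof -
    have "rv {i, 7} = rv {i, 8} \<circ> transpose 7 8" using that by (auto simp: rv_pair fun_eq_iff transpose_def)
    then show ?thesis by (simp add: *)
  qed
  show "proj 7 (rv (insert 8 P)) = proj 7 (rv (insert 7 P))" if P: "P \<subseteq> {..<7}" "card P = 2"
  proof -
    have "finite P" using P(1) finite_subset by blast
    moreover have no: "7 \<notin> P" "8 \<notin> P" using P(1) by auto
    ultimately have "card (insert 7 P) = 3" "card (insert 8 P) = 3" using P(2) by simp_all
    then have "rv (insert 8 P) = rv (insert 7 P) \<circ> transpose 7 8"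
      using no by (auto simp: rv_def fun_eq_iff transpose_def)
    then show ?thesis by (simp add: *)
  qed
qed

lemma card_weight_lines: "card weight_lines \<le> 28"
proof -
  let ?l = "\<lambda>r. {proj 7 r, neg (proj 7 r)}"
  let ?A = "rv ` (\<lambda>i. {i, 8}) ` {..<7}" and ?C = "rv ` insert 7 ` {P. P \<subseteq> {..<7::nat} \<and> card P = 2}"
  have l_neg: "?l (neg r) = ?l r" for r by (simp add: proj_neg insert_commute)
  have "?l r \<in> ?l ` ?A \<union> ?l ` ?C" if r: "r \<in> charged 7" for r
  proof -
    from subsetD[OF charged_7 r] consider "r \<in> ?A" | i where "i < 7" "r = neg (rv {i, 7})" | "r \<in> ?C"
      | P where "P \<subseteq> {..<7}" "card P = 2" "r = neg (rv (insert 8 P))" by auto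
    then show ?thesis
    proof cases
      case 2
      have "?l r = ?l (rv {i, 8})" unfolding 2(2) l_neg proj_7_swap(1)[OF 2(1)] ..
      then show ?thesis using 2(1) by simp
    next
      case 4
      have "?l r = ?l (rv (insert 7 P))" unfolding 4(3) l_neg proj_7_swap(2)[OF 4(1,2)] ..
      moreover have "?l (rv (insert 7 P)) \<in> ?l ` ?C" using 4(1,2) by (intro imageI) simp
      ultimately show ?thesis by simp
    qed (rule UnI1, erule imageI, rule UnI2, erule imageI)
  qed
  then have "weight_lines \<subseteq> ?l ` ?A \<union> ?l ` ?C" unfolding weight_lines_def by (rule image_subsetI)
  moreover have fin: "finite ?A" "finite ?C" by (simp_all add: finite_lines)
  moreover have "card ?A \<le> 7" "card ?C \<le> 21"
    by (rule card_image_bound, simp add: finite_lines, rule card_image_bound; simp add: finite_lines card_lines binomials)+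
  then have "card (?l ` ?A) \<le> 7" "card (?l ` ?C) \<le> 21" using fin card_image_bound by blast+
  then have "card (?l ` ?A \<union> ?l ` ?C) \<le> 28" using card_Un_le[of "?l ` ?A" "?l ` ?C"] by linarith
  ultimately show ?thesis using card_mono[of "?l ` ?A \<union> ?l ` ?C" weight_lines] fin by simp
qed

definition chosen_roots :: "(nat \<Rightarrow> real) set" where
  "chosen_roots = rv ` root_lines 7"

definition root_sign :: "(nat \<Rightarrow> real) \<Rightarrow> int" where
  "root_sign x = (if x \<in> chosen_roots then 1 else -1)"

text \<open>The parity of the number of chosen roots that are mapped to opposites of chosen roots.\<close>

definition sign_character :: "nat set list \<Rightarrow> int" where
  "sign_character Rs = (\<Prod>x\<in>chosen_roots. root_sign (word Rs x))"

lemma rv_inject: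
  assumes "R \<in> root_lines n" "S \<in> root_lines n" "rv R = rv S" shows "R = S"
proof -
  have *: "{k. k < 9 \<and> rv R k \<noteq> 0 \<and> rv R k \<noteq> -1/3} = R" if "R \<in> root_lines n" for R
    using that
  proof (cases rule: line_cases)
    case (1 i j)
    then show ?thesis by (auto simp: rv_pair)
  next
    case 2
    then show ?thesis by (auto simp: rv_triple split: if_splits)
  qed
  show ?thesis using *[OF assms(1)] *[OF assms(2)] unfolding assms(3) by (rule trans[OF sym])
qed

lemma rv_not_neg:
  assumes R: "R \<in> root_lines n" and S: "S \<in> root_lines n" shows "rv R \<noteq> neg (rv S)"
proof
  assume "rv R = neg (rv S)"
  then have e: "rv R k = - rv S k" for k unfolding neg_def by (rule fun_cong)
  have no: False if T: "card T = 3" "T \<subseteq> {..<9}" and e: "\<And>k. rv T k = - rv U k" and U: "U \<in> root_lines n" for T U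
  proof -
    obtain k where k: "k \<in> T" using T(1) by fastforce
    have "rv U k = - (2/3)" using e[of k] k T by (auto simp: rv_triple)
    then show False using U
    proof (cases rule: line_cases[OF U])
      case (1 i j) then show False using \<open>rv U k = - (2/3)\<close> by (simp add: rv_pair split: if_splits)
    next
      case 2 then show False using \<open>rv U k = - (2/3)\<close> by (simp add: rv_def split: if_splits)
    qed
  qed
  have e': "rv S k = - rv R k" for k using e[of k] by linarith
  show False using R
  proof (cases rule: line_cases)
    case ij: (1 i j)
    show False using S
    proof (cases rule: line_cases)
      case (1 a b)
      have "b = i" using e[of i] ij(1) unfolding ij(3) 1(3) rv_pair[OF ij(1)] rv_pair[OF 1(1)] by (simp split: if_splits)
      moreover have "a = j" using e[of j] ij(1) unfolding ij(3) 1(3) rv_pair[OF ij(1)] rv_pair[OF 1(1)] by (simp split: if_splits)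
      ultimately show False using ij(1) 1(1) by simp
    qed (rule no[OF _ _ e' R])
  qed (rule no[OF _ _ e S])
qed

lemma roots_7: "roots 7 = chosen_roots \<union> neg ` chosen_roots"
  by (simp add: roots_def chosen_roots_def)

lemma root_sign_neg: "x \<in> roots 7 \<Longrightarrow> root_sign (neg x) = - root_sign x"
proof -
  have *: "neg y \<notin> chosen_roots" if "y \<in> chosen_roots" for y
  proof
    assume "neg y \<in> chosen_roots"
    then obtain R where R: "R \<in> root_lines 7" "neg y = rv R" by (auto simp: chosen_roots_def)
    obtain S where S: "S \<in> root_lines 7" "y = rv S" using \<open>y \<in> chosen_roots\<close> by (auto simp: chosen_roots_def)
    show False using rv_not_neg[OF R(1) S(1)] R(2) S(2) by simp
  qed
  assume "x \<in> roots 7"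
  then have "x \<in> chosen_roots \<or> (\<exists>y\<in>chosen_roots. x = neg y)" by (auto simp: roots_7)
  then show ?thesis
  proof
    assume x: "x \<in> chosen_roots"
    show ?thesis using x *[OF x] by (simp add: root_sign_def)
  next
    assume "\<exists>y\<in>chosen_roots. x = neg y"
    then obtain y where y: "y \<in> chosen_roots" "x = neg y" by (rule bexE)
    show ?thesis unfolding y(2) neg_neg using y(1) *[OF y(1)] by (simp add: root_sign_def)
  qed
qed

lemma word_root: "set Rs \<subseteq> root_lines 7 \<Longrightarrow> x \<in> roots 7 \<Longrightarrow> word Rs x \<in> roots 7"
  by (rule word_closed[of 7]) (rule reflect_roots, simp_all)

lemma word_rev: "set Rs \<subseteq> root_lines n \<Longrightarrow> word (rev Rs) (word Rs x) = x"
  by (induction Rs) (auto simp: reflect_reflect)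

lemma finite_chosen: "finite chosen_roots"
  by (simp add: chosen_roots_def finite_root_lines)

text \<open>The chosen root on the line of \<open>x\<close>.\<close>

definition upright :: "(nat \<Rightarrow> real) \<Rightarrow> nat \<Rightarrow> real" where
  "upright x = (if x \<in> chosen_roots then x else neg x)"

lemma upright: "x \<in> roots 7 \<Longrightarrow> upright x \<in> chosen_roots"
  unfolding roots_7 upright_def by auto

lemma upright_bij:
  assumes Rs: "set Rs \<subseteq> root_lines 7"
  shows "bij_betw (\<lambda>x. upright (word Rs x)) chosen_roots chosen_roots"
proof -
  have pos: "x \<in> roots 7" if "x \<in> chosen_roots" for x using that by (simp add: roots_7)
  have inj: "inj_on (\<lambda>x. upright (word Rs x)) chosen_roots"
  proof (rule inj_onI)
    fix x y assume x: "x \<in> chosen_roots" and y: "y \<in> chosen_roots" and "upright (word Rs x) = upright (word Rs y)"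
    then have "word Rs x = word Rs y \<or> word Rs x = word Rs (neg y)"
      unfolding upright_def word_neg by (metis neg_neg)
    then have "x = y \<or> x = neg y" using word_rev[OF Rs] by metis
    moreover have "x \<noteq> neg y" using rv_not_neg x y by (auto simp: chosen_roots_def)
    ultimately show "x = y" by blast
  qed
  have into: "(\<lambda>x. upright (word Rs x)) ` chosen_roots \<subseteq> chosen_roots"
    by (rule image_subsetI) (rule upright[OF word_root[OF Rs pos]])
  show ?thesis using inj endo_inj_surj[OF finite_chosen into inj] by (rule bij_betw_imageI)
qed

text \<open>Multiplicativity: \<open>Ss\<close> permutes the chosen roots up to sign, and each sign that it creates is passed on by the linear map \<open>Rs\<close>.\<close>

lemma sign_character_append:
  assumes Rs: "set Rs \<subseteq> root_lines 7" and Ss: "set Ss \<subseteq> root_lines 7"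
  shows "sign_character (Rs @ Ss) = sign_character Rs * sign_character Ss"
proof -
  have "root_sign (word (Rs @ Ss) x) = root_sign (word Ss x) * root_sign (word Rs (upright (word Ss x)))"
    if x: "x \<in> chosen_roots" for x
  proof (cases "word Ss x \<in> chosen_roots")
    case True
    then show ?thesis by (simp add: upright_def root_sign_def)
  next
    case False
    have "word Rs (word Ss x) \<in> roots 7" using x by (intro word_root Rs Ss) (simp add: roots_7)
    from root_sign_neg[OF this] show ?thesis using False by (simp add: upright_def word_neg root_sign_def[of "word Ss x"])
  qed
  then have "sign_character (Rs @ Ss)
      = sign_character Ss * (\<Prod>x\<in>chosen_roots. root_sign (word Rs (upright (word Ss x))))"
    unfolding sign_character_def prod.distrib[symmetric] by (intro prod.cong) auto
  also have "(\<Prod>x\<in>chosen_roots. root_sign (word Rs (upright (word Ss x)))) = sign_character Rs"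
    unfolding sign_character_def by (rule prod.reindex_bij_betw[OF upright_bij[OF Ss]])
  finally show ?thesis by (simp add: mult.commute)
qed

lemma sign_character_cases: "sign_character Rs = 1 \<or> sign_character Rs = -1"
proof -
  have "sign_character Rs * sign_character Rs = 1"
    unfolding sign_character_def prod.distrib[symmetric] by (rule prod.neutral) (simp add: root_sign_def)
  then show ?thesis using square_eq_1_iff by blast
qed

lemma sign_character_Nil: "sign_character [] = 1"
  by (simp add: sign_character_def root_sign_def)

lemma card_root_lines_7: "card (root_lines 7) = 63"
proof -
  let ?A = "{R. R \<subseteq> {..<7::nat} \<and> card R = 2}" and ?B = "{R. R \<subseteq> {..<7::nat} \<and> card R = 3}"
    and ?C = "(\<lambda>i. {i, 7, 8 :: nat}) ` {..<7}"
  have "root_lines 7 \<subseteq> ?A \<union> ?B \<union> ?C"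
  proof
    fix R assume R: "R \<in> root_lines 7"
    then have sub: "R \<subseteq> {..<9}" and c: "card R = 2 \<or> card R = 3"
      and or: "R \<inter> {7, 8} = {} \<or> {7, 8} \<subseteq> R \<and> card R = 3" by (auto simp: lines_eval)
    from or show "R \<in> ?A \<union> ?B \<union> ?C"
    proof
      assume av: "R \<inter> {7, 8} = {}"
      have "R \<subseteq> {..<7}"
      proof
        fix k assume "k \<in> R"
        then have "k < 9" "k \<noteq> 7" "k \<noteq> 8" using sub av by auto
        then show "k \<in> {..<7}" by simp
      qed
      then show ?thesis using c by simp
    next
      assume *: "{7, 8} \<subseteq> R \<and> card R = 3"
      have "card (R - {7, 8}) = 1" using * card_Diff_subset[of "{7, 8}" R] by simp
      then obtain i where i: "R - {7, 8} = {i}" by (rule card_1_singletonE)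
      have "i \<in> R" "i \<noteq> 7" "i \<noteq> 8" using i by auto
      then have "i < 7" using sub by force
      moreover have "R = {i, 7, 8}" using i * by blast
      ultimately show ?thesis by simp
    qed
  qed
  moreover have "?A \<union> ?B \<union> ?C \<subseteq> root_lines 7" by (auto simp: low_line lines_eval)
  ultimately have e: "root_lines 7 = ?A \<union> ?B \<union> ?C" by (rule subset_antisym)
  have "inj_on (\<lambda>i. {i, 7, 8 :: nat}) {..<7}"
  proof (rule inj_onI)
    fix i j :: nat assume "i \<in> {..<7}" "j \<in> {..<7}" and e: "{i, 7, 8} = {j, 7, 8}"
    then have "i \<noteq> 7" "i \<noteq> 8" by auto
    moreover have "i \<in> {j, 7, 8}" unfolding e[symmetric] by simp
    ultimately show "i = j" by simp
  qed
  then have "card ?C = 7" by (simp add: card_image)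
  moreover have "(?A \<union> ?B) \<inter> ?C = {}" by auto
  moreover have "card (?A \<union> ?B) = 21 + 35"
    by (subst card_Un_disjoint) (auto simp: finite_lines card_lines binomials)
  ultimately show ?thesis unfolding e by (subst card_Un_disjoint) (simp_all add: finite_lines)
qed

text \<open>All of the \<open>63\<close> signs change, and this number is odd.\<close>

lemma sign_character_minus:
  assumes "\<And>x. x \<in> coord_space 7 \<Longrightarrow> word Rs x = neg x"
  shows "sign_character Rs = -1"
proof -
  have "root_sign (word Rs x) = -1" if x: "x \<in> chosen_roots" for x
  proof -
    have r: "x \<in> roots 7" using x by (simp add: roots_7)
    have "word Rs x = neg x" using assms roots_space[OF _ r] by simp
    then show ?thesis using root_sign_neg[OF r] x by (simp add: root_sign_def[of x])
  qed
  then have "sign_character Rs = (\<Prod>x\<in>chosen_roots. -1)" unfolding sign_character_def by (rule prod.cong[OF HOL.refl])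
  also have "\<dots> = (-1) ^ card chosen_roots" by simp
  also have "card chosen_roots = 63"
    unfolding chosen_roots_def card_root_lines_7[symmetric] by (rule card_image, rule inj_onI, rule rv_inject)
  finally show ?thesis by simp
qed

lemma weights_not_orthogonal: "i < 7 \<Longrightarrow> 0 < ip (weight 7 0) (weight 7 i)"
proof -
  assume i: "i < 7"
  have "ip (weight 7 0) (weight 7 i) = - ip (rv {i, 7}) (weight 7 0)"
    unfolding weight_def[of 7 i] ip_neg ip_proj[of 7 "weight 7 0", OF _ weight_space[of 7 0], simplified] by (simp add: ip_commute)
  also have "\<dots> = weight 7 0 7 - weight 7 0 i" using ip_pair[of i 7] i by simp
  finally show ?thesis using i by (simp add: weight_def neg_def proj_def upto9 rv_pair)
qed

lemma weight_line: "i < 7 \<Longrightarrow> {weight 7 i, neg (weight 7 i)} \<in> weight_lines"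
proof -
  assume i: "i < 7"
  have "neg (rv {i, 7}) \<in> charged 7" using weight_charged[of 7 i] i by simp
  then have "{proj 7 (neg (rv {i, 7})), neg (proj 7 (neg (rv {i, 7})))} \<in> weight_lines" unfolding weight_lines_def by (rule imageI)
  then show ?thesis unfolding weight_def proj_neg .
qed

lemma weight_lines_closed:
  assumes R: "R \<in> root_lines 7" and L: "L \<in> weight_lines" shows "reflect R ` L \<in> weight_lines"
proof -
  obtain r where r: "r \<in> charged 7" "L = {proj 7 r, neg (proj 7 r)}" using L by (auto simp: weight_lines_def)
  have "reflect R ` L = {proj 7 (reflect R r), neg (proj 7 (reflect R r))}"
    using reflect_proj[of 7 R r] R by (simp add: r(2) reflect_neg)
  then show ?thesis using reflect_charged[of 7 R r] R r(1) by (simp add: weight_lines_def)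
qed

text \<open>Two further points, exchanged according to the sign character, make the action on the \<open>28\<close> lines of weights faithful. An element
fixing all lines acts on every weight by a sign, and by the same sign on the spanning weights, none of which is orthogonal to the first; so it is \<open>1\<close>
or \<open>-1\<close>, and the sign character distinguishes the two.\<close>

theorem E7_upper_bound: "\<exists>\<phi>. \<phi> \<in> mon (W_E 7) (sym_group 30)"
proof -
  define \<Omega> :: "((nat \<Rightarrow> real) set + bool) set" where "\<Omega> = Inl ` weight_lines \<union> range Inr"
  define \<alpha> :: "nat set list \<Rightarrow> (nat \<Rightarrow> real) set + bool \<Rightarrow> (nat \<Rightarrow> real) set + bool"
    where "\<alpha> Rs = map_sum (image (word Rs)) (\<lambda>b. b \<noteq> (sign_character Rs = -1))" for Rs
  have fin: "finite weight_lines" using finite_roots[of 8] by (simp add: weight_lines_def charged_def)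
  have cases: "(\<exists>L\<in>weight_lines. \<omega> = Inl L) \<or> (\<exists>b. \<omega> = Inr b)" if "\<omega> \<in> \<Omega>" for \<omega> using that by (auto simp: \<Omega>_def)
  show ?thesis
  proof (rule mon_of_word_action[of 7 \<Omega> 30 \<alpha>])
    show "finite \<Omega>" using fin by (simp add: \<Omega>_def)
    have "card (Inl ` weight_lines :: ((nat \<Rightarrow> real) set + bool) set) \<le> 28" by (rule card_image_bound[OF fin card_weight_lines])
    moreover have "card (range Inr :: ((nat \<Rightarrow> real) set + bool) set) \<le> 2" by (rule card_image_bound) simp_all
    ultimately show "card \<Omega> \<le> 30"
      using card_Un_le[of "Inl ` weight_lines" "range Inr :: ((nat \<Rightarrow> real) set + bool) set"] unfolding \<Omega>_def by linarith
    show "\<alpha> Rs \<omega> \<in> \<Omega>" if Rs: "set Rs \<subseteq> root_lines 7" and \<omega>: "\<omega> \<in> \<Omega>" for Rs \<omega>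
      using cases[OF \<omega>]
    proof
      assume "\<exists>L\<in>weight_lines. \<omega> = Inl L"
      then obtain L where L: "L \<in> weight_lines" "\<omega> = Inl L" by (rule bexE)
      have "word Rs ` L \<in> weight_lines" using Rs
      proof (induction Rs)
        case (Cons R Rs)
        then have "reflect R ` word Rs ` L \<in> weight_lines" by (intro weight_lines_closed) simp_all
        then show ?case by (simp add: image_image)
      qed (simp add: L(1))
      then show ?thesis by (simp add: L(2) \<alpha>_def \<Omega>_def)
    next
      assume "\<exists>b. \<omega> = Inr b"
      then show ?thesis by (auto simp: \<alpha>_def \<Omega>_def)
    qed
    show "\<alpha> [] \<omega> = \<omega>" if \<omega>: "\<omega> \<in> \<Omega>" for \<omega>
      using cases[OF \<omega>] by (elim disjE bexE exE) (simp_all add: \<alpha>_def sign_character_Nil)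
    show "\<alpha> (Rs @ Ss) \<omega> = \<alpha> Rs (\<alpha> Ss \<omega>)"
      if Rs: "set Rs \<subseteq> root_lines 7" and Ss: "set Ss \<subseteq> root_lines 7" and \<omega>: "\<omega> \<in> \<Omega>" for Rs Ss \<omega>
    proof -
      have "(sign_character (Rs @ Ss) = -1) = ((sign_character Rs = -1) \<noteq> (sign_character Ss = -1))"
        using sign_character_cases[of Rs] sign_character_cases[of Ss] unfolding sign_character_append[OF Rs Ss] by auto
      then show ?thesis using cases[OF \<omega>] by (elim disjE bexE exE) (auto simp: \<alpha>_def image_image)
    qed
    show "\<alpha> Rs \<omega> = \<alpha> Ss \<omega>" if e: "\<And>x. x \<in> coord_space 7 \<Longrightarrow> word Rs x = word Ss x" and \<omega>: "\<omega> \<in> \<Omega>" for Rs Ss \<omega>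
    proof -
      have "word Rs x = word Ss x" if "x \<in> chosen_roots" for x
        by (rule e) (use roots_space[of 7 x] that in \<open>simp add: roots_7\<close>)
      then have "sign_character Rs = sign_character Ss" unfolding sign_character_def by (intro prod.cong) simp_all
      moreover have "word Rs ` L = word Ss ` L" if "L \<in> weight_lines" for L
      proof (rule image_cong[OF HOL.refl e])
        fix x assume x: "x \<in> L"
        obtain r where r: "r \<in> charged 7" "L = {proj 7 r, neg (proj 7 r)}" using \<open>L \<in> weight_lines\<close> unfolding weight_lines_def by (rule imageE)
        have p: "proj 7 r \<in> coord_space 7" using proj_space[of 7 r] roots_space[OF _ chargedD(1)[OF r(1)]] by simp
        then have "neg (proj 7 r) \<in> coord_space 7" using coord_space_linear[OF p p, of "-1" 0] by (simp add: neg_def)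
        then show "x \<in> coord_space 7" using x p r(2) by auto
      qed
      ultimately show ?thesis using cases[OF \<omega>] by (elim disjE bexE exE) (simp_all add: \<alpha>_def)
    qed
    show "word Rs x = x" if Rs: "set Rs \<subseteq> root_lines 7" and fixed: "\<And>\<omega>. \<omega> \<in> \<Omega> \<Longrightarrow> \<alpha> Rs \<omega> = \<omega>"
      and x: "x \<in> coord_space 7" for Rs x
    proof -
      have sgn: "sign_character Rs \<noteq> -1" using fixed[of "Inr True"] by (simp add: \<alpha>_def \<Omega>_def)
      have "\<exists>c. (c = 1 \<or> c = -1) \<and> word Rs (weight 7 i) = (\<lambda>k. c * weight 7 i k)" if "i < 7" for i
      proof -
        have "word Rs ` {weight 7 i, neg (weight 7 i)} = {weight 7 i, neg (weight 7 i)}"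
          using fixed[of "Inl {weight 7 i, neg (weight 7 i)}"] weight_line[OF that] by (simp add: \<alpha>_def \<Omega>_def)
        then have "word Rs (weight 7 i) \<in> {weight 7 i, neg (weight 7 i)}" by (metis imageI insertI1)
        then have "word Rs (weight 7 i) = (\<lambda>k. 1 * weight 7 i k) \<or> word Rs (weight 7 i) = (\<lambda>k. (-1) * weight 7 i k)"
          by (simp add: neg_def)
        then show ?thesis by blast
      qed
      then obtain c where c: "c i = 1 \<or> c i = -1" "word Rs (weight 7 i) = (\<lambda>k. c i * weight 7 i k)" if "i < 7" for i
        by metis
      have same: "c i = c 0" if i: "i < 7" for i
      proof -
        have "ip (weight 7 0) (weight 7 i) = ip (\<lambda>k. c 0 * weight 7 0 k) (\<lambda>k. c i * weight 7 i k)"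
          using word_ip[OF Rs, of "weight 7 0" "weight 7 i"] c(2)[OF i] c(2)[of 0] by simp
        also have "\<dots> = c 0 * c i * ip (weight 7 0) (weight 7 i)"
          by (simp add: ip_def sum_distrib_left algebra_simps)
        finally have "c 0 * c i = 1" using weights_not_orthogonal[OF i] by simp
        then show ?thesis using c(1)[OF i] by auto
      qed
      have all: "word Rs y = (\<lambda>k. c 0 * y k)" if "y \<in> coord_space 7" for y
      proof (rule word_sign[OF _ Rs c(1) _ that])
        show "word Rs (weight 7 i) = (\<lambda>k. c 0 * weight 7 i k)" if i: "i < 7" for i
          using c(2)[OF i] unfolding same[OF i] .
      qed simp_all
      have "c 0 \<noteq> -1"
      proof
        assume "c 0 = -1"
        then have "sign_character Rs = -1" using all by (intro sign_character_minus) (simp add: neg_def)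
        then show False using sgn by simp
      qed
      then have "c 0 = 1" using c(1)[of 0] by simp
      then show ?thesis using all[OF x] by simp
    qed
  qed simp
qed

lemma min_perm_degree_eqI:
  assumes "\<exists>\<phi>. \<phi> \<in> mon G (sym_group d)" and "\<And>\<phi> m. \<phi> \<in> mon G (sym_group m) \<Longrightarrow> d \<le> m"
  shows "min_perm_degree G = d"
  unfolding min_perm_degree_def using assms by (intro Least_equality) auto

theorem proposition5p2:
  shows "min_perm_degree (W_E 6) = 27
       \<and> min_perm_degree (W_E 7) = 30
       \<and> min_perm_degree (W_E 8) = 240"
proof (intro conjI)
  show "min_perm_degree (W_E 6) = 27" by (rule min_perm_degree_eqI[OF E6_upper_bound]) (rule E6_lower_bound)
  show "min_perm_degree (W_E 7) = 30" by (rule min_perm_degree_eqI[OF E7_upper_bound]) (rule E7_lower_bound)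
  show "min_perm_degree (W_E 8) = 240" by (rule min_perm_degree_eqI[OF E8_upper_bound]) (rule E8_lower_bound)
qed

end
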